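(* Let $\mathbf{k}$ be a commutative ring. (a) There is a connected graded $\mathbf{k}$-Hopf algebra $H$ such that the family $$(p_{\alpha,\sigma})_{k\in\mathbb{N};\ \alpha\text{ is a composition of length }k;\ \sigma\in\mathfrak{S}_k}$$ of endomorphisms of $H$ is $\mathbf{k}$-linearly independent, and such that each graded component $H_n$ is a free $\mathbf{k}$-module. (b) Let $n\in\mathbb{N}$. Then there is a connected graded $\mathbf{k}$-Hopf algebra $H$ such that the family $$(p_{\alpha,\sigma})_{k\in\mathbb{N};\ \alpha\text{ is a composition of length }k\text{ and size }<n;\ \sigma\in\mathfrak{S}_k}$$ of endomorphisms of $H$ is $\mathbf{k}$-linearly independent, and such that each graded component $H_m$ is a free $\mathbf{k}$-module with a finite basis.
   Context: $\mathbb{N}=\{0,1,2,\ldots\}$; $[k]=\{1,2,\ldots,k\}$; $\mathfrak{S}_k$ is the group of permutations of $[k]$. All structures are over the commutative ring $\mathbf{k}$. "Graded" means $\mathbb{N}$-graded; a graded bialgebra $H=\bigoplus_{n\in\mathbb{N}}H_n$ is a bialgebra whose multiplication, unit, comultiplication and counit are graded maps (no sign twists in tensor products). It is connected if $H_0=\mathbf{k}\cdot 1_H$; any connected graded bialgebra is automatically a Hopf algebra. $p_n:H\to H$ is the canonical projection onto the $n$-th graded component $H_n$. The maps $m^{[k]}:H^{\otimes k}\to H$ and $\Delta^{[k]}:H\to H^{\otimes k}$ are the $k$-fold iterated multiplication and comultiplication ($m^{[0]}=u$ is the unit map, $\Delta^{[0]}=\epsilon$ is the counit). The group $\mathfrak{S}_k$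 acts on $H^{\otimes k}$ from the left by $\sigma\cdot(h_1\otimes\cdots\otimes h_k)=h_{\sigma^{-1}(1)}\otimes\cdots\otimes h_{\sigma^{-1}(k)}$. A composition is a finite tuple of positive integers; its length is its number of entries and its size is the sum of its entries. For a tuple $\alpha=(\alpha_1,\ldots,\alpha_k)\in\mathbb{N}^k$, let $P_\alpha:=p_{\alpha_1}\otimes\cdots\otimes p_{\alpha_k}$. For $\alpha\in\mathbb{N}^k$ and $\sigma\in\mathfrak{S}_k$, define $p_{\alpha,\sigma}:=m^{[k]}\circ P_\alpha\circ\sigma^{-1}\circ\Delta^{[k]}:H\to H$, where $\sigma^{-1}$ means the action of $\sigma^{-1}$ on $H^{\otimes k}$. *)

theory Defs
  imports "HOL-Algebra.Module" "HOL-Algebra.AbelCoset" "HOL-Combinatorics.Permutations"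
begin

section \<open>Modules: linear maps, quotients, free modules, linear independence\<close>

definition linear_maps ::
  "('a, 'r) ring_scheme \<Rightarrow> ('a, 'b, 'm) module_scheme \<Rightarrow> ('a, 'c, 'n) module_scheme \<Rightarrow> ('b \<Rightarrow> 'c) set"
  where "linear_maps R M N =
    {f \<in> carrier M \<rightarrow> carrier N.
      (\<forall>x\<in>carrier M. \<forall>y\<in>carrier M. f (x \<oplus>\<^bsub>M\<^esub> y) = f x \<oplus>\<^bsub>N\<^esub> f y) \<and>
      (\<forall>a\<in>carrier R. \<forall>x\<in>carrier M. f (a \<odot>\<^bsub>M\<^esub> x) = a \<odot>\<^bsub>N\<^esub> f x)}"

definition regular_module :: "('a, 'r) ring_scheme \<Rightarrow> ('a, 'a) module"
  where "regular_module R =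
    \<lparr>carrier = carrier R, monoid.mult = monoid.mult R, one = one R, zero = zero R, add = add R, smult = monoid.mult R\<rparr>"

definition submodule_span ::
  "('a, 'r) ring_scheme \<Rightarrow> ('a, 'b, 'm) module_scheme \<Rightarrow> 'b set \<Rightarrow> 'b set"
  where "submodule_span R M S = \<Inter>{N. submodule N R M \<and> S \<subseteq> N}"

text \<open>The record type for modules carries ring multiplication fields that the notion of a module
  does not use; they are left \<^const>\<open>undefined\<close> here and in the free module below.\<close>

definition quotient_module ::
  "('a, 'b, 'm) module_scheme \<Rightarrow> 'b set \<Rightarrow> ('a, 'b set) module"
  where "quotient_module M N =
    \<lparr>carrier = a_rcosets\<^bsub>M\<^esub> N, monoid.mult = undefined, one = undefined, zero = N, add = set_add M,
     smult = (\<lambda>a X. \<Union>x\<in>X. N +>\<^bsub>M\<^esub> (a \<odot>\<^bsub>M\<^esub> x))\<rparr>"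

definition free_module_on :: "('a, 'r) ring_scheme \<Rightarrow> 's set \<Rightarrow> ('a, 's \<Rightarrow> 'a) module"
  where "free_module_on R S =
    \<lparr>carrier = {f. (\<forall>s. f s \<in> carrier R) \<and> finite {s. f s \<noteq> \<zero>\<^bsub>R\<^esub>} \<and> {s. f s \<noteq> \<zero>\<^bsub>R\<^esub>} \<subseteq> S},
     monoid.mult = undefined, one = undefined, zero = (\<lambda>_. \<zero>\<^bsub>R\<^esub>),
     add = (\<lambda>f g s. f s \<oplus>\<^bsub>R\<^esub> g s), smult = (\<lambda>a f s. a \<otimes>\<^bsub>R\<^esub> f s)\<rparr>"

definition free_gen :: "('a, 'r) ring_scheme \<Rightarrow> 's \<Rightarrow> 's \<Rightarrow> 'a"
  where "free_gen R s = (\<lambda>t. if t = s then \<one>\<^bsub>R\<^esub> else \<zero>\<^bsub>R\<^esub>)"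

definition lin_indep_family ::
  "('a, 'r) ring_scheme \<Rightarrow> ('a, 'b, 'm) module_scheme \<Rightarrow> 'i set \<Rightarrow> ('i \<Rightarrow> 'b) \<Rightarrow> bool"
  where "lin_indep_family R M I v \<longleftrightarrow>
    (\<forall>J c. finite J \<and> J \<subseteq> I \<and> c \<in> J \<rightarrow> carrier R \<and>
        (\<Oplus>\<^bsub>M\<^esub>i\<in>J. c i \<odot>\<^bsub>M\<^esub> v i) = \<zero>\<^bsub>M\<^esub> \<longrightarrow> (\<forall>i\<in>J. c i = \<zero>\<^bsub>R\<^esub>))"

text \<open>Linear independence of a family of endomorphisms of the module \<open>M\<close>: a linear combination of
  endomorphisms is zero iff it vanishes at every element of \<open>M\<close>.\<close>

definition lin_indep_endos ::
  "('a, 'r) ring_scheme \<Rightarrow> ('a, 'b, 'm) module_scheme \<Rightarrow> 'i set \<Rightarrow> ('i \<Rightarrow> 'b \<Rightarrow> 'b) \<Rightarrow> bool"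
  where "lin_indep_endos R M I f \<longleftrightarrow>
    (\<forall>J c. finite J \<and> J \<subseteq> I \<and> c \<in> J \<rightarrow> carrier R \<and>
        (\<forall>x\<in>carrier M. (\<Oplus>\<^bsub>M\<^esub>i\<in>J. c i \<odot>\<^bsub>M\<^esub> f i x) = \<zero>\<^bsub>M\<^esub>) \<longrightarrow> (\<forall>i\<in>J. c i = \<zero>\<^bsub>R\<^esub>))"

definition module_basis ::
  "('a, 'r) ring_scheme \<Rightarrow> ('a, 'b, 'm) module_scheme \<Rightarrow> 'b set \<Rightarrow> bool"
  where "module_basis R M B \<longleftrightarrow>
    B \<subseteq> carrier M \<and> lin_indep_family R M B (\<lambda>b. b) \<and>
    (\<forall>x\<in>carrier M. \<exists>J c. finite J \<and> J \<subseteq> B \<and> c \<in> J \<rightarrow> carrier R \<and> x = (\<Oplus>\<^bsub>M\<^esub>b\<in>J. c b \<odot>\<^bsub>M\<^esub> b))"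


section \<open>Tensor powers of a module\<close>

text \<open>The \<open>k\<close>-th tensor power of \<open>M\<close> is the free module on the \<open>k\<close>-tuples (lists of length \<open>k\<close>) of
  elements of \<open>M\<close>, modulo the relations of multilinearity. Its elements are cosets of finitely
  supported functions on lists. In particular, concatenation of lists induces the identification
  of the tensor product of the \<open>k\<close>-th and the \<open>l\<close>-th tensor power with the \<open>(k + l)\<close>-th one, and the
  tensor power for \<open>k = 0\<close> is the base ring (generated by the empty tensor).\<close>

definition tuples :: "('b, 'm) partial_object_scheme \<Rightarrow> nat \<Rightarrow> 'b list set"
  where "tuples M k = {xs. length xs = k \<and> set xs \<subseteq> carrier M}"

definition tensor_relations ::
  "('a, 'r) ring_scheme \<Rightarrow> ('a, 'b, 'm) module_scheme \<Rightarrow> nat \<Rightarrow> ('b list \<Rightarrow> 'a) set"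
  where "tensor_relations R M k = (let F = free_module_on R (tuples M k) in
    {free_gen R (xs[i := x \<oplus>\<^bsub>M\<^esub> y]) \<ominus>\<^bsub>F\<^esub> (free_gen R (xs[i := x]) \<oplus>\<^bsub>F\<^esub> free_gen R (xs[i := y])) | xs i x y.
       xs \<in> tuples M k \<and> i < k \<and> x \<in> carrier M \<and> y \<in> carrier M} \<union>
    {free_gen R (xs[i := a \<odot>\<^bsub>M\<^esub> x]) \<ominus>\<^bsub>F\<^esub> (a \<odot>\<^bsub>F\<^esub> free_gen R (xs[i := x])) | xs i a x.
       xs \<in> tuples M k \<and> i < k \<and> a \<in> carrier R \<and> x \<in> carrier M})"

definition tensor_null ::
  "('a, 'r) ring_scheme \<Rightarrow> ('a, 'b, 'm) module_scheme \<Rightarrow> nat \<Rightarrow> ('b list \<Rightarrow> 'a) set"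
  where "tensor_null R M k =
    submodule_span R (free_module_on R (tuples M k)) (tensor_relations R M k)"

definition tensor_power ::
  "('a, 'r) ring_scheme \<Rightarrow> ('a, 'b, 'm) module_scheme \<Rightarrow> nat \<Rightarrow> ('a, ('b list \<Rightarrow> 'a) set) module"
  where "tensor_power R M k =
    quotient_module (free_module_on R (tuples M k)) (tensor_null R M k)"

definition pure_tensor ::
  "('a, 'r) ring_scheme \<Rightarrow> ('a, 'b, 'm) module_scheme \<Rightarrow> 'b list \<Rightarrow> ('b list \<Rightarrow> 'a) set"
  where "pure_tensor R M xs = (let k = length xs in
    tensor_null R M k +>\<^bsub>free_module_on R (tuples M k)\<^esub> free_gen R xs)"

text \<open>The linear map to \<open>N\<close> induced by a multilinear map \<open>f\<close> on tuples: all representatives of the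
  coset \<open>X\<close> have the same image under the linear extension of \<open>f\<close>, and \<open>f\<close> is only meaningful here
  if it is multilinear.\<close>

definition tensor_lift ::
  "('a, 'r) ring_scheme \<Rightarrow> ('a, 'c, 'n) module_scheme \<Rightarrow> ('b list \<Rightarrow> 'c) \<Rightarrow> ('b list \<Rightarrow> 'a) set \<Rightarrow> 'c"
  where "tensor_lift R N f X =
    the_elem ((\<lambda>t. \<Oplus>\<^bsub>N\<^esub>xs\<in>{xs. t xs \<noteq> \<zero>\<^bsub>R\<^esub>}. t xs \<odot>\<^bsub>N\<^esub> f xs) ` X)"

definition tensor_append ::
  "('a, 'r) ring_scheme \<Rightarrow> ('a, 'b, 'm) module_scheme \<Rightarrow> nat \<Rightarrow> nat \<Rightarrow>
   ('b list \<Rightarrow> 'a) set \<Rightarrow> ('b list \<Rightarrow> 'a) set \<Rightarrow> ('b list \<Rightarrow> 'a) set"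
  where "tensor_append R M k l X Y =
    tensor_lift R (tensor_power R M (k + l))
      (\<lambda>xs. tensor_lift R (tensor_power R M (k + l)) (\<lambda>ys. pure_tensor R M (xs @ ys)) Y) X"

text \<open>The componentwise product on the tensor square of an algebra, without sign twists:
  \<open>(x1 \<otimes> x2) (y1 \<otimes> y2) = x1 y1 \<otimes> x2 y2\<close>.\<close>

definition tensor_square_mult ::
  "('a, 'r) ring_scheme \<Rightarrow> ('a, 'b, 'm) module_scheme \<Rightarrow>
   ('b list \<Rightarrow> 'a) set \<Rightarrow> ('b list \<Rightarrow> 'a) set \<Rightarrow> ('b list \<Rightarrow> 'a) set"
  where "tensor_square_mult R M X Y =
    tensor_lift R (tensor_power R M 2)
      (\<lambda>xs. tensor_lift R (tensor_power R M 2)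
        (\<lambda>ys. pure_tensor R M [xs ! 0 \<otimes>\<^bsub>M\<^esub> ys ! 0, xs ! 1 \<otimes>\<^bsub>M\<^esub> ys ! 1]) Y) X"

definition tensor_map ::
  "('a, 'r) ring_scheme \<Rightarrow> ('a, 'b, 'm) module_scheme \<Rightarrow> ('b \<Rightarrow> 'b) list \<Rightarrow>
   ('b list \<Rightarrow> 'a) set \<Rightarrow> ('b list \<Rightarrow> 'a) set"
  where "tensor_map R M fs =
    tensor_lift R (tensor_power R M (length fs))
      (\<lambda>xs. pure_tensor R M (map (\<lambda>i. (fs ! i) (xs ! i)) [0..<length fs]))"

text \<open>The left action \<open>\<sigma> \<cdot> (h\<^sub>1 \<otimes> \<dots> \<otimes> h\<^sub>k) = h\<^bsub>\<sigma>\<^sup>-\<^sup>1(1)\<^esub> \<otimes> \<dots> \<otimes> h\<^bsub>\<sigma>\<^sup>-\<^sup>1(k)\<^esub>\<close> of the permutations \<open>\<sigma>\<close> of \<open>{1..k}\<close>.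
  List positions start at \<open>0\<close>, whence the shift by one.\<close>

definition perm_action ::
  "('a, 'r) ring_scheme \<Rightarrow> ('a, 'b, 'm) module_scheme \<Rightarrow> nat \<Rightarrow> (nat \<Rightarrow> nat) \<Rightarrow>
   ('b list \<Rightarrow> 'a) set \<Rightarrow> ('b list \<Rightarrow> 'a) set"
  where "perm_action R M k \<sigma> =
    tensor_lift R (tensor_power R M k)
      (\<lambda>xs. pure_tensor R M (map (\<lambda>i. xs ! (Hilbert_Choice.inv \<sigma> i - 1)) [1..<Suc k]))"


section \<open>Connected graded Hopf algebras\<close>

locale unital_algebra = module + ring M +
  assumes smult_mult_left:
      "\<lbrakk>a \<in> carrier R; x \<in> carrier M; y \<in> carrier M\<rbrakk> \<Longrightarrow>
        (a \<odot>\<^bsub>M\<^esub> x) \<otimes>\<^bsub>M\<^esub> y = a \<odot>\<^bsub>M\<^esub> (x \<otimes>\<^bsub>M\<^esub> y)"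
    and smult_mult_right:
      "\<lbrakk>a \<in> carrier R; x \<in> carrier M; y \<in> carrier M\<rbrakk> \<Longrightarrow>
        x \<otimes>\<^bsub>M\<^esub> (a \<odot>\<^bsub>M\<^esub> y) = a \<odot>\<^bsub>M\<^esub> (x \<otimes>\<^bsub>M\<^esub> y)"

text \<open>Since HOL cannot quantify existentially over types, an existence statement about such
  structures has to name the type \<open>'b\<close> containing the carrier. The type \<open>(nat \<times> nat) list \<Rightarrow> 'a\<close>
  is large enough for every \<open>R\<close>-module that has a countable basis: up to isomorphism, such a module
  consists of finitely supported functions.\<close>

record ('a, 'b) graded_bialg = "('a, 'b) module" +
  comult :: "'b \<Rightarrow> ('b list \<Rightarrow> 'a) set"
  counit :: "'b \<Rightarrow> 'a"
  graded_part :: "nat \<Rightarrow> 'b set"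

locale coalgebra = module R H
  for R :: "('a, 'r) ring_scheme" (structure) and H :: "('a, 'b, 'm) graded_bialg_scheme" (structure) +
  assumes comult_linear: "comult H \<in> linear_maps R H (tensor_power R H 2)"
    and counit_linear: "counit H \<in> linear_maps R H (regular_module R)"
    and coassoc:
      "h \<in> carrier H \<Longrightarrow>
        tensor_lift R (tensor_power R H 3)
          (\<lambda>xs. tensor_append R H 2 1 (comult H (xs ! 0)) (pure_tensor R H [xs ! 1])) (comult H h) =
        tensor_lift R (tensor_power R H 3)
          (\<lambda>xs. tensor_append R H 1 2 (pure_tensor R H [xs ! 0]) (comult H (xs ! 1))) (comult H h)"
    and counit_left:
      "h \<in> carrier H \<Longrightarrow> tensor_lift R H (\<lambda>xs. counit H (xs ! 0) \<odot>\<^bsub>H\<^esub> xs ! 1) (comult H h) = h"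
    and counit_right:
      "h \<in> carrier H \<Longrightarrow> tensor_lift R H (\<lambda>xs. counit H (xs ! 1) \<odot>\<^bsub>H\<^esub> xs ! 0) (comult H h) = h"

locale bialgebra = unital_algebra R H + coalgebra R H
  for R :: "('a, 'r) ring_scheme" (structure) and H :: "('a, 'b, 'm) graded_bialg_scheme" (structure) +
  assumes comult_mult:
      "\<lbrakk>x \<in> carrier H; y \<in> carrier H\<rbrakk> \<Longrightarrow>
        comult H (x \<otimes>\<^bsub>H\<^esub> y) = tensor_square_mult R H (comult H x) (comult H y)"
    and comult_one: "comult H \<one>\<^bsub>H\<^esub> = pure_tensor R H [\<one>\<^bsub>H\<^esub>, \<one>\<^bsub>H\<^esub>]"
    and counit_mult:
      "\<lbrakk>x \<in> carrier H; y \<in> carrier H\<rbrakk> \<Longrightarrow> counit H (x \<otimes>\<^bsub>H\<^esub> y) = counit H x \<otimes>\<^bsub>R\<^esub> counit H y"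
    and counit_one: "counit H \<one>\<^bsub>H\<^esub> = \<one>\<^bsub>R\<^esub>"

definition homogeneous_decomp ::
  "('a, 'b, 'm) graded_bialg_scheme \<Rightarrow> 'b \<Rightarrow> (nat \<Rightarrow> 'b) \<Rightarrow> bool"
  where "homogeneous_decomp H h f \<longleftrightarrow>
    (\<forall>n. f n \<in> graded_part H n) \<and> finite {n. f n \<noteq> \<zero>\<^bsub>H\<^esub>} \<and>
    h = (\<Oplus>\<^bsub>H\<^esub>n\<in>{n. f n \<noteq> \<zero>\<^bsub>H\<^esub>}. f n)"

locale graded_bialgebra = bialgebra R H
  for R :: "('a, 'r) ring_scheme" (structure) and H :: "('a, 'b, 'm) graded_bialg_scheme" (structure) +
  assumes graded_part_submodule: "submodule (graded_part H n) R H"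
    and direct_sum: "h \<in> carrier H \<Longrightarrow> \<exists>!f. homogeneous_decomp H h f"
    and mult_graded:
      "\<lbrakk>x \<in> graded_part H i; y \<in> graded_part H j\<rbrakk> \<Longrightarrow> x \<otimes>\<^bsub>H\<^esub> y \<in> graded_part H (i + j)"
    and one_graded: "\<one>\<^bsub>H\<^esub> \<in> graded_part H 0"
    and comult_graded:
      "h \<in> graded_part H n \<Longrightarrow>
        comult H h \<in> submodule_span R (tensor_power R H 2)
          {pure_tensor R H [x, y] | x y i j. i + j = n \<and> x \<in> graded_part H i \<and> y \<in> graded_part H j}"
    and counit_graded: "\<lbrakk>h \<in> graded_part H n; n > 0\<rbrakk> \<Longrightarrow> counit H h = \<zero>\<^bsub>R\<^esub>"

definition is_antipode ::
  "('a, 'r) ring_scheme \<Rightarrow> ('a, 'b, 'm) graded_bialg_scheme \<Rightarrow> ('b \<Rightarrow> 'b) \<Rightarrow> bool"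
  where "is_antipode R H S \<longleftrightarrow> S \<in> linear_maps R H H \<and>
    (\<forall>h\<in>carrier H.
      tensor_lift R H (\<lambda>xs. S (xs ! 0) \<otimes>\<^bsub>H\<^esub> xs ! 1) (comult H h) = counit H h \<odot>\<^bsub>H\<^esub> \<one>\<^bsub>H\<^esub> \<and>
      tensor_lift R H (\<lambda>xs. xs ! 0 \<otimes>\<^bsub>H\<^esub> S (xs ! 1)) (comult H h) = counit H h \<odot>\<^bsub>H\<^esub> \<one>\<^bsub>H\<^esub>)"

locale connected_graded_hopf_algebra = graded_bialgebra R H
  for R :: "('a, 'r) ring_scheme" (structure) and H :: "('a, 'b, 'm) graded_bialg_scheme" (structure) +
  assumes antipode: "\<exists>S. is_antipode R H S"
    and connected: "graded_part H 0 = {a \<odot>\<^bsub>H\<^esub> \<one>\<^bsub>H\<^esub> | a. a \<in> carrier R}"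

abbreviation component_module ::
  "('a, 'b, 'm) graded_bialg_scheme \<Rightarrow> nat \<Rightarrow> ('a, 'b, 'm) graded_bialg_scheme"
  where "component_module H n \<equiv> H\<lparr>carrier := graded_part H n\<rparr>"


section \<open>The operators \<open>p\<^bsub>\<alpha>,\<sigma>\<^esub>\<close>\<close>

definition graded_proj :: "('a, 'b, 'm) graded_bialg_scheme \<Rightarrow> nat \<Rightarrow> 'b \<Rightarrow> 'b"
  where "graded_proj H n h = (THE f. homogeneous_decomp H h f) n"

definition iter_mult ::
  "('a, 'r) ring_scheme \<Rightarrow> ('a, 'b, 'm) module_scheme \<Rightarrow> ('b list \<Rightarrow> 'a) set \<Rightarrow> 'b"
  where "iter_mult R H = tensor_lift R H (\<lambda>xs. foldr (\<otimes>\<^bsub>H\<^esub>) xs \<one>\<^bsub>H\<^esub>)"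

text \<open>\<open>\<Delta>\<^bsup>[k+1]\<^esup> = (id \<otimes> \<Delta>\<^bsup>[k]\<^esup>) \<circ> \<Delta>\<close>, starting from the counit \<open>\<Delta>\<^bsup>[0]\<^esup>\<close>.\<close>

primrec iter_comult ::
  "('a, 'r) ring_scheme \<Rightarrow> ('a, 'b, 'm) graded_bialg_scheme \<Rightarrow> nat \<Rightarrow> 'b \<Rightarrow> ('b list \<Rightarrow> 'a) set"
  where
    "iter_comult R H 0 h = counit H h \<odot>\<^bsub>tensor_power R H 0\<^esub> pure_tensor R H []"
  | "iter_comult R H (Suc k) h =
      tensor_lift R (tensor_power R H (Suc k))
        (\<lambda>xs. tensor_append R H 1 k (pure_tensor R H [xs ! 0]) (iter_comult R H k (xs ! 1)))
        (comult H h)"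

text \<open>The number \<open>k\<close> of tensor factors is the length of \<open>\<alpha>\<close>.\<close>

definition p_endo ::
  "('a, 'r) ring_scheme \<Rightarrow> ('a, 'b, 'm) graded_bialg_scheme \<Rightarrow> nat list \<Rightarrow> (nat \<Rightarrow> nat) \<Rightarrow> 'b \<Rightarrow> 'b"
  where "p_endo R H \<alpha> \<sigma> h =
    iter_mult R H
      (tensor_map R H (map (graded_proj H) \<alpha>)
        (perm_action R H (length \<alpha>) (Hilbert_Choice.inv \<sigma>)
          (iter_comult R H (length \<alpha>) h)))"

definition is_composition :: "nat list \<Rightarrow> bool"
  where "is_composition \<alpha> \<longleftrightarrow> (\<forall>a\<in>set \<alpha>. 0 < a)"

end

theory Submission
  imports Defs
begin

text \<open>Let \<open>H\<close> be the free algebra on generators \<open>x\<^bsub>ij\<^esub>\<close> for \<open>i < j\<close>, of degree \<open>j - i\<close>, with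
  \<open>\<Delta>(x\<^bsub>ij\<^esub>) = \<Sum>\<^bsub>i \<le> k \<le> j\<^esub> x\<^bsub>ik\<^esub> \<otimes> x\<^bsub>kj\<^esub>\<close> where \<open>x\<^bsub>ii\<^esub> = 1\<close>. The antipode inverts the unitriangular matrix
  of the \<open>x\<^bsub>ij\<^esub>\<close>. The iterated coproduct of \<open>x\<^bsub>0n\<^esub>\<close> is the sum over all ways to cut the interval from \<open>0\<close>
  to \<open>n\<close> into \<open>k\<close> consecutive intervals, and \<open>p\<^bsub>\<alpha>,\<sigma>\<^esub>\<close> keeps the only one of them in which the interval
  number \<open>\<sigma>(i)\<close> has length \<open>\<alpha>\<^sub>i\<close>, for all \<open>i\<close>. Hence \<open>p\<^bsub>\<alpha>,\<sigma>\<^esub>(x\<^bsub>0n\<^esub>)\<close> is a single word in the generators if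
  \<open>\<alpha>\<close> has size \<open>n\<close>, and \<open>0\<close> otherwise. Different pairs \<open>(\<alpha>, \<sigma>)\<close> give different words, and words are
  linearly independent. For part (b), the generators with \<open>j \<le> n\<close> suffice.

  Identities in tensor powers of \<open>H\<close> follow by evaluating linear maps at words and pure tensors, so no
  basis of the tensor powers is needed.\<close>

section \<open>Linear maps and submodules\<close>

text \<open>The coproduct is that of the entries of a unitriangular matrix, and its coassociativity
  reflects the associativity of matrix multiplication. Two features of the generators make the test
  words faithful. They do not commute, so a word remembers the order of the factors; with commuting
  letters, \<open>\<alpha>\<close> and \<open>\<sigma>\<close> could be permuted together without
  changing the value. They are indexed by intervals and not just by lengths, so a letter remembers
  its place in the coproduct; lengths alone would give back \<open>\<alpha>\<close> but not
  \<open>\<sigma>\<close>. The obstacle is that an element of a tensor power is a coset of functions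
  on all tuples, with no unique expansion into pure tensors. Tensor powers therefore serve only as
  places to form sums of pure tensors and as domains of linear maps. For this reason
  \<open>split_sum\<close> takes the target module and the function applied to the two pieces as
  arguments: a linear map out of the tensor square only changes these arguments. The zero ring is an
  admissible base ring, so words are told apart by evaluating functions at words.\<close>

lemma linear_mapsI:
  assumes "\<And>x. x \<in> carrier M \<Longrightarrow> f x \<in> carrier N"
    and "\<And>x y. \<lbrakk>x \<in> carrier M; y \<in> carrier M\<rbrakk> \<Longrightarrow> f (x \<oplus>\<^bsub>M\<^esub> y) = f x \<oplus>\<^bsub>N\<^esub> f y"
    and "\<And>a x. \<lbrakk>a \<in> carrier R; x \<in> carrier M\<rbrakk> \<Longrightarrow> f (a \<odot>\<^bsub>M\<^esub> x) = a \<odot>\<^bsub>N\<^esub> f x"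
  shows "f \<in> linear_maps R M N"
  using assms by (auto simp: linear_maps_def)

lemma linear_maps_closed: "\<lbrakk>f \<in> linear_maps R M N; x \<in> carrier M\<rbrakk> \<Longrightarrow> f x \<in> carrier N"
  by (auto simp: linear_maps_def)

lemma linear_maps_add:
  "\<lbrakk>f \<in> linear_maps R M N; x \<in> carrier M; y \<in> carrier M\<rbrakk> \<Longrightarrow> f (x \<oplus>\<^bsub>M\<^esub> y) = f x \<oplus>\<^bsub>N\<^esub> f y"
  by (auto simp: linear_maps_def)

lemma linear_maps_smult:
  "\<lbrakk>f \<in> linear_maps R M N; a \<in> carrier R; x \<in> carrier M\<rbrakk> \<Longrightarrow> f (a \<odot>\<^bsub>M\<^esub> x) = a \<odot>\<^bsub>N\<^esub> f x"
  by (auto simp: linear_maps_def)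

lemma linear_maps_zero:
  assumes "module R M" "module R N" "f \<in> linear_maps R M N"
  shows "f \<zero>\<^bsub>M\<^esub> = \<zero>\<^bsub>N\<^esub>"
proof -
  interpret M: module R M by fact
  interpret N: module R N by fact
  have "f (\<zero>\<^bsub>R\<^esub> \<odot>\<^bsub>M\<^esub> \<zero>\<^bsub>M\<^esub>) = \<zero>\<^bsub>R\<^esub> \<odot>\<^bsub>N\<^esub> f \<zero>\<^bsub>M\<^esub>"
    using assms(3) by (rule linear_maps_smult) auto
  then show ?thesis
    using linear_maps_closed[OF assms(3)] by simp
qed

lemma linear_maps_finsum:
  assumes "module R M" "module R N" "f \<in> linear_maps R M N" "g \<in> A \<rightarrow> carrier M"
  shows "f (\<Oplus>\<^bsub>M\<^esub>i\<in>A. g i) = (\<Oplus>\<^bsub>N\<^esub>i\<in>A. f (g i))"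
proof -
  interpret M: module R M by fact
  interpret N: module R N by fact
  note c = linear_maps_closed[OF assms(3)]
  show ?thesis
    using assms(4)
  proof (induction A rule: infinite_finite_induct)
    case (insert a A)
    then have "g a \<in> carrier M" "g \<in> A \<rightarrow> carrier M"
      by auto
    moreover from this have "(\<lambda>i. f (g i)) \<in> A \<rightarrow> carrier N"
      using c by auto
    ultimately show ?case
      using insert by (simp add: linear_maps_add[OF assms(3)] c)
  qed (simp_all add: linear_maps_zero[OF assms(1-3)])
qed

text \<open>\<open>linear_maps\<close> constrains a function on the carrier only, and the module
  axioms keep sums and multiples there. This matters for \<open>tensor_lift\<close>, which is
  controlled only for parameters in the carrier.\<close>

lemma linear_maps_cong:
  assumes "module R M" "\<And>x. x \<in> carrier M \<Longrightarrow> f x = g x"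
  shows "f \<in> linear_maps R M N \<longleftrightarrow> g \<in> linear_maps R M N"
proof -
  interpret M: module R M by fact
  show ?thesis
    by (simp add: linear_maps_def Pi_def assms(2) cong: ball_cong)
qed

lemma linear_maps_compose:
  assumes "f \<in> linear_maps R M N" "g \<in> linear_maps R N P"
  shows "(\<lambda>x. g (f x)) \<in> linear_maps R M P"
  using assms
  by (intro linear_mapsI)
    (simp_all add: linear_maps_closed[OF assms(1)] linear_maps_closed[OF assms(2)]
      linear_maps_add[OF assms(1)] linear_maps_add[OF assms(2)]
      linear_maps_smult[OF assms(1)] linear_maps_smult[OF assms(2)])

lemma linear_maps_id: "(\<lambda>x. x) \<in> linear_maps R M M"
  by (auto simp: linear_maps_def)

lemma linear_maps_const_zero:
  assumes "module R N"
  shows "(\<lambda>x. \<zero>\<^bsub>N\<^esub>) \<in> linear_maps R M N"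
proof -
  interpret N: module R N by fact
  show ?thesis
    by (auto simp: linear_maps_def)
qed

lemma linear_maps_smult_fun:
  assumes "module R N" "a \<in> carrier R" "f \<in> linear_maps R M N"
  shows "(\<lambda>x. a \<odot>\<^bsub>N\<^esub> f x) \<in> linear_maps R M N"
proof -
  interpret N: module R N by fact
  show ?thesis
    using assms(2)
    by (intro linear_mapsI)
      (simp_all add: linear_maps_closed[OF assms(3)] linear_maps_add[OF assms(3)]
        linear_maps_smult[OF assms(3)] N.smult_r_distr N.smult_assoc1[symmetric] N.R.m_comm)
qed

lemma linear_maps_finsum_fun:
  assumes "module R N" "\<And>i. i \<in> A \<Longrightarrow> f i \<in> linear_maps R M N"
  shows "(\<lambda>x. \<Oplus>\<^bsub>N\<^esub>i\<in>A. f i x) \<in> linear_maps R M N"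
proof -
  interpret N: module R N by fact
  show ?thesis
  proof (cases "finite A")
    case True
    note c = linear_maps_closed[OF assms(2)]
    show ?thesis
    proof (rule linear_mapsI)
      fix x y assume xy: "x \<in> carrier M" "y \<in> carrier M"
      have "(\<Oplus>\<^bsub>N\<^esub>i\<in>A. f i (x \<oplus>\<^bsub>M\<^esub> y)) = (\<Oplus>\<^bsub>N\<^esub>i\<in>A. f i x \<oplus>\<^bsub>N\<^esub> f i y)"
        using xy by (intro N.finsum_cong') (auto simp: linear_maps_add[OF assms(2)] c)
      also have "\<dots> = (\<Oplus>\<^bsub>N\<^esub>i\<in>A. f i x) \<oplus>\<^bsub>N\<^esub> (\<Oplus>\<^bsub>N\<^esub>i\<in>A. f i y)"
        using xy by (intro N.finsum_addf) (auto simp: c)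
      finally show "(\<Oplus>\<^bsub>N\<^esub>i\<in>A. f i (x \<oplus>\<^bsub>M\<^esub> y)) = (\<Oplus>\<^bsub>N\<^esub>i\<in>A. f i x) \<oplus>\<^bsub>N\<^esub> (\<Oplus>\<^bsub>N\<^esub>i\<in>A. f i y)" .
    next
      fix a x assume ax: "a \<in> carrier R" "x \<in> carrier M"
      show "(\<Oplus>\<^bsub>N\<^esub>i\<in>A. f i (a \<odot>\<^bsub>M\<^esub> x)) = a \<odot>\<^bsub>N\<^esub> (\<Oplus>\<^bsub>N\<^esub>i\<in>A. f i x)"
        using ax True
        by (subst N.finsum_smult_ldistr)
          (auto intro!: N.finsum_cong' simp: linear_maps_smult[OF assms(2)] c)
    qed (auto intro!: N.finsum_closed simp: c)
  qed (simp add: N.finsum_infinite linear_maps_const_zero[OF assms(1)])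
qed

lemma (in module) submodule_finsum_closed:
  assumes "submodule N R M" "g \<in> A \<rightarrow> N"
  shows "(\<Oplus>\<^bsub>M\<^esub>i\<in>A. g i) \<in> N"
proof -
  have zero: "\<zero>\<^bsub>M\<^esub> \<in> N"
    using subgroup.one_closed[OF submodule.axioms(1)[OF assms(1)]] by simp
  have sub: "N \<subseteq> carrier M"
    using submoduleE(1)[OF assms(1)] .
  show ?thesis
    using assms(2)
  proof (induction A rule: infinite_finite_induct)
    case (insert a A)
    then have "g \<in> A \<rightarrow> carrier M" "g a \<in> carrier M"
      using sub by auto
    with insert show ?case
      using submoduleE(5)[OF assms(1)] by simp
  qed (simp_all add: zero)
qed

text \<open>The source of the extension arguments below: linear maps that agree on generators agree
  on the submodule generated by them. With the zero map as \<open>g\<close> it says that kernels are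
  submodules.\<close>

lemma submodule_equalizer:
  assumes "module R M" "module R N" "f \<in> linear_maps R M N" "g \<in> linear_maps R M N"
  shows "submodule {x \<in> carrier M. f x = g x} R M"
proof -
  interpret M: module R M by fact
  interpret N: module R N by fact
  \<comment> \<open>\<open>submoduleI\<close> asks for closure under negation; linearity as defined
    provides it through multiplication by minus one.\<close>
  have minus: "h (\<ominus>\<^bsub>M\<^esub> x) = \<ominus>\<^bsub>R\<^esub> \<one>\<^bsub>R\<^esub> \<odot>\<^bsub>N\<^esub> h x"
    if "x \<in> carrier M" "h \<in> linear_maps R M N" for x h
    using linear_maps_smult[OF that(2), of "\<ominus>\<^bsub>R\<^esub> \<one>\<^bsub>R\<^esub>" x] that(1)
    by (simp add: M.smult_l_minus)
  show ?thesis
    by (rule M.submoduleI)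
      (auto simp: linear_maps_add[OF assms(3)] linear_maps_add[OF assms(4)]
        linear_maps_smult[OF assms(3)] linear_maps_smult[OF assms(4)]
        minus[OF _ assms(3)] minus[OF _ assms(4)]
        linear_maps_zero[OF assms(1,2,3)] linear_maps_zero[OF assms(1,2,4)])
qed

lemma submodule_preimage:
  assumes "module R M" "module R N" "f \<in> linear_maps R M N" "submodule K R N"
  shows "submodule {x \<in> carrier M. f x \<in> K} R M"
proof -
  interpret M: module R M by fact
  interpret N: module R N by fact
  have zero: "\<zero>\<^bsub>N\<^esub> \<in> K"
    using subgroup.one_closed[OF submodule.axioms(1)[OF assms(4)]] by simp
  have minus: "f (\<ominus>\<^bsub>M\<^esub> x) = \<ominus>\<^bsub>R\<^esub> \<one>\<^bsub>R\<^esub> \<odot>\<^bsub>N\<^esub> f x" if "x \<in> carrier M" for x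
    using linear_maps_smult[OF assms(3), of "\<ominus>\<^bsub>R\<^esub> \<one>\<^bsub>R\<^esub>" x] that
    by (simp add: M.smult_l_minus)
  show ?thesis
    by (rule M.submoduleI)
      (auto simp: linear_maps_add[OF assms(3)] linear_maps_smult[OF assms(3)] minus zero
        linear_maps_zero[OF assms(1,2,3)] N.submoduleE[OF assms(4)])
qed

lemma submodule_span_submodule:
  assumes "module R M" "S \<subseteq> carrier M"
  shows "submodule (submodule_span R M S) R M"
proof -
  interpret M: module R M by fact
  \<comment> \<open>The carrier belongs to the family being intersected. This is where
    \<open>S \<subseteq> carrier M\<close> enters, and it keeps the intersection inside
    \<open>M\<close>.\<close>
  note ne = M.carrier_is_submodule
  have zero: "\<zero>\<^bsub>M\<^esub> \<in> N" if "submodule N R M" for N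
    using subgroup.one_closed[OF submodule.axioms(1)[OF that]] by simp
  show ?thesis
    unfolding submodule_span_def
    by (rule M.submoduleI) (use ne assms(2) in \<open>auto simp: M.submoduleE zero\<close>)
qed

lemma submodule_span_superset: "S \<subseteq> submodule_span R M S"
  by (auto simp: submodule_span_def)

lemma submodule_span_least: "\<lbrakk>submodule N R M; S \<subseteq> N\<rbrakk> \<Longrightarrow> submodule_span R M S \<subseteq> N"
  by (auto simp: submodule_span_def)


section \<open>Free modules\<close>

text \<open>The sum has exactly the shape of the one inside \<open>tensor_lift\<close>, so that
  \<open>tensor_lift\<close> picks the element of the image of a coset under
  \<open>lin_ext\<close>.\<close>

definition lin_ext ::
  "('a, 'r) ring_scheme \<Rightarrow> ('a, 'c, 'n) module_scheme \<Rightarrow> ('s \<Rightarrow> 'c) \<Rightarrow> ('s \<Rightarrow> 'a) \<Rightarrow> 'c"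
  where "lin_ext R N \<phi> t = (\<Oplus>\<^bsub>N\<^esub>s\<in>{s. t s \<noteq> \<zero>\<^bsub>R\<^esub>}. t s \<odot>\<^bsub>N\<^esub> \<phi> s)"

lemma free_module_on_simps [simp]:
  "zero (free_module_on R S) = (\<lambda>_. \<zero>\<^bsub>R\<^esub>)"
  "add (free_module_on R S) = (\<lambda>f g s. f s \<oplus>\<^bsub>R\<^esub> g s)"
  "smult (free_module_on R S) = (\<lambda>a f s. a \<otimes>\<^bsub>R\<^esub> f s)"
  by (simp_all add: free_module_on_def)

lemma free_module_on_carrier:
  "f \<in> carrier (free_module_on R S) \<longleftrightarrow>
    (\<forall>s. f s \<in> carrier R) \<and> finite {s. f s \<noteq> \<zero>\<^bsub>R\<^esub>} \<and> {s. f s \<noteq> \<zero>\<^bsub>R\<^esub>} \<subseteq> S"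
  by (simp add: free_module_on_def)

lemma free_module_on_module:
  assumes "cring R"
  shows "module R (free_module_on R S)"
proof -
  interpret cring R by fact
  show ?thesis
  proof (rule moduleI)
    show "abelian_group (free_module_on R S)"
    proof (rule abelian_groupI)
      fix x assume x: "x \<in> carrier (free_module_on R S)"
      then have "(\<lambda>s. \<ominus>\<^bsub>R\<^esub> x s) \<in> carrier (free_module_on R S)"
        by (auto simp: free_module_on_carrier elim!: finite_subset[rotated])
      then show "\<exists>y\<in>carrier (free_module_on R S). y \<oplus>\<^bsub>free_module_on R S\<^esub> x = \<zero>\<^bsub>free_module_on R S\<^esub>"
        by (rule rev_bexI) (use x in \<open>auto simp: free_module_on_carrier l_neg\<close>)
    next
      fix x y assume "x \<in> carrier (free_module_on R S)" "y \<in> carrier (free_module_on R S)"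
      moreover have "{s. x s \<oplus>\<^bsub>R\<^esub> y s \<noteq> \<zero>\<^bsub>R\<^esub>} \<subseteq> {s. x s \<noteq> \<zero>\<^bsub>R\<^esub>} \<union> {s. y s \<noteq> \<zero>\<^bsub>R\<^esub>}"
        by auto
      ultimately show "x \<oplus>\<^bsub>free_module_on R S\<^esub> y \<in> carrier (free_module_on R S)"
        by (auto simp: free_module_on_carrier dest: finite_subset)
    qed (auto simp: free_module_on_carrier a_ac)
  next
    fix a x assume "a \<in> carrier R" "x \<in> carrier (free_module_on R S)"
    moreover from this have "{s. a \<otimes>\<^bsub>R\<^esub> x s \<noteq> \<zero>\<^bsub>R\<^esub>} \<subseteq> {s. x s \<noteq> \<zero>\<^bsub>R\<^esub>}"
      by auto
    ultimately show "a \<odot>\<^bsub>free_module_on R S\<^esub> x \<in> carrier (free_module_on R S)"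
      by (auto simp: free_module_on_carrier dest: finite_subset)
  qed (use assms in \<open>auto simp: free_module_on_carrier l_distr r_distr m_assoc\<close>)
qed

lemma free_gen_closed:
  assumes "cring R" "s \<in> S"
  shows "free_gen R s \<in> carrier (free_module_on R S)"
proof -
  interpret cring R by fact
  show ?thesis
    using assms(2) by (auto simp: free_module_on_carrier free_gen_def)
qed

text \<open>Terms outside the support vanish. The freedom in \<open>A\<close> is what makes
  additivity work: the support of a sum depends on cancellation, while the union of the two supports
  serves all three elements. Inside \<open>S\<close> the values of \<open>\<phi>\<close> are known
  to lie in \<open>N\<close>.\<close>

lemma lin_ext_superset:
  assumes "module R N" "\<phi> \<in> S \<rightarrow> carrier N" "t \<in> carrier (free_module_on R S)"
    and "finite A" "{s. t s \<noteq> \<zero>\<^bsub>R\<^esub>} \<subseteq> A" "A \<subseteq> S"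
  shows "lin_ext R N \<phi> t = (\<Oplus>\<^bsub>N\<^esub>s\<in>A. t s \<odot>\<^bsub>N\<^esub> \<phi> s)"
proof -
  interpret N: module R N by fact
  have "\<phi> s \<in> carrier N" if "s \<in> A" for s
    using assms that by auto
  then show ?thesis
    unfolding lin_ext_def
    by (intro N.add.finprod_mono_neutral_cong_left) (use assms in \<open>auto simp: free_module_on_carrier\<close>)
qed

lemma lin_ext_linear:
  assumes "module R N" "\<phi> \<in> S \<rightarrow> carrier N"
  shows "lin_ext R N \<phi> \<in> linear_maps R (free_module_on R S) N"
proof -
  interpret N: module R N by fact
  interpret F: module R "free_module_on R S"
    by (rule free_module_on_module) (rule N.R.is_cring)
  have fin: "finite {s. t s \<noteq> \<zero>\<^bsub>R\<^esub>}" and sub: "{s. t s \<noteq> \<zero>\<^bsub>R\<^esub>} \<subseteq> S" and val: "t s \<in> carrier R"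
    if "t \<in> carrier (free_module_on R S)" for t s
    using that by (auto simp: free_module_on_carrier)
  have \<phi>: "\<phi> s \<in> carrier N" if "s \<in> S" for s
    using assms(2) that by auto
  show ?thesis
  proof (rule linear_mapsI)
    fix t assume t: "t \<in> carrier (free_module_on R S)"
    show "lin_ext R N \<phi> t \<in> carrier N"
      unfolding lin_ext_def using sub[OF t] val[OF t] \<phi> by (auto intro!: N.finsum_closed)
  next
    fix t u assume t: "t \<in> carrier (free_module_on R S)" and u: "u \<in> carrier (free_module_on R S)"
    let ?A = "{s. t s \<noteq> \<zero>\<^bsub>R\<^esub>} \<union> {s. u s \<noteq> \<zero>\<^bsub>R\<^esub>}"
    have A: "finite ?A" "?A \<subseteq> S"
      using fin sub t u by auto
    have "lin_ext R N \<phi> (t \<oplus>\<^bsub>free_module_on R S\<^esub> u) =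
        (\<Oplus>\<^bsub>N\<^esub>s\<in>?A. (t s \<oplus>\<^bsub>R\<^esub> u s) \<odot>\<^bsub>N\<^esub> \<phi> s)"
      by (subst lin_ext_superset[OF assms _ A(1) _ A(2)]) (use t u F.a_closed[OF t u] in auto)
    also have "\<dots> = (\<Oplus>\<^bsub>N\<^esub>s\<in>?A. t s \<odot>\<^bsub>N\<^esub> \<phi> s \<oplus>\<^bsub>N\<^esub> u s \<odot>\<^bsub>N\<^esub> \<phi> s)"
      using t u A(2) \<phi> val by (intro N.finsum_cong') (auto intro!: N.smult_l_distr)
    also have "\<dots> = (\<Oplus>\<^bsub>N\<^esub>s\<in>?A. t s \<odot>\<^bsub>N\<^esub> \<phi> s) \<oplus>\<^bsub>N\<^esub> (\<Oplus>\<^bsub>N\<^esub>s\<in>?A. u s \<odot>\<^bsub>N\<^esub> \<phi> s)"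
      by (intro N.finsum_addf) (use t u A(2) \<phi> val in \<open>blast intro!: N.smult_closed\<close>)+
    also have "\<dots> = lin_ext R N \<phi> t \<oplus>\<^bsub>N\<^esub> lin_ext R N \<phi> u"
      using lin_ext_superset[OF assms t A(1) _ A(2)] lin_ext_superset[OF assms u A(1) _ A(2)] by auto
    finally show "lin_ext R N \<phi> (t \<oplus>\<^bsub>free_module_on R S\<^esub> u) = lin_ext R N \<phi> t \<oplus>\<^bsub>N\<^esub> lin_ext R N \<phi> u" .
  next
    fix a t assume a: "a \<in> carrier R" and t: "t \<in> carrier (free_module_on R S)"
    let ?A = "{s. t s \<noteq> \<zero>\<^bsub>R\<^esub>}"
    note A = fin[OF t] sub[OF t]
    have "lin_ext R N \<phi> (a \<odot>\<^bsub>free_module_on R S\<^esub> t) = (\<Oplus>\<^bsub>N\<^esub>s\<in>?A. (a \<otimes>\<^bsub>R\<^esub> t s) \<odot>\<^bsub>N\<^esub> \<phi> s)"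
      by (subst lin_ext_superset[OF assms _ A(1) _ A(2)]) (use t a F.smult_closed[OF a t] in auto)
    also have "\<dots> = (\<Oplus>\<^bsub>N\<^esub>s\<in>?A. a \<odot>\<^bsub>N\<^esub> (t s \<odot>\<^bsub>N\<^esub> \<phi> s))"
      using t a A(2) \<phi> val by (intro N.finsum_cong') (auto intro!: N.smult_assoc1)
    also have "\<dots> = a \<odot>\<^bsub>N\<^esub> lin_ext R N \<phi> t"
      unfolding lin_ext_def
      by (subst N.finsum_smult_ldistr) (use t a A \<phi> val in \<open>blast intro!: N.smult_closed\<close>)+
    finally show "lin_ext R N \<phi> (a \<odot>\<^bsub>free_module_on R S\<^esub> t) = a \<odot>\<^bsub>N\<^esub> lin_ext R N \<phi> t" .
  qed
qed

lemma lin_ext_free_gen: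
  assumes "module R N" "\<phi> s \<in> carrier N"
  shows "lin_ext R N \<phi> (free_gen R s) = \<phi> s"
proof -
  interpret N: module R N by fact
  \<comment> \<open>Over the zero ring the support of \<open>free_gen R s\<close> is empty, so the
    sum is extended to \<open>{s}\<close> instead of computing the support.\<close>
  have "lin_ext R N \<phi> (free_gen R s) = (\<Oplus>\<^bsub>N\<^esub>s\<in>{s}. free_gen R s s \<odot>\<^bsub>N\<^esub> \<phi> s)"
    using assms N.R.is_cring
    by (subst lin_ext_superset[of R N \<phi> "{s}" _ "{s}"])
      (auto simp: free_gen_closed, auto simp: free_gen_def split: if_splits)
  also have "\<dots> = \<phi> s"
    using assms(2) by (simp add: free_gen_def)
  finally show ?thesis .
qed

text \<open>Stated for any \<open>M\<close> with pointwise addition, since it serves the free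
  module, the Hopf algebra and its graded components, which are different records.\<close>

lemma finsum_fun_apply:
  assumes "cring R" "abelian_monoid M" "add M = (\<lambda>f g s. f s \<oplus>\<^bsub>R\<^esub> g s)" "zero M = (\<lambda>_. \<zero>\<^bsub>R\<^esub>)"
    and "\<And>f s. f \<in> carrier M \<Longrightarrow> f s \<in> carrier R" "g \<in> A \<rightarrow> carrier M"
  shows "(\<Oplus>\<^bsub>M\<^esub>i\<in>A. g i) s = (\<Oplus>\<^bsub>R\<^esub>i\<in>A. g i s)"
proof -
  interpret R: cring R by fact
  interpret M: abelian_monoid M by fact
  show ?thesis
    using assms(6)
  proof (induction A rule: infinite_finite_induct)
    case (insert a A)
    then have "g a \<in> carrier M" "g \<in> A \<rightarrow> carrier M" "(\<lambda>i. g i s) \<in> A \<rightarrow> carrier R"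
      using assms(5) by auto
    with insert show ?case
      by (simp add: assms(3,5))
  qed (simp_all add: assms(4))
qed

lemma free_module_on_expand:
  assumes "cring R" "t \<in> carrier (free_module_on R S)"
  shows "t = (\<Oplus>\<^bsub>free_module_on R S\<^esub>s\<in>{s. t s \<noteq> \<zero>\<^bsub>R\<^esub>}. t s \<odot>\<^bsub>free_module_on R S\<^esub> free_gen R s)"
    (is "t = (\<Oplus>\<^bsub>?F\<^esub>s\<in>?A. ?g s)")
proof
  interpret R: cring R by fact
  interpret F: module R ?F by (rule free_module_on_module) fact
  have t: "finite ?A" "?A \<subseteq> S" "\<And>s. t s \<in> carrier R"
    using assms(2) by (auto simp: free_module_on_carrier)
  have g: "?g \<in> ?A \<rightarrow> carrier ?F"
    using t assms(1) by (intro Pi_I F.smult_closed free_gen_closed) auto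
  fix s
  have "(\<Oplus>\<^bsub>?F\<^esub>s\<in>?A. ?g s) s = (\<Oplus>\<^bsub>R\<^esub>r\<in>?A. ?g r s)"
    by (rule finsum_fun_apply[OF assms(1) F.abelian_monoid_axioms])
      (use g in \<open>auto simp: free_module_on_carrier\<close>)
  also have "\<dots> = (\<Oplus>\<^bsub>R\<^esub>r\<in>?A. if s = r then t r else \<zero>\<^bsub>R\<^esub>)"
    using t(3) by (intro R.finsum_cong') (auto simp: free_gen_def)
  also have "\<dots> = t s"
  proof (cases "s \<in> ?A")
    case True
    then show ?thesis
      by (subst R.finsum_singleton) (use t in auto)
  next
    case False
    then have "(\<Oplus>\<^bsub>R\<^esub>r\<in>?A. if s = r then t r else \<zero>\<^bsub>R\<^esub>) = \<zero>\<^bsub>R\<^esub>"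
      by (intro R.add.finprod_one_eqI) auto
    with False show ?thesis
      by simp
  qed
  finally show "t s = (\<Oplus>\<^bsub>?F\<^esub>s\<in>?A. ?g s) s"
    by simp
qed

lemma free_module_on_induct:
  assumes "cring R" "t \<in> carrier (free_module_on R S)" "submodule N R (free_module_on R S)"
    and "\<And>s. \<lbrakk>s \<in> S; t s \<noteq> \<zero>\<^bsub>R\<^esub>\<rbrakk> \<Longrightarrow> free_gen R s \<in> N"
  shows "t \<in> N"
proof -
  interpret F: module R "free_module_on R S" by (rule free_module_on_module) fact
  have t: "{s. t s \<noteq> \<zero>\<^bsub>R\<^esub>} \<subseteq> S" "\<And>s. t s \<in> carrier R"
    using assms(2) by (auto simp: free_module_on_carrier)
  have "(\<Oplus>\<^bsub>free_module_on R S\<^esub>s\<in>{s. t s \<noteq> \<zero>\<^bsub>R\<^esub>}. t s \<odot>\<^bsub>free_module_on R S\<^esub> free_gen R s) \<in> N"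
    using t assms(4) by (intro F.submodule_finsum_closed assms(3) Pi_I F.submoduleE(4)[OF assms(3)]) auto
  then show ?thesis
    using free_module_on_expand[OF assms(1,2)] by simp
qed

lemma free_module_on_ext:
  assumes "module R N" "f \<in> linear_maps R (free_module_on R S) N" "g \<in> linear_maps R (free_module_on R S) N"
    and "\<And>s. s \<in> S \<Longrightarrow> f (free_gen R s) = g (free_gen R s)" "t \<in> carrier (free_module_on R S)"
  shows "f t = g t"
proof -
  interpret N: module R N by fact
  note F = free_module_on_module[OF N.R.is_cring]
  have "t \<in> {x \<in> carrier (free_module_on R S). f x = g x}"
    by (rule free_module_on_induct[OF N.R.is_cring assms(5) submodule_equalizer[OF F assms(1-3)]])
      (use assms(4) N.R.is_cring in \<open>auto intro: free_gen_closed\<close>)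
  then show ?thesis
    by simp
qed

text \<open>The element is fixed and the function being extended varies. This yields linearity in
  the remaining variable of a bilinear construction, such as the second factor of the product of the
  Hopf algebra.\<close>

lemma lin_ext_param_linear:
  assumes "module R N" "t \<in> carrier (free_module_on R S)"
    and "\<And>s. s \<in> S \<Longrightarrow> (\<lambda>x. \<phi> x s) \<in> linear_maps R P N"
  shows "(\<lambda>x. lin_ext R N (\<phi> x) t) \<in> linear_maps R P N"
  unfolding lin_ext_def
  using assms(2,3)
  by (intro linear_maps_finsum_fun linear_maps_smult_fun assms(1)) (auto simp: free_module_on_carrier)


declare free_module_on_simps [simp del]

section \<open>Quotient modules\<close>

lemma submodule_abelian_subgroup:
  assumes "module R M" "submodule K R M"
  shows "abelian_subgroup K M"
proof -
  interpret M: module R M by fact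
  show ?thesis
    by (intro abelian_subgroupI3 additive_subgroup.intro submodule.axioms(1)[OF assms(2)])
      (rule M.abelian_group_axioms)
qed

lemma quotient_module_carrier:
  "carrier (quotient_module M K) = (\<lambda>x. K +>\<^bsub>M\<^esub> x) ` carrier M"
  by (auto simp: quotient_module_def A_RCOSETS_def')

lemma quotient_module_add:
  assumes "module R M" "submodule K R M" "x \<in> carrier M" "y \<in> carrier M"
  shows "(K +>\<^bsub>M\<^esub> x) \<oplus>\<^bsub>quotient_module M K\<^esub> (K +>\<^bsub>M\<^esub> y) = K +>\<^bsub>M\<^esub> (x \<oplus>\<^bsub>M\<^esub> y)"
  using abelian_subgroup.a_rcos_sum[OF submodule_abelian_subgroup[OF assms(1,2)] assms(3,4)]
  by (simp add: quotient_module_def)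

text \<open>The union in the definition runs over all representatives. Changing the representative
  by \<open>h \<in> K\<close> changes the multiple by \<open>a\<close> times \<open>h\<close>, which
  is again in \<open>K\<close>, so all cosets in the union coincide.\<close>

lemma quotient_module_smult:
  assumes "module R M" "submodule K R M" "a \<in> carrier R" "x \<in> carrier M"
  shows "a \<odot>\<^bsub>quotient_module M K\<^esub> (K +>\<^bsub>M\<^esub> x) = K +>\<^bsub>M\<^esub> (a \<odot>\<^bsub>M\<^esub> x)"
proof -
  interpret M: module R M by fact
  interpret K: abelian_subgroup K M
    by (rule submodule_abelian_subgroup) fact+
  have eq: "K +>\<^bsub>M\<^esub> (a \<odot>\<^bsub>M\<^esub> y) = K +>\<^bsub>M\<^esub> (a \<odot>\<^bsub>M\<^esub> x)" if y: "y \<in> K +>\<^bsub>M\<^esub> x" for y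
  proof -
    from y obtain h where h: "h \<in> K" "y = h \<oplus>\<^bsub>M\<^esub> x"
      by (auto simp: a_r_coset_def')
    then have "a \<odot>\<^bsub>M\<^esub> y = a \<odot>\<^bsub>M\<^esub> h \<oplus>\<^bsub>M\<^esub> a \<odot>\<^bsub>M\<^esub> x"
      using assms(3,4) by (simp add: M.smult_r_distr)
    then have "a \<odot>\<^bsub>M\<^esub> y \<in> K +>\<^bsub>M\<^esub> (a \<odot>\<^bsub>M\<^esub> x)"
      using h(1) M.submoduleE(4)[OF assms(2,3)] by (auto simp: a_r_coset_def')
    then show ?thesis
      using assms(3,4) by (intro K.a_repr_independence'[symmetric]) auto
  qed
  have "x \<in> K +>\<^bsub>M\<^esub> x"
    using assms(4) by (rule K.a_rcos_self)
  then have "(\<Union>y\<in>K +>\<^bsub>M\<^esub> x. K +>\<^bsub>M\<^esub> (a \<odot>\<^bsub>M\<^esub> y)) = K +>\<^bsub>M\<^esub> (a \<odot>\<^bsub>M\<^esub> x)"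
    using eq by (intro UN_constant_eq) blast+
  then show ?thesis
    by (simp add: quotient_module_def)
qed

lemma quotient_module_module:
  assumes "module R M" "submodule K R M"
  shows "module R (quotient_module M K)"
proof -
  interpret M: module R M by fact
  interpret K: abelian_subgroup K M
    by (rule submodule_abelian_subgroup) fact+
  let ?Q = "quotient_module M K"
  note simps = quotient_module_carrier quotient_module_add[OF assms] quotient_module_smult[OF assms]
  have zero: "\<zero>\<^bsub>?Q\<^esub> = K +>\<^bsub>M\<^esub> \<zero>\<^bsub>M\<^esub>"
    using M.a_coset_add_zero[OF K.a_subset] by (simp add: quotient_module_def)
  show ?thesis
  proof (rule moduleI)
    show "abelian_group ?Q"
    proof (rule abelian_groupI)
      fix X assume "X \<in> carrier ?Q"
      then obtain x where x: "x \<in> carrier M" "X = K +>\<^bsub>M\<^esub> x"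
        by (auto simp: simps)
      show "\<exists>Y\<in>carrier ?Q. Y \<oplus>\<^bsub>?Q\<^esub> X = \<zero>\<^bsub>?Q\<^esub>"
        by (rule bexI[of _ "K +>\<^bsub>M\<^esub> (\<ominus>\<^bsub>M\<^esub> x)"]) (use x in \<open>auto simp: simps zero M.l_neg\<close>)
    qed (auto simp: simps zero M.a_ac)
  qed (use M.R.is_cring in \<open>auto simp: simps M.smult_l_distr M.smult_r_distr M.smult_assoc1\<close>)
qed

lemma quotient_module_proj_linear:
  assumes "module R M" "submodule K R M"
  shows "(\<lambda>x. K +>\<^bsub>M\<^esub> x) \<in> linear_maps R M (quotient_module M K)"
  by (intro linear_mapsI)
    (auto simp: quotient_module_carrier quotient_module_add[OF assms] quotient_module_smult[OF assms])


section \<open>Multilinear maps and tensor powers\<close>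

text \<open>The entry of \<open>xs\<close> at position \<open>i\<close> is overwritten and serves as
  a placeholder. For \<open>k = 0\<close> the condition only places \<open>f []\<close> in the
  carrier.\<close>

definition multilinear ::
  "('a, 'r) ring_scheme \<Rightarrow> ('a, 'b, 'm) module_scheme \<Rightarrow> ('a, 'c, 'n) module_scheme \<Rightarrow> nat \<Rightarrow>
   ('b list \<Rightarrow> 'c) \<Rightarrow> bool"
  where "multilinear R M N k f \<longleftrightarrow> f \<in> tuples M k \<rightarrow> carrier N \<and>
    (\<forall>xs\<in>tuples M k. \<forall>i<k. (\<lambda>x. f (xs[i := x])) \<in> linear_maps R M N)"

lemma multilinearI:
  assumes "\<And>xs. xs \<in> tuples M k \<Longrightarrow> f xs \<in> carrier N"
    and "\<And>xs i. \<lbrakk>xs \<in> tuples M k; i < k\<rbrakk> \<Longrightarrow> (\<lambda>x. f (xs[i := x])) \<in> linear_maps R M N"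
  shows "multilinear R M N k f"
  using assms by (auto simp: multilinear_def)

lemma multilinear_closed: "\<lbrakk>multilinear R M N k f; xs \<in> tuples M k\<rbrakk> \<Longrightarrow> f xs \<in> carrier N"
  by (auto simp: multilinear_def)

lemma multilinear_linear:
  "\<lbrakk>multilinear R M N k f; xs \<in> tuples M k; i < k\<rbrakk> \<Longrightarrow> (\<lambda>x. f (xs[i := x])) \<in> linear_maps R M N"
  by (auto simp: multilinear_def)

lemma tuples_update: "\<lbrakk>xs \<in> tuples M k; x \<in> carrier M\<rbrakk> \<Longrightarrow> xs[i := x] \<in> tuples M k"
  using set_update_subset_insert[of xs i x] by (auto simp: tuples_def)

lemma tuples_append: "\<lbrakk>xs \<in> tuples M k; ys \<in> tuples M l\<rbrakk> \<Longrightarrow> xs @ ys \<in> tuples M (k + l)"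
  by (auto simp: tuples_def)

lemma tuples_nth: "\<lbrakk>xs \<in> tuples M k; i < k\<rbrakk> \<Longrightarrow> xs ! i \<in> carrier M"
  by (auto simp: tuples_def)

lemma tuples_2_cases:
  assumes "xs \<in> tuples M 2"
  obtains x y where "xs = [x, y]" "x \<in> carrier M" "y \<in> carrier M"
proof -
  from assms have "length xs = Suc (Suc 0)"
    by (simp add: tuples_def)
  then show ?thesis
    using assms that by (auto simp: length_Suc_conv tuples_def)
qed

lemma multilinear_2I:
  assumes "\<And>x. x \<in> carrier M \<Longrightarrow> (\<lambda>y. f [x, y]) \<in> linear_maps R M N"
    and "\<And>y. y \<in> carrier M \<Longrightarrow> (\<lambda>x. f [x, y]) \<in> linear_maps R M N"
  shows "multilinear R M N 2 f"
proof (rule multilinearI)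
  fix xs assume "xs \<in> tuples M 2"
  then show "f xs \<in> carrier N"
    using linear_maps_closed[OF assms(1)] by (elim tuples_2_cases) auto
next
  fix xs and i :: nat assume "xs \<in> tuples M 2" "i < 2"
  then show "(\<lambda>x. f (xs[i := x])) \<in> linear_maps R M N"
    using assms by (elim tuples_2_cases) (auto simp: less_2_cases_iff)
qed

section \<open>Pure tensors and the universal property of tensor powers\<close>

context module
begin

abbreviation (input) tuple_module :: "nat \<Rightarrow> ('a, 'c list \<Rightarrow> 'a) module"
  where "tuple_module k \<equiv> free_module_on R (tuples M k)"

lemma tuple_module_module: "module R (tuple_module k)"
  by (rule free_module_on_module) (rule R.is_cring)

lemma tensor_relations_closed: "tensor_relations R M k \<subseteq> carrier (tuple_module k)"
proof -
  interpret F: module R "tuple_module k"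
    by (rule tuple_module_module)
  have gen: "free_gen R (xs[i := x]) \<in> carrier (tuple_module k)"
    if "xs \<in> tuples M k" "x \<in> carrier M" for xs i x
    using that by (intro free_gen_closed R.is_cring tuples_update)
  show ?thesis
    unfolding tensor_relations_def Let_def
    by (auto intro!: F.minus_closed F.a_closed F.smult_closed gen)
qed

lemma tensor_null_submodule: "submodule (tensor_null R M k) R (tuple_module k)"
  unfolding tensor_null_def
  by (rule submodule_span_submodule[OF tuple_module_module tensor_relations_closed])

lemma tensor_power_module: "module R (tensor_power R M k)"
  unfolding tensor_power_def by (rule quotient_module_module[OF tuple_module_module tensor_null_submodule])

lemma tensor_proj_linear:
  "(\<lambda>t. tensor_null R M k +>\<^bsub>tuple_module k\<^esub> t) \<in> linear_maps R (tuple_module k) (tensor_power R M k)"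
  unfolding tensor_power_def
  by (rule quotient_module_proj_linear[OF tuple_module_module tensor_null_submodule])

lemma tensor_power_cases:
  assumes "X \<in> carrier (tensor_power R M k)"
  obtains t where "t \<in> carrier (tuple_module k)" "X = tensor_null R M k +>\<^bsub>tuple_module k\<^esub> t"
  using assms unfolding tensor_power_def quotient_module_carrier by auto

lemma pure_tensor_eq:
  "xs \<in> tuples M k \<Longrightarrow> pure_tensor R M xs = tensor_null R M k +>\<^bsub>tuple_module k\<^esub> free_gen R xs"
  by (auto simp: pure_tensor_def tuples_def)

lemma pure_tensor_closed: "xs \<in> tuples M k \<Longrightarrow> pure_tensor R M xs \<in> carrier (tensor_power R M k)"
  by (simp add: pure_tensor_eq linear_maps_closed[OF tensor_proj_linear] free_gen_closed R.is_cring)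

text \<open>Each instance of additivity or homogeneity says that one of the
  \<open>tensor_relations\<close> is null, and membership in the null submodule turns into equality
  of cosets.\<close>

lemma pure_tensor_multilinear: "multilinear R M (tensor_power R M k) k (pure_tensor R M)"
proof (rule multilinearI)
  fix xs i assume xs: "xs \<in> tuples M k" and i: "i < k"
  interpret F: module R "tuple_module k"
    by (rule tuple_module_module)
  interpret T: module R "tensor_power R M k"
    by (rule tensor_power_module)
  interpret K: abelian_subgroup "tensor_null R M k" "tuple_module k"
    by (rule submodule_abelian_subgroup[OF tuple_module_module tensor_null_submodule])
  let ?\<pi> = "\<lambda>t. tensor_null R M k +>\<^bsub>tuple_module k\<^esub> t"
  have gen: "free_gen R (xs[i := x]) \<in> carrier (tuple_module k)" if "x \<in> carrier M" for x
    using that xs by (intro free_gen_closed R.is_cring tuples_update)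
  have eq: "?\<pi> s = ?\<pi> t"
    if "s \<ominus>\<^bsub>tuple_module k\<^esub> t \<in> tensor_relations R M k"
      "s \<in> carrier (tuple_module k)" "t \<in> carrier (tuple_module k)" for s t
  proof -
    have "s \<ominus>\<^bsub>tuple_module k\<^esub> t \<in> tensor_null R M k"
      unfolding tensor_null_def by (rule subsetD[OF submodule_span_superset that(1)])
    then have "s \<in> ?\<pi> t"
      using K.a_rcos_module[OF that(3,2)] by (simp add: a_minus_def)
    then show ?thesis
      using that(3) by (intro K.a_repr_independence'[symmetric])
  qed
  have pt: "pure_tensor R M (xs[i := x]) = ?\<pi> (free_gen R (xs[i := x]))" if "x \<in> carrier M" for x
    using xs that by (intro pure_tensor_eq tuples_update)
  show "(\<lambda>x. pure_tensor R M (xs[i := x])) \<in> linear_maps R M (tensor_power R M k)"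
  proof (rule linear_mapsI)
    fix x y assume xy: "x \<in> carrier M" "y \<in> carrier M"
    have "?\<pi> (free_gen R (xs[i := x \<oplus>\<^bsub>M\<^esub> y])) =
        ?\<pi> (free_gen R (xs[i := x]) \<oplus>\<^bsub>tuple_module k\<^esub> free_gen R (xs[i := y]))"
      by (rule eq)
        (use xy xs i in \<open>auto simp: tensor_relations_def Let_def gen
          intro!: F.a_closed\<close>)
    then show "pure_tensor R M (xs[i := x \<oplus>\<^bsub>M\<^esub> y]) =
        pure_tensor R M (xs[i := x]) \<oplus>\<^bsub>tensor_power R M k\<^esub> pure_tensor R M (xs[i := y])"
      using xy by (simp add: pt gen linear_maps_add[OF tensor_proj_linear])
  next
    fix a x assume ax: "a \<in> carrier R" "x \<in> carrier M"
    have "?\<pi> (free_gen R (xs[i := a \<odot>\<^bsub>M\<^esub> x])) = ?\<pi> (a \<odot>\<^bsub>tuple_module k\<^esub> free_gen R (xs[i := x]))"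
      by (rule eq)
        (use ax xs i in \<open>auto simp: tensor_relations_def Let_def gen
          intro!: F.smult_closed\<close>)
    then show "pure_tensor R M (xs[i := a \<odot>\<^bsub>M\<^esub> x]) =
        a \<odot>\<^bsub>tensor_power R M k\<^esub> pure_tensor R M (xs[i := x])"
      using ax by (simp add: pt gen linear_maps_smult[OF tensor_proj_linear])
  qed (use xs in \<open>auto intro!: pure_tensor_closed tuples_update\<close>)
qed (rule pure_tensor_closed)

text \<open>Multilinearity of \<open>f\<close> makes its linear extension vanish on every relation,
  hence on the null submodule, so it is constant on each coset. The image in the definition of
  \<open>tensor_lift\<close> is then a singleton, and \<open>the_elem\<close> has a meaning. All
  properties of \<open>tensor_lift\<close> rest on this equation.\<close>

lemma tensor_lift_eq:
  assumes "module R N" "multilinear R M N k f" "t \<in> carrier (tuple_module k)"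
  shows "tensor_lift R N f (tensor_null R M k +>\<^bsub>tuple_module k\<^esub> t) = lin_ext R N f t"
proof -
  interpret N: module R N by fact
  interpret F: module R "tuple_module k"
    by (rule tuple_module_module)
  interpret K: abelian_subgroup "tensor_null R M k" "tuple_module k"
    by (rule submodule_abelian_subgroup[OF tuple_module_module tensor_null_submodule])
  have f: "f \<in> tuples M k \<rightarrow> carrier N"
    using assms(2) by (simp add: multilinear_def)
  note lin = lin_ext_linear[OF assms(1) f]
  have gen: "free_gen R xs \<in> carrier (tuple_module k)" if "xs \<in> tuples M k" for xs
    using that by (intro free_gen_closed R.is_cring)
  have lin_minus: "lin_ext R N f (s \<ominus>\<^bsub>tuple_module k\<^esub> t) = \<zero>\<^bsub>N\<^esub>"
    if "lin_ext R N f s = lin_ext R N f t" "s \<in> carrier (tuple_module k)" "t \<in> carrier (tuple_module k)" for s t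
  proof -
    have "s = (s \<ominus>\<^bsub>tuple_module k\<^esub> t) \<oplus>\<^bsub>tuple_module k\<^esub> t"
      using that(2,3) by (simp add: a_minus_def F.a_assoc F.l_neg)
    then have "lin_ext R N f s = lin_ext R N f (s \<ominus>\<^bsub>tuple_module k\<^esub> t) \<oplus>\<^bsub>N\<^esub> lin_ext R N f t"
      using that(2,3) linear_maps_add[OF lin, of "s \<ominus>\<^bsub>tuple_module k\<^esub> t" t] F.minus_closed by metis
    then show ?thesis
      using that linear_maps_closed[OF lin] F.minus_closed N.add.r_cancel_one' by metis
  qed
  have "tensor_relations R M k \<subseteq> {t \<in> carrier (tuple_module k). lin_ext R N f t = \<zero>\<^bsub>N\<^esub>}"
  proof
    fix r assume r: "r \<in> tensor_relations R M k"
    have "lin_ext R N f r = \<zero>\<^bsub>N\<^esub>"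
      using r[unfolded tensor_relations_def Let_def]
    proof (elim UnE CollectE exE conjE)
      fix xs i x y
      assume req: "r = free_gen R (xs[i := x \<oplus>\<^bsub>M\<^esub> y]) \<ominus>\<^bsub>tuple_module k\<^esub>
            (free_gen R (xs[i := x]) \<oplus>\<^bsub>tuple_module k\<^esub> free_gen R (xs[i := y]))"
        and as: "xs \<in> tuples M k" "i < k" "x \<in> carrier M" "y \<in> carrier M"
      note up = tuples_update[OF as(1)]
      have "lin_ext R N f (free_gen R (xs[i := x \<oplus>\<^bsub>M\<^esub> y])) =
          lin_ext R N f (free_gen R (xs[i := x]) \<oplus>\<^bsub>tuple_module k\<^esub> free_gen R (xs[i := y]))"
        using as linear_maps_add[OF multilinear_linear[OF assms(2) as(1,2)] as(3,4)]
        by (simp add: linear_maps_add[OF lin] gen up lin_ext_free_gen[OF assms(1)]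
            multilinear_closed[OF assms(2)])
      then show ?thesis
        unfolding req using as by (intro lin_minus) (auto intro!: gen up F.a_closed)
    next
      fix xs i a x
      assume req: "r = free_gen R (xs[i := a \<odot>\<^bsub>M\<^esub> x]) \<ominus>\<^bsub>tuple_module k\<^esub>
            (a \<odot>\<^bsub>tuple_module k\<^esub> free_gen R (xs[i := x]))"
        and as: "xs \<in> tuples M k" "i < k" "a \<in> carrier R" "x \<in> carrier M"
      note up = tuples_update[OF as(1)]
      have "lin_ext R N f (free_gen R (xs[i := a \<odot>\<^bsub>M\<^esub> x])) =
          lin_ext R N f (a \<odot>\<^bsub>tuple_module k\<^esub> free_gen R (xs[i := x]))"
        using as linear_maps_smult[OF multilinear_linear[OF assms(2) as(1,2)] as(3,4)]
        by (simp add: linear_maps_smult[OF lin] gen up lin_ext_free_gen[OF assms(1)]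
            multilinear_closed[OF assms(2)])
      then show ?thesis
        unfolding req using as by (intro lin_minus) (auto intro!: gen up F.smult_closed)
    qed
    then show "r \<in> {t \<in> carrier (tuple_module k). lin_ext R N f t = \<zero>\<^bsub>N\<^esub>}"
      using r tensor_relations_closed by auto
  qed
  then have null: "tensor_null R M k \<subseteq> {t \<in> carrier (tuple_module k). lin_ext R N f t = \<zero>\<^bsub>N\<^esub>}"
    unfolding tensor_null_def
    by (intro submodule_span_least
        submodule_equalizer[OF tuple_module_module assms(1) lin linear_maps_const_zero[OF assms(1)]])
  have "lin_ext R N f s = lin_ext R N f t" if s: "s \<in> tensor_null R M k +>\<^bsub>tuple_module k\<^esub> t" for s
  proof -
    from s obtain h where h: "h \<in> tensor_null R M k" "s = h \<oplus>\<^bsub>tuple_module k\<^esub> t"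
      by (auto simp: a_r_coset_def')
    with null have "h \<in> carrier (tuple_module k)" "lin_ext R N f h = \<zero>\<^bsub>N\<^esub>"
      by auto
    then show ?thesis
      using assms(3) h(2) by (simp add: linear_maps_add[OF lin] linear_maps_closed[OF lin])
  qed
  then have "lin_ext R N f ` (tensor_null R M k +>\<^bsub>tuple_module k\<^esub> t) =
      (\<lambda>_. lin_ext R N f t) ` (tensor_null R M k +>\<^bsub>tuple_module k\<^esub> t)"
    by (rule image_cong[OF refl])
  also have "\<dots> = {lin_ext R N f t}"
    by (rule image_constant[OF K.a_rcos_self[OF assms(3)]])
  finally have "the_elem (lin_ext R N f ` (tensor_null R M k +>\<^bsub>tuple_module k\<^esub> t)) = lin_ext R N f t"
    by simp
  then show ?thesis
    by (simp add: tensor_lift_def lin_ext_def[abs_def])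
qed

lemma tensor_lift_pure:
  assumes "module R N" "multilinear R M N k f" "xs \<in> tuples M k"
  shows "tensor_lift R N f (pure_tensor R M xs) = f xs"
  using tensor_lift_eq[OF assms(1,2), of "free_gen R xs"] assms
  by (simp add: pure_tensor_eq free_gen_closed R.is_cring lin_ext_free_gen multilinear_closed)

lemma tensor_lift_linear:
  assumes "module R N" "multilinear R M N k f"
  shows "tensor_lift R N f \<in> linear_maps R (tensor_power R M k) N"
proof -
  interpret F: module R "tuple_module k"
    by (rule tuple_module_module)
  have f: "f \<in> tuples M k \<rightarrow> carrier N"
    using assms(2) by (simp add: multilinear_def)
  note lin = lin_ext_linear[OF assms(1) f]
  note eq = tensor_lift_eq[OF assms]
  show ?thesis
    by (intro linear_mapsI; elim tensor_power_cases)
      (simp_all add: eq linear_maps_closed[OF lin] linear_maps_add[OF lin] linear_maps_smult[OF lin]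
        linear_maps_add[OF tensor_proj_linear, symmetric] linear_maps_smult[OF tensor_proj_linear, symmetric]
        F.a_closed F.smult_closed)
qed

lemma tensor_lift_param_linear:
  assumes "module R N" "X \<in> carrier (tensor_power R M k)"
    and "\<And>x. x \<in> carrier P \<Longrightarrow> multilinear R M N k (\<phi> x)"
    and "\<And>xs. xs \<in> tuples M k \<Longrightarrow> (\<lambda>x. \<phi> x xs) \<in> linear_maps R P N"
    and "module R P"
  shows "(\<lambda>x. tensor_lift R N (\<phi> x) X) \<in> linear_maps R P N"
proof -
  obtain t where t: "t \<in> carrier (tuple_module k)" "X = tensor_null R M k +>\<^bsub>tuple_module k\<^esub> t"
    using assms(2) by (rule tensor_power_cases)
  have "(\<lambda>x. lin_ext R N (\<phi> x) t) \<in> linear_maps R P N"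
    using lin_ext_param_linear[OF assms(1) t(1) assms(4)] .
  then show ?thesis
    by (rule iffD1[OF linear_maps_cong[OF assms(5)], rotated])
      (simp add: t(2) tensor_lift_eq[OF assms(1,3) t(1)])
qed

text \<open>Nested lifts are how bilinear operations on tensor powers are defined: concatenation and
  the product of the tensor square are both instances. The inner lift is multilinear in
  \<open>xs\<close> because a lift depends linearly on the function that is lifted.\<close>

lemma tensor_lift2:
  assumes "module R N"
    and "\<And>xs. xs \<in> tuples M k \<Longrightarrow> multilinear R M N l (f xs)"
    and "\<And>ys. ys \<in> tuples M l \<Longrightarrow> multilinear R M N k (\<lambda>xs. f xs ys)"
  defines "B \<equiv> \<lambda>X Y. tensor_lift R N (\<lambda>xs. tensor_lift R N (f xs) Y) X"
  shows tensor_lift2_linear_left: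
      "\<And>Y. Y \<in> carrier (tensor_power R M l) \<Longrightarrow> (\<lambda>X. B X Y) \<in> linear_maps R (tensor_power R M k) N"
    and tensor_lift2_linear_right:
      "\<And>X. X \<in> carrier (tensor_power R M k) \<Longrightarrow> B X \<in> linear_maps R (tensor_power R M l) N"
    and tensor_lift2_pure:
      "\<And>xs ys. \<lbrakk>xs \<in> tuples M k; ys \<in> tuples M l\<rbrakk> \<Longrightarrow>
        B (pure_tensor R M xs) (pure_tensor R M ys) = f xs ys"
proof -
  have multi: "multilinear R M N k (\<lambda>xs. tensor_lift R N (f xs) Y)"
    if Y: "Y \<in> carrier (tensor_power R M l)" for Y
  proof (rule multilinearI)
    fix xs assume "xs \<in> tuples M k"
    then show "tensor_lift R N (f xs) Y \<in> carrier N"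
      by (intro linear_maps_closed[OF tensor_lift_linear Y] assms)
  next
    fix xs i assume "xs \<in> tuples M k" "i < k"
    then show "(\<lambda>x. tensor_lift R N (f (xs[i := x])) Y) \<in> linear_maps R M N"
      by (intro tensor_lift_param_linear[OF assms(1) Y] assms(2) multilinear_linear[OF assms(3)]
          tuples_update module_axioms)
  qed
  show "(\<lambda>X. B X Y) \<in> linear_maps R (tensor_power R M k) N" if "Y \<in> carrier (tensor_power R M l)" for Y
    unfolding B_def using tensor_lift_linear[OF assms(1) multi[OF that]] by simp
  show "B X \<in> linear_maps R (tensor_power R M l) N" if "X \<in> carrier (tensor_power R M k)" for X
    unfolding B_def
    by (rule tensor_lift_param_linear[OF assms(1) that multi])
      (auto intro!: tensor_lift_linear assms tensor_power_module)
  show "B (pure_tensor R M xs) (pure_tensor R M ys) = f xs ys"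
    if "xs \<in> tuples M k" "ys \<in> tuples M l" for xs ys
    unfolding B_def
    using that by (subst tensor_lift_pure[OF assms(1) multi]) (auto intro!: pure_tensor_closed tensor_lift_pure assms)
qed

section \<open>Concatenation of tensors\<close>

lemma tensor_append_multilinear:
  shows "xs \<in> tuples M k \<Longrightarrow> multilinear R M (tensor_power R M (k + l)) l (\<lambda>ys. pure_tensor R M (xs @ ys))"
    and "ys \<in> tuples M l \<Longrightarrow> multilinear R M (tensor_power R M (k + l)) k (\<lambda>xs. pure_tensor R M (xs @ ys))"
proof -
  assume xs: "xs \<in> tuples M k"
  show "multilinear R M (tensor_power R M (k + l)) l (\<lambda>ys. pure_tensor R M (xs @ ys))"
  proof (rule multilinearI)
    fix ys i assume "ys \<in> tuples M l" "i < l"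
    then show "(\<lambda>y. pure_tensor R M (xs @ ys[i := y])) \<in> linear_maps R M (tensor_power R M (k + l))"
      using multilinear_linear[OF pure_tensor_multilinear tuples_append[OF xs, of ys], where i="k + i"] xs
      by (simp add: tuples_def list_update_append)
  qed (intro pure_tensor_closed tuples_append xs)
next
  assume ys: "ys \<in> tuples M l"
  show "multilinear R M (tensor_power R M (k + l)) k (\<lambda>xs. pure_tensor R M (xs @ ys))"
  proof (rule multilinearI)
    fix xs i assume "xs \<in> tuples M k" "i < k"
    then show "(\<lambda>x. pure_tensor R M (xs[i := x] @ ys)) \<in> linear_maps R M (tensor_power R M (k + l))"
      using multilinear_linear[OF pure_tensor_multilinear tuples_append[OF _ ys, of xs], where i=i]
      by (simp add: tuples_def list_update_append)
  qed (intro pure_tensor_closed tuples_append ys)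
qed

lemma tensor_append_linear_left:
  "Y \<in> carrier (tensor_power R M l) \<Longrightarrow>
    (\<lambda>X. tensor_append R M k l X Y) \<in> linear_maps R (tensor_power R M k) (tensor_power R M (k + l))"
  unfolding tensor_append_def
  by (rule tensor_lift2_linear_left[OF tensor_power_module tensor_append_multilinear])

lemma tensor_append_linear_right:
  "X \<in> carrier (tensor_power R M k) \<Longrightarrow>
    tensor_append R M k l X \<in> linear_maps R (tensor_power R M l) (tensor_power R M (k + l))"
  unfolding tensor_append_def
  by (rule tensor_lift2_linear_right[OF tensor_power_module tensor_append_multilinear])

lemma tensor_append_pure:
  "\<lbrakk>xs \<in> tuples M k; ys \<in> tuples M l\<rbrakk> \<Longrightarrow>
    tensor_append R M k l (pure_tensor R M xs) (pure_tensor R M ys) = pure_tensor R M (xs @ ys)"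
  unfolding tensor_append_def
  by (rule tensor_lift2_pure[OF tensor_power_module tensor_append_multilinear])

lemma pure_tensor_linear_comp:
  assumes "xs \<in> tuples M k" "i < k" "f \<in> linear_maps R M M"
  shows "(\<lambda>x. pure_tensor R M (xs[i := f x])) \<in> linear_maps R M (tensor_power R M k)"
  using linear_maps_compose[OF assms(3) multilinear_linear[OF pure_tensor_multilinear assms(1,2)]] .

lemma pure_tensor_linear_2:
  shows "\<lbrakk>x \<in> carrier M; f \<in> linear_maps R P M\<rbrakk> \<Longrightarrow>
      (\<lambda>y. pure_tensor R M [x, f y]) \<in> linear_maps R P (tensor_power R M 2)"
    and "\<lbrakk>y \<in> carrier M; f \<in> linear_maps R P M\<rbrakk> \<Longrightarrow>
      (\<lambda>x. pure_tensor R M [f x, y]) \<in> linear_maps R P (tensor_power R M 2)"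
proof -
  assume x: "x \<in> carrier M" and f: "f \<in> linear_maps R P M"
  \<comment> \<open>The second entry only has to be some element of \<open>M\<close>, as it is
    overwritten by \<open>f y\<close>.\<close>
  have xx: "[x, x] \<in> tuples M 2"
    using x by (simp add: tuples_def)
  show "(\<lambda>y. pure_tensor R M [x, f y]) \<in> linear_maps R P (tensor_power R M 2)"
    using linear_maps_compose[OF f multilinear_linear[OF pure_tensor_multilinear xx, of 1]] by simp
next
  assume y: "y \<in> carrier M" and f: "f \<in> linear_maps R P M"
  have yy: "[y, y] \<in> tuples M 2"
    using y by (simp add: tuples_def)
  show "(\<lambda>x. pure_tensor R M [f x, y]) \<in> linear_maps R P (tensor_power R M 2)"
    using linear_maps_compose[OF f multilinear_linear[OF pure_tensor_multilinear yy, of 0]] by simp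
qed

end

section \<open>Products in the tensor square and iterated products\<close>

context unital_algebra
begin

lemma algebra_ring: "ring M"
  by (rule unital_algebra.axioms(2)[OF unital_algebra_axioms])

lemmas algebra_l_distr = ringE(3)[OF algebra_ring]
lemmas algebra_r_distr = ringE(4)[OF algebra_ring]
lemmas algebra_mult_closed = monoid.m_closed[OF ringE(2)[OF algebra_ring]]

lemma mult_linear_right: "x \<in> carrier M \<Longrightarrow> (\<lambda>y. x \<otimes>\<^bsub>M\<^esub> y) \<in> linear_maps R M M"
  by (intro linear_mapsI) (auto simp: algebra_r_distr algebra_mult_closed smult_mult_right)

lemma mult_linear_left: "y \<in> carrier M \<Longrightarrow> (\<lambda>x. x \<otimes>\<^bsub>M\<^esub> y) \<in> linear_maps R M M"
  by (intro linear_mapsI) (auto simp: algebra_l_distr algebra_mult_closed smult_mult_left)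

lemma tensor_square_mult_multilinear:
  shows "xs \<in> tuples M 2 \<Longrightarrow> multilinear R M (tensor_power R M 2) 2
      (\<lambda>ys. pure_tensor R M [xs ! 0 \<otimes>\<^bsub>M\<^esub> ys ! 0, xs ! 1 \<otimes>\<^bsub>M\<^esub> ys ! 1])"
    and "ys \<in> tuples M 2 \<Longrightarrow> multilinear R M (tensor_power R M 2) 2
      (\<lambda>xs. pure_tensor R M [xs ! 0 \<otimes>\<^bsub>M\<^esub> ys ! 0, xs ! 1 \<otimes>\<^bsub>M\<^esub> ys ! 1])"
  by (intro multilinear_2I;
      auto intro!: pure_tensor_linear_2 mult_linear_left mult_linear_right algebra_mult_closed tuples_nth)+

lemma tensor_square_mult_linear_left:
  "Y \<in> carrier (tensor_power R M 2) \<Longrightarrow>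
    (\<lambda>X. tensor_square_mult R M X Y) \<in> linear_maps R (tensor_power R M 2) (tensor_power R M 2)"
  unfolding tensor_square_mult_def
  by (rule tensor_lift2_linear_left[OF tensor_power_module tensor_square_mult_multilinear])

lemma tensor_square_mult_linear_right:
  "X \<in> carrier (tensor_power R M 2) \<Longrightarrow>
    tensor_square_mult R M X \<in> linear_maps R (tensor_power R M 2) (tensor_power R M 2)"
  unfolding tensor_square_mult_def
  by (rule tensor_lift2_linear_right[OF tensor_power_module tensor_square_mult_multilinear])

lemma tensor_square_mult_pure:
  "\<lbrakk>a \<in> carrier M; b \<in> carrier M; c \<in> carrier M; d \<in> carrier M\<rbrakk> \<Longrightarrow>
    tensor_square_mult R M (pure_tensor R M [a, b]) (pure_tensor R M [c, d]) =
      pure_tensor R M [a \<otimes>\<^bsub>M\<^esub> c, b \<otimes>\<^bsub>M\<^esub> d]"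
  unfolding tensor_square_mult_def
  by (subst tensor_lift2_pure[OF tensor_power_module tensor_square_mult_multilinear])
    (auto simp: tuples_def)

lemma iter_mult_multilinear: "multilinear R M M k (\<lambda>xs. foldr (\<otimes>\<^bsub>M\<^esub>) xs \<one>\<^bsub>M\<^esub>)"
proof (rule multilinearI)
  have closed: "foldr (\<otimes>\<^bsub>M\<^esub>) xs \<one>\<^bsub>M\<^esub> \<in> carrier M" if "set xs \<subseteq> carrier M" for xs
    using that by (induction xs) auto
  then show "foldr (\<otimes>\<^bsub>M\<^esub>) xs \<one>\<^bsub>M\<^esub> \<in> carrier M" if "xs \<in> tuples M k" for xs
    using that by (auto simp: tuples_def)
  have "(\<lambda>x. foldr (\<otimes>\<^bsub>M\<^esub>) (xs[i := x]) \<one>\<^bsub>M\<^esub>) \<in> linear_maps R M M"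
    if "set xs \<subseteq> carrier M" "i < length xs" for xs i
    using that
  proof (induction xs arbitrary: i)
    case (Cons y xs)
    show ?case
    proof (cases i)
      case 0
      with Cons.prems show ?thesis
        by (auto intro!: mult_linear_left closed)
    next
      case (Suc j)
      with Cons have "(\<lambda>x. foldr (\<otimes>\<^bsub>M\<^esub>) (xs[j := x]) \<one>\<^bsub>M\<^esub>) \<in> linear_maps R M M" "y \<in> carrier M"
        by auto
      from linear_maps_compose[OF this(1) mult_linear_right[OF this(2)]] Suc show ?thesis
        by simp
    qed
  qed simp
  then show "(\<lambda>x. foldr (\<otimes>\<^bsub>M\<^esub>) (xs[i := x]) \<one>\<^bsub>M\<^esub>) \<in> linear_maps R M M"
    if "xs \<in> tuples M k" "i < k" for xs i
    using that by (auto simp: tuples_def)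
qed

end


section \<open>Cutting words of intervals\<close>

lemma (in abelian_monoid) finsum_swap:
  assumes "finite A" "finite B" "\<And>i j. \<lbrakk>i \<in> A; j \<in> B\<rbrakk> \<Longrightarrow> g i j \<in> carrier G"
  shows "(\<Oplus>i\<in>A. \<Oplus>j\<in>B. g i j) = (\<Oplus>j\<in>B. \<Oplus>i\<in>A. g i j)"
  using assms(1,3)
proof (induction A rule: finite_induct)
  case (insert a A)
  then have "(\<Oplus>i\<in>insert a A. \<Oplus>j\<in>B. g i j) = (\<Oplus>j\<in>B. g a j) \<oplus> (\<Oplus>j\<in>B. \<Oplus>i\<in>A. g i j)"
    by (subst finsum_insert) (auto intro!: finsum_closed)
  also have "\<dots> = (\<Oplus>j\<in>B. g a j \<oplus> (\<Oplus>i\<in>A. g i j))"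
    using insert.prems by (intro finsum_addf[symmetric]) (auto intro!: finsum_closed)
  also have "\<dots> = (\<Oplus>j\<in>B. \<Oplus>i\<in>insert a A. g i j)"
    using insert.hyps insert.prems
    by (intro finsum_cong' refl) (auto intro!: finsum_closed finsum_insert[symmetric])
  finally show ?case .
qed simp

text \<open>Both sides run over the chains \<open>i \<le> l \<le> k \<le> j\<close>. Padding by zero
  turns the triangle into a square, where the order of summation can be swapped. It is needed for
  coassociativity and for inverting a unitriangular matrix.\<close>

lemma (in abelian_monoid) finsum_triangle:
  fixes i j :: nat
  assumes g: "\<And>k l. \<lbrakk>i \<le> l; l \<le> k; k \<le> j\<rbrakk> \<Longrightarrow> g k l \<in> carrier G"
  shows "(\<Oplus>k\<in>{i..j}. \<Oplus>l\<in>{i..k}. g k l) = (\<Oplus>l\<in>{i..j}. \<Oplus>k\<in>{l..j}. g k l)"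
proof -
  let ?h = "\<lambda>k l. if l \<le> k then g k l else \<zero>"
  have "(\<Oplus>k\<in>{i..j}. \<Oplus>l\<in>{i..k}. g k l) = (\<Oplus>k\<in>{i..j}. \<Oplus>l\<in>{i..j}. ?h k l)"
    by (intro finsum_cong' refl add.finprod_mono_neutral_cong_left) (auto intro!: finsum_closed g)
  also have "\<dots> = (\<Oplus>l\<in>{i..j}. \<Oplus>k\<in>{i..j}. ?h k l)"
    by (rule finsum_swap) (auto intro: g)
  also have "\<dots> = (\<Oplus>l\<in>{i..j}. \<Oplus>k\<in>{l..j}. g k l)"
    by (intro finsum_cong' refl add.finprod_mono_neutral_cong_right) (auto intro!: finsum_closed g)
  finally show ?thesis .
qed

text \<open>The letter \<open>(i, j)\<close> stands for the interval from \<open>i\<close> to \<open>j\<close>, and \<open>edge i j\<close> for the generator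
  \<open>x\<^bsub>ij\<^esub>\<close> of the Hopf algebra, where \<open>x\<^bsub>ii\<^esub> = 1\<close>. The sum \<open>split_sum N w f\<close> is obtained from
  \<open>\<Delta>(w) = \<Sum> u \<otimes> v\<close>, for \<open>\<Delta>(x\<^bsub>ij\<^esub>) = \<Sum>\<^bsub>i \<le> k \<le> j\<^esub> x\<^bsub>ik\<^esub> \<otimes> x\<^bsub>kj\<^esub>\<close>, by replacing \<open>u \<otimes> v\<close> with \<open>f u v\<close>.\<close>

definition edge :: "nat \<Rightarrow> nat \<Rightarrow> (nat \<times> nat) list"
  where "edge i j = (if i = j then [] else [(i, j)])"

primrec split_sum ::
  "('c, 'm) ring_scheme \<Rightarrow> (nat \<times> nat) list \<Rightarrow> ((nat \<times> nat) list \<Rightarrow> (nat \<times> nat) list \<Rightarrow> 'c) \<Rightarrow> 'c"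
  where
    "split_sum N [] f = f [] []"
  | "split_sum N (x # w) f =
      (\<Oplus>\<^bsub>N\<^esub>k\<in>{fst x..snd x}. split_sum N w (\<lambda>u v. f (edge (fst x) k @ u) (edge k (snd x) @ v)))"

definition weight :: "(nat \<times> nat) list \<Rightarrow> nat"
  where "weight w = (\<Sum>x\<leftarrow>w. snd x - fst x)"

lemma edge_same [simp]: "edge i i = []"
  by (simp add: edge_def)

lemma weight_simps [simp]:
  "weight [] = 0" "weight (x # w) = snd x - fst x + weight w" "weight (u @ v) = weight u + weight v"
  "weight (edge i j) = j - i"
  by (auto simp: weight_def edge_def)

text \<open>This is the multiplicativity of the coproduct on words. It holds by mere unfolding,
  because the recursion nests the sums over the cuts of successive letters.\<close>

lemma split_sum_append:
  "split_sum N (w1 @ w2) f =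
    split_sum N w1 (\<lambda>u v. split_sum N w2 (\<lambda>u' v'. f (u @ u') (v @ v')))"
  by (induction w1 arbitrary: f) simp_all

declare in_lists_conv_set [simp del] in_listsI [rule del] in_listsD [rule del]

text \<open>Closure under subintervals keeps the coproduct of a generator within the algebra on
  \<open>L\<close>. Both the set of all intervals and the truncated finite set are of this
  kind.\<close>

locale interval_letters =
  fixes L :: "(nat \<times> nat) set"
  assumes less: "(i, j) \<in> L \<Longrightarrow> i < j"
    and subinterval: "\<lbrakk>(i, j) \<in> L; i \<le> k; k < l; l \<le> j\<rbrakk> \<Longrightarrow> (k, l) \<in> L"
begin

lemma edge_closed: "\<lbrakk>(i, j) \<in> L; i \<le> k; k \<le> l; l \<le> j\<rbrakk> \<Longrightarrow> edge k l \<in> lists L"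
  using subinterval[of i j k l] by (auto simp: edge_def)

lemma edge_cut_closed:
  assumes "x \<in> L" "fst x \<le> k" "k \<le> snd x"
  shows "edge (fst x) k \<in> lists L" "edge k (snd x) \<in> lists L"
  using assms edge_closed[of "fst x" "snd x"] by auto

lemma edge_sub_closed: "\<lbrakk>edge i j \<in> lists L; i \<le> k; k \<le> l; l \<le> j\<rbrakk> \<Longrightarrow> edge k l \<in> lists L"
  using subinterval[of i j k l] by (auto simp: edge_def split: if_splits)

lemma weight_eq_0_iff: "w \<in> lists L \<Longrightarrow> weight w = 0 \<longleftrightarrow> w = []"
  using less by (cases w) fastforce+

lemma split_sum_closed:
  assumes "abelian_monoid N" "w \<in> lists L"
    and "\<And>u v. \<lbrakk>u \<in> lists L; v \<in> lists L\<rbrakk> \<Longrightarrow> f u v \<in> carrier N"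
  shows "split_sum N w f \<in> carrier N"
proof -
  interpret N: abelian_monoid N by fact
  show ?thesis
    using assms(2,3)
  proof (induction w arbitrary: f rule: list.induct)
    case (Cons x w)
    from Cons.prems(1) show ?case
      by (auto intro!: N.finsum_closed Cons.IH Cons.prems(2) edge_cut_closed)
  qed simp
qed

text \<open>Cutting an interval preserves the total length, so only pieces with the weight of
  \<open>w\<close> in total occur. This is the reason why the coproduct is graded.\<close>

lemma split_sum_in_submodule:
  assumes "module R N" "submodule K R N" "w \<in> lists L"
    and "\<And>u v. \<lbrakk>u \<in> lists L; v \<in> lists L; weight u + weight v = weight w\<rbrakk> \<Longrightarrow> f u v \<in> K"
  shows "split_sum N w f \<in> K"
  using assms(3,4)
proof (induction w arbitrary: f rule: list.induct)
  case (Cons x w)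
  obtain i j where x: "x = (i, j)"
    by (cases x)
  with Cons.prems have L: "(i, j) \<in> L" "i < j" "w \<in> lists L"
    using less by auto
  have "split_sum N w (\<lambda>u v. f (edge i k @ u) (edge k j @ v)) \<in> K" if "i \<le> k" "k \<le> j" for k
    using that L by (intro Cons.IH Cons.prems(2)) (auto intro!: edge_closed simp: x)
  then show ?case
    by (auto simp: x intro!: module.submodule_finsum_closed[OF assms(1,2)])
qed simp

lemma split_sum_cong:
  assumes "abelian_monoid N" "w \<in> lists L"
    and "\<And>u v. \<lbrakk>u \<in> lists L; v \<in> lists L\<rbrakk> \<Longrightarrow> g u v \<in> carrier N"
    and "\<And>u v. \<lbrakk>u \<in> lists L; v \<in> lists L\<rbrakk> \<Longrightarrow> f u v = g u v"
  shows "split_sum N w f = split_sum N w g"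
proof -
  interpret N: abelian_monoid N by fact
  show ?thesis
    using assms(2-)
  proof (induction w arbitrary: f g rule: list.induct)
    case (Cons x w)
    from Cons.prems(1) show ?case
      by (auto intro!: N.finsum_cong' split_sum_closed[OF assms(1)] Cons.IH Cons.prems(2,3) edge_cut_closed)
  qed simp
qed

text \<open>A linear map applied to a coproduct passes to the summands and changes the module of the
  sum. Computations on the coproduct of a word thus never take an element of the tensor square
  apart.\<close>

lemma split_sum_linear:
  assumes "module R N" "module R P" "g \<in> linear_maps R N P" "w \<in> lists L"
    and "\<And>u v. \<lbrakk>u \<in> lists L; v \<in> lists L\<rbrakk> \<Longrightarrow> f u v \<in> carrier N"
  shows "g (split_sum N w f) = split_sum P w (\<lambda>u v. g (f u v))"
proof -
  interpret N: module R N by fact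
  interpret P: module R P by fact
  show ?thesis
    using assms(4-)
  proof (induction w arbitrary: f rule: list.induct)
    case (Cons x w)
    have "g (split_sum N (x # w) f) =
        (\<Oplus>\<^bsub>P\<^esub>k\<in>{fst x..snd x}. g (split_sum N w (\<lambda>u v. f (edge (fst x) k @ u) (edge k (snd x) @ v))))"
      using Cons.prems(1)
      by (subst split_sum.simps, intro linear_maps_finsum[OF assms(1-3)])
        (auto intro!: split_sum_closed N.abelian_monoid_axioms Cons.prems(2) edge_cut_closed)
    also have "\<dots> = split_sum P (x # w) (\<lambda>u v. g (f u v))"
      unfolding split_sum.simps using Cons.prems(1)
      by (intro P.finsum_cong' refl Cons.IH)
        (auto intro!: split_sum_closed P.abelian_monoid_axioms Cons.prems(2) edge_cut_closed linear_maps_closed[OF assms(3)])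
    finally show ?case .
  qed simp
qed

lemma split_sum_linear_eq:
  assumes "module R N" "module R P" "g \<in> linear_maps R N P" "w \<in> lists L"
    and "\<And>u v. \<lbrakk>u \<in> lists L; v \<in> lists L\<rbrakk> \<Longrightarrow> f u v \<in> carrier N"
    and "\<And>u v. \<lbrakk>u \<in> lists L; v \<in> lists L\<rbrakk> \<Longrightarrow> g (f u v) = h u v"
  shows "g (split_sum N w f) = split_sum P w h"
proof -
  have "g (split_sum N w f) = split_sum P w (\<lambda>u v. g (f u v))"
    by (rule split_sum_linear[OF assms(1-5)])
  also have "\<dots> = split_sum P w h"
    using assms(6) linear_maps_closed[OF assms(3,5)]
    by (intro split_sum_cong abelian_group.axioms(1) module.axioms(2)[OF assms(2)] assms(4)) auto
  finally show ?thesis .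
qed

lemma split_sum_zero:
  assumes "abelian_monoid N"
  shows "split_sum N w (\<lambda>u v. \<zero>\<^bsub>N\<^esub>) = \<zero>\<^bsub>N\<^esub>"
proof -
  interpret N: abelian_monoid N by fact
  show ?thesis
    by (induction w) (auto intro: N.add.finprod_one_eqI)
qed

lemma split_sum_finsum:
  assumes "abelian_monoid N" "finite A" "w \<in> lists L"
    and "\<And>a u v. \<lbrakk>a \<in> A; u \<in> lists L; v \<in> lists L\<rbrakk> \<Longrightarrow> f a u v \<in> carrier N"
  shows "split_sum N w (\<lambda>u v. \<Oplus>\<^bsub>N\<^esub>a\<in>A. f a u v) = (\<Oplus>\<^bsub>N\<^esub>a\<in>A. split_sum N w (f a))"
proof -
  interpret N: abelian_monoid N by fact
  show ?thesis
    using assms(3-)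
  proof (induction w arbitrary: f rule: list.induct)
    case Nil
    then show ?case
      by simp
  next
    case (Cons x w)
    let ?f = "\<lambda>a k u v. f a (edge (fst x) k @ u) (edge k (snd x) @ v)"
    have f: "?f a k u v \<in> carrier N"
      if "a \<in> A" "u \<in> lists L" "v \<in> lists L" "k \<in> {fst x..snd x}" for a k u v
      using that Cons.prems(1) by (auto intro!: Cons.prems(2) edge_cut_closed)
    have w: "w \<in> lists L"
      using Cons.prems by simp
    have "(\<Oplus>\<^bsub>N\<^esub>k\<in>{fst x..snd x}. split_sum N w (\<lambda>u v. \<Oplus>\<^bsub>N\<^esub>a\<in>A. ?f a k u v)) =
        (\<Oplus>\<^bsub>N\<^esub>k\<in>{fst x..snd x}. \<Oplus>\<^bsub>N\<^esub>a\<in>A. split_sum N w (?f a k))"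
      by (intro N.finsum_cong' refl Cons.IH w)
        (auto intro!: N.finsum_closed split_sum_closed assms(1) w f)
    also have "\<dots> = (\<Oplus>\<^bsub>N\<^esub>a\<in>A. \<Oplus>\<^bsub>N\<^esub>k\<in>{fst x..snd x}. split_sum N w (?f a k))"
      by (intro N.finsum_swap assms(2)) (auto intro!: split_sum_closed assms(1) w f)
    finally show ?case
      by simp
  qed
qed

text \<open>In contrast to the recursion equation for a letter, this covers the degenerate edge with
  \<open>i = j\<close>, where the sum has a single term. Cut pieces may be degenerate, so this is
  the form in which a sum over their cuts can be expanded.\<close>

lemma split_sum_edge_append:
  assumes "abelian_monoid N" "i \<le> j" "edge i j \<in> lists L" "w \<in> lists L"
    and f: "\<And>u v. \<lbrakk>u \<in> lists L; v \<in> lists L\<rbrakk> \<Longrightarrow> f u v \<in> carrier N"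
  shows "split_sum N (edge i j @ w) f =
    (\<Oplus>\<^bsub>N\<^esub>k\<in>{i..j}. split_sum N w (\<lambda>u v. f (edge i k @ u) (edge k j @ v)))"
proof -
  interpret N: abelian_monoid N by fact
  show ?thesis
  proof (cases "i = j")
    case True
    then show ?thesis
      using split_sum_closed[OF assms(1,4) f] by simp
  qed (simp add: edge_def)
qed

text \<open>Cutting the first letter at \<open>k\<close> and then its left part at \<open>l\<close>
  yields the chains \<open>i \<le> l \<le> k \<le> j\<close>, and so does cutting it at
  \<open>l\<close> and then its right part at \<open>k\<close>. The rest of the word is covered by
  the induction hypothesis with both cut points fixed. The pieces already cut off are absorbed into
  \<open>f\<close>, hence \<open>f\<close> varies in the induction.\<close>

lemma split_sum_coassoc:
  assumes "abelian_monoid N" "w \<in> lists L"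
    and "\<And>a b c. \<lbrakk>a \<in> lists L; b \<in> lists L; c \<in> lists L\<rbrakk> \<Longrightarrow> f a b c \<in> carrier N"
  shows "split_sum N w (\<lambda>u v. split_sum N u (\<lambda>a b. f a b v)) =
    split_sum N w (\<lambda>u v. split_sum N v (\<lambda>b c. f u b c))"
proof -
  interpret N: abelian_monoid N by fact
  note closed = split_sum_closed[OF assms(1)]
  show ?thesis
    using assms(2-)
  proof (induction w arbitrary: f rule: list.induct)
    case Nil
    then show ?case
      by simp
  next
    case (Cons x w)
    obtain i j where x: "x = (i, j)"
      by (cases x)
    with Cons.prems have L: "(i, j) \<in> L" "i < j" and w: "w \<in> lists L"
      using less by auto
    note edge = edge_closed[OF L(1)]
    let ?f = "\<lambda>k l a b c. f (edge i l @ a) (edge l k @ b) (edge k j @ c)"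
    have f: "?f k l a b c \<in> carrier N"
      if "i \<le> l" "l \<le> k" "k \<le> j" "a \<in> lists L" "b \<in> lists L" "c \<in> lists L" for k l a b c
      using that by (auto intro!: Cons.prems edge)
    have "split_sum N (x # w) (\<lambda>u v. split_sum N u (\<lambda>a b. f a b v)) =
        (\<Oplus>\<^bsub>N\<^esub>k\<in>{i..j}. split_sum N w (\<lambda>u v. split_sum N (edge i k @ u) (\<lambda>a b. f a b (edge k j @ v))))"
      by (simp add: x)
    also have "\<dots> = (\<Oplus>\<^bsub>N\<^esub>k\<in>{i..j}. split_sum N w (\<lambda>u v. \<Oplus>\<^bsub>N\<^esub>l\<in>{i..k}. split_sum N u (\<lambda>a b. ?f k l a b v)))"
      by (intro N.finsum_cong' refl split_sum_cong split_sum_edge_append w assms(1))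
        (auto intro!: Cons.prems edge closed N.finsum_closed w)
    also have "\<dots> = (\<Oplus>\<^bsub>N\<^esub>k\<in>{i..j}. \<Oplus>\<^bsub>N\<^esub>l\<in>{i..k}. split_sum N w (\<lambda>u v. split_sum N u (\<lambda>a b. ?f k l a b v)))"
      by (intro N.finsum_cong' refl split_sum_finsum w assms(1))
        (auto intro!: Cons.prems edge closed N.finsum_closed w)
    also have "\<dots> = (\<Oplus>\<^bsub>N\<^esub>k\<in>{i..j}. \<Oplus>\<^bsub>N\<^esub>l\<in>{i..k}. split_sum N w (\<lambda>u v. split_sum N v (\<lambda>b c. ?f k l u b c)))"
      by (intro N.finsum_cong' refl Cons.IH w) (auto intro!: Cons.prems edge closed N.finsum_closed w)
    also have "\<dots> = (\<Oplus>\<^bsub>N\<^esub>l\<in>{i..j}. \<Oplus>\<^bsub>N\<^esub>k\<in>{l..j}. split_sum N w (\<lambda>u v. split_sum N v (\<lambda>b c. ?f k l u b c)))"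
      by (intro N.finsum_triangle) (auto intro!: Cons.prems edge closed w)
    also have "\<dots> = (\<Oplus>\<^bsub>N\<^esub>l\<in>{i..j}. split_sum N w (\<lambda>u v. \<Oplus>\<^bsub>N\<^esub>k\<in>{l..j}. split_sum N v (\<lambda>b c. ?f k l u b c)))"
      by (intro N.finsum_cong' refl split_sum_finsum[symmetric] w assms(1))
        (auto intro!: Cons.prems edge closed N.finsum_closed w)
    also have "\<dots> = (\<Oplus>\<^bsub>N\<^esub>l\<in>{i..j}. split_sum N w (\<lambda>u v. split_sum N (edge l j @ v) (\<lambda>b c. f (edge i l @ u) b c)))"
      by (intro N.finsum_cong' refl split_sum_cong split_sum_edge_append[symmetric] w assms(1))
        (auto intro!: Cons.prems edge closed N.finsum_closed w)
    also have "\<dots> = split_sum N (x # w) (\<lambda>u v. split_sum N v (\<lambda>b c. f u b c))"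
      by (simp add: x)
    finally show ?case .
  qed
qed

lemma split_sum_counit_left:
  assumes "abelian_monoid N" "w \<in> lists L" "\<And>v. v \<in> lists L \<Longrightarrow> f v \<in> carrier N"
  shows "split_sum N w (\<lambda>u v. if u = [] then f v else \<zero>\<^bsub>N\<^esub>) = f w"
proof -
  interpret N: abelian_monoid N by fact
  show ?thesis
    using assms(2-)
  proof (induction w arbitrary: f rule: list.induct)
    case (Cons x w)
    obtain i j where x: "x = (i, j)"
      by (cases x)
    with Cons.prems have L: "(i, j) \<in> L" "i < j" and w: "w \<in> lists L"
      using less by auto
    have IH: "split_sum N w (\<lambda>u v. if u = [] then f (x # v) else \<zero>\<^bsub>N\<^esub>) = f (x # w)"
      using Cons.prems by (intro Cons.IH w) auto
    \<comment> \<open>Only the cut at \<open>k = i\<close> leaves an empty left piece, and then the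
      whole letter passes to the right; any other cut makes every term zero.\<close>
    have "split_sum N w (\<lambda>u v. if edge i k @ u = [] then f (edge k j @ v) else \<zero>\<^bsub>N\<^esub>) =
        (if i = k then f (x # w) else \<zero>\<^bsub>N\<^esub>)" for k
    proof (cases "i = k")
      case True
      then have "edge k j = [x]"
        using L(2) by (auto simp: edge_def x)
      with True IH show ?thesis
        by (simp cong: if_cong)
    qed (simp add: edge_def split_sum_zero[OF assms(1)])
    then have "split_sum N (x # w) (\<lambda>u v. if u = [] then f v else \<zero>\<^bsub>N\<^esub>) =
        (\<Oplus>\<^bsub>N\<^esub>k\<in>{i..j}. if i = k then f (x # w) else \<zero>\<^bsub>N\<^esub>)"
      by (simp add: x cong: if_cong)
    also have "\<dots> = f (x # w)"
      using Cons.prems L(2) by (intro N.finsum_singleton) auto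
    finally show ?case .
  qed simp
qed

lemma split_sum_counit_right:
  assumes "abelian_monoid N" "w \<in> lists L" "\<And>v. v \<in> lists L \<Longrightarrow> f v \<in> carrier N"
  shows "split_sum N w (\<lambda>u v. if v = [] then f u else \<zero>\<^bsub>N\<^esub>) = f w"
proof -
  interpret N: abelian_monoid N by fact
  show ?thesis
    using assms(2-)
  proof (induction w arbitrary: f rule: list.induct)
    case (Cons x w)
    obtain i j where x: "x = (i, j)"
      by (cases x)
    with Cons.prems have L: "(i, j) \<in> L" "i < j" and w: "w \<in> lists L"
      using less by auto
    have IH: "split_sum N w (\<lambda>u v. if v = [] then f (x # u) else \<zero>\<^bsub>N\<^esub>) = f (x # w)"
      using Cons.prems by (intro Cons.IH w) auto
    have "split_sum N w (\<lambda>u v. if edge k j @ v = [] then f (edge i k @ u) else \<zero>\<^bsub>N\<^esub>) =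
        (if j = k then f (x # w) else \<zero>\<^bsub>N\<^esub>)" for k
    proof (cases "j = k")
      case True
      then have "edge i k = [x]"
        using L(2) by (auto simp: edge_def x)
      with True IH show ?thesis
        by (simp cong: if_cong)
    qed (simp add: edge_def split_sum_zero[OF assms(1)])
    then have "split_sum N (x # w) (\<lambda>u v. if v = [] then f u else \<zero>\<^bsub>N\<^esub>) =
        (\<Oplus>\<^bsub>N\<^esub>k\<in>{i..j}. if j = k then f (x # w) else \<zero>\<^bsub>N\<^esub>)"
      by (simp add: x cong: if_cong)
    also have "\<dots> = f (x # w)"
      using Cons.prems L(2) by (intro N.finsum_singleton) auto
    finally show ?case .
  qed simp
qed

end


section \<open>The bialgebra of intervals\<close>

text \<open>The coproduct is formed in the tensor square of the underlying free module, as the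
  record cannot refer to itself. Tensor powers depend only on carrier, addition and scalar
  multiplication, so they agree with those of the finished record.\<close>

definition interval_bialg ::
  "('a, 'r) ring_scheme \<Rightarrow> (nat \<times> nat) set \<Rightarrow> ('a, (nat \<times> nat) list \<Rightarrow> 'a) graded_bialg"
  where "interval_bialg R L = (let F = free_module_on R (lists L) in
    \<lparr>carrier = carrier F,
     monoid.mult = (\<lambda>x y. lin_ext R F (\<lambda>u. lin_ext R F (\<lambda>v. free_gen R (u @ v)) y) x),
     one = free_gen R [], zero = zero F, add = add F, smult = smult F,
     comult = lin_ext R (tensor_power R F 2)
       (\<lambda>w. split_sum (tensor_power R F 2) w (\<lambda>u v. pure_tensor R F [free_gen R u, free_gen R v])),
     counit = (\<lambda>h. h []),
     graded_part = (\<lambda>n. {h \<in> carrier F. \<forall>w. h w \<noteq> \<zero>\<^bsub>R\<^esub> \<longrightarrow> weight w = n})\<rparr>)"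

lemma tensor_power_cong:
  fixes M :: "('a, 'b, 'm) module_scheme" and M' :: "('a, 'b, 'n) module_scheme"
  assumes "carrier M = carrier M'" "add M = add M'" "smult M = smult M'"
  shows "tensor_power R M k = tensor_power R M' k" "pure_tensor R M xs = pure_tensor R M' xs"
  by (simp_all add: tensor_power_def pure_tensor_def tensor_null_def tensor_relations_def tuples_def assms)

lemma regular_module_simps [simp]:
  "carrier (regular_module R) = carrier R" "add (regular_module R) = add R"
  "zero (regular_module R) = zero R" "smult (regular_module R) = monoid.mult R"
  by (simp_all add: regular_module_def)

lemma regular_module_module:
  assumes "cring R"
  shows "module R (regular_module R)"
proof -
  interpret cring R by fact
  show ?thesis
  proof (rule moduleI)
    show "abelian_group (regular_module R)"
    proof (rule abelian_groupI)
      fix x assume "x \<in> carrier (regular_module R)"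
      then show "\<exists>y\<in>carrier (regular_module R). y \<oplus>\<^bsub>regular_module R\<^esub> x = \<zero>\<^bsub>regular_module R\<^esub>"
        by (intro bexI[of _ "\<ominus>\<^bsub>R\<^esub> x"]) (auto simp: l_neg)
    qed (auto simp: a_ac)
  qed (use assms in \<open>auto simp: l_distr r_distr m_assoc\<close>)
qed

locale interval_hopf = cring R + interval_letters L
  for R :: "('a, 'r) ring_scheme" (structure) and L :: "(nat \<times> nat) set"
begin

abbreviation "F \<equiv> free_module_on R (lists L)"
abbreviation "H \<equiv> interval_bialg R L"
abbreviation "T k \<equiv> tensor_power R H k"
abbreviation "e \<equiv> free_gen R"

lemma H_simps:
  "carrier H = carrier F"
  "x \<otimes>\<^bsub>H\<^esub> y = lin_ext R F (\<lambda>u. lin_ext R F (\<lambda>v. e (u @ v)) y) x"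
  "\<one>\<^bsub>H\<^esub> = e []" "\<zero>\<^bsub>H\<^esub> = \<zero>\<^bsub>F\<^esub>" "add H = add F" "smult H = smult F"
  "counit H h = h []"
  "graded_part H n = {h \<in> carrier F. \<forall>w. h w \<noteq> \<zero> \<longrightarrow> weight w = n}"
  by (simp_all add: interval_bialg_def Let_def)

lemma H_comult:
  "comult H = lin_ext R (T 2) (\<lambda>w. split_sum (T 2) w (\<lambda>u v. pure_tensor R H [e u, e v]))"
proof -
  have eq: "T 2 = tensor_power R F 2" "\<And>xs. pure_tensor R H xs = pure_tensor R F xs"
    by (intro tensor_power_cong; simp add: H_simps)+
  show ?thesis
    unfolding eq by (simp add: interval_bialg_def Let_def)
qed

lemma linear_maps_H:
  "linear_maps R H N = linear_maps R F N" "linear_maps R P H = linear_maps R P F"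
  by (simp_all add: linear_maps_def H_simps)

lemma finsum_H: "finsum H f A = finsum F f A"
  by (simp add: finsum_def finprod_def H_simps)

lemma F_module: "module R F"
  by (rule free_module_on_module) (rule is_cring)

lemma H_module: "module R H"
proof -
  interpret F: module R F by (rule F_module)
  show ?thesis
  proof (rule moduleI)
    show "abelian_group H"
      using abelian_groupE[OF F.abelian_group_axioms] by (intro abelian_groupI) (simp_all add: H_simps)
  qed (use is_cring in \<open>simp_all add: H_simps F.smult_l_distr F.smult_r_distr F.smult_assoc1\<close>)
qed

lemma e_closed [simp]: "w \<in> lists L \<Longrightarrow> e w \<in> carrier H"
  by (simp add: H_simps free_gen_closed is_cring)

lemma H_ext:
  assumes "module R N" "f \<in> linear_maps R H N" "g \<in> linear_maps R H N"
    and "\<And>w. w \<in> lists L \<Longrightarrow> f (e w) = g (e w)" "h \<in> carrier H"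
  shows "f h = g h"
  using free_module_on_ext[of R N f "lists L" g h] assms by (simp add: linear_maps_H H_simps)

text \<open>Restricting to words in the support of \<open>h\<close> matters for homogeneous
  elements: then only words of the right weight have to be considered.\<close>

lemma H_induct:
  assumes "h \<in> carrier H" "submodule N R H"
    and "\<And>w. \<lbrakk>w \<in> lists L; h w \<noteq> \<zero>\<rbrakk> \<Longrightarrow> e w \<in> N"
  shows "h \<in> N"
proof -
  interpret H: module R H by (rule H_module)
  have h: "{w. h w \<noteq> \<zero>} \<subseteq> lists L" "\<And>w. h w \<in> carrier R"
    using assms(1) by (auto simp: H_simps free_module_on_carrier)
  have "(\<Oplus>\<^bsub>H\<^esub>w\<in>{w. h w \<noteq> \<zero>}. h w \<odot>\<^bsub>H\<^esub> e w) \<in> N"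
    using h assms(3) by (intro H.submodule_finsum_closed assms(2) Pi_I H.submoduleE(4)[OF assms(2)]) auto
  then show ?thesis
    using free_module_on_expand[of R h "lists L"] assms(1) is_cring by (simp add: finsum_H H_simps)
qed

section \<open>The concatenation product\<close>

lemma concat_linear: "u \<in> lists L \<Longrightarrow> lin_ext R F (\<lambda>v. e (u @ v)) \<in> linear_maps R F F"
  by (intro lin_ext_linear F_module) (auto intro!: free_gen_closed is_cring)

lemma mult_linear_left: "y \<in> carrier H \<Longrightarrow> (\<lambda>x. x \<otimes>\<^bsub>H\<^esub> y) \<in> linear_maps R H H"
  unfolding H_simps linear_maps_H
  by (intro lin_ext_linear F_module) (auto intro: linear_maps_closed[OF concat_linear])

lemma mult_linear_right: "x \<in> carrier H \<Longrightarrow> (\<lambda>y. x \<otimes>\<^bsub>H\<^esub> y) \<in> linear_maps R H H"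
  unfolding H_simps linear_maps_H
  by (intro lin_ext_param_linear[where S="lists L"] F_module concat_linear)

lemma mult_closed: "\<lbrakk>x \<in> carrier H; y \<in> carrier H\<rbrakk> \<Longrightarrow> x \<otimes>\<^bsub>H\<^esub> y \<in> carrier H"
  by (rule linear_maps_closed[OF mult_linear_right])

lemma e_mult: "\<lbrakk>u \<in> lists L; v \<in> lists L\<rbrakk> \<Longrightarrow> e u \<otimes>\<^bsub>H\<^esub> e v = e (u @ v)"
  using linear_maps_closed[OF concat_linear, of u "e v"]
  by (simp add: H_simps lin_ext_free_gen F_module free_gen_closed is_cring)

text \<open>Both sides are linear in each variable, so words are substituted one variable at a time.
  The equation is first extended from words to arbitrary \<open>z\<close>, then to \<open>y\<close>,
  then to \<open>x\<close>.\<close>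

lemma mult_assoc:
  assumes "x \<in> carrier H" "y \<in> carrier H" "z \<in> carrier H"
  shows "x \<otimes>\<^bsub>H\<^esub> y \<otimes>\<^bsub>H\<^esub> z = x \<otimes>\<^bsub>H\<^esub> (y \<otimes>\<^bsub>H\<^esub> z)"
proof -
  note lin = linear_maps_compose[OF mult_linear_left mult_linear_left]
    linear_maps_compose[OF mult_linear_left mult_linear_right]
    linear_maps_compose[OF mult_linear_right mult_linear_left]
    linear_maps_compose[OF mult_linear_right mult_linear_right]
    mult_linear_left mult_linear_right
  have 1: "e u \<otimes>\<^bsub>H\<^esub> e v \<otimes>\<^bsub>H\<^esub> z = e u \<otimes>\<^bsub>H\<^esub> (e v \<otimes>\<^bsub>H\<^esub> z)" if "u \<in> lists L" "v \<in> lists L" for u v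
    by (rule H_ext[OF H_module _ _ _ assms(3)]) (use that in \<open>auto intro!: lin mult_closed simp: e_mult\<close>)
  have 2: "e u \<otimes>\<^bsub>H\<^esub> y \<otimes>\<^bsub>H\<^esub> z = e u \<otimes>\<^bsub>H\<^esub> (y \<otimes>\<^bsub>H\<^esub> z)" if "u \<in> lists L" for u
    by (rule H_ext[OF H_module _ _ _ assms(2), where f="\<lambda>y. e u \<otimes>\<^bsub>H\<^esub> y \<otimes>\<^bsub>H\<^esub> z"])
      (use that assms in \<open>auto intro!: lin mult_closed 1\<close>)
  show ?thesis
    by (rule H_ext[OF H_module _ _ _ assms(1), where f="\<lambda>x. x \<otimes>\<^bsub>H\<^esub> y \<otimes>\<^bsub>H\<^esub> z"])
      (use assms in \<open>auto intro!: lin mult_closed 2\<close>)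
qed

lemma one_mult:
  assumes "x \<in> carrier H"
  shows "\<one>\<^bsub>H\<^esub> \<otimes>\<^bsub>H\<^esub> x = x" "x \<otimes>\<^bsub>H\<^esub> \<one>\<^bsub>H\<^esub> = x"
proof -
  have one: "\<one>\<^bsub>H\<^esub> = e []"
    by (simp add: H_simps)
  show "\<one>\<^bsub>H\<^esub> \<otimes>\<^bsub>H\<^esub> x = x"
    unfolding one
    by (rule H_ext[OF H_module mult_linear_right linear_maps_id _ assms]) (simp_all add: e_mult)
  show "x \<otimes>\<^bsub>H\<^esub> \<one>\<^bsub>H\<^esub> = x"
    unfolding one
    by (rule H_ext[OF H_module mult_linear_left linear_maps_id _ assms]) (simp_all add: e_mult)
qed

lemma H_unital_algebra: "unital_algebra R H"
proof -
  interpret H: module R H by (rule H_module)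
  have one: "\<one>\<^bsub>H\<^esub> \<in> carrier H"
    using e_closed[of "[]"] by (simp add: H_simps del: e_closed)
  have "ring H"
    by (intro ringI monoidI H.abelian_group_axioms mult_closed mult_assoc one_mult one
        linear_maps_add[OF mult_linear_left] linear_maps_add[OF mult_linear_right])
  then show ?thesis
    by (intro unital_algebra.intro unital_algebra_axioms.intro H_module
        linear_maps_smult[OF mult_linear_left] linear_maps_smult[OF mult_linear_right])
qed

sublocale H: unital_algebra R H
  by (rule H_unital_algebra)

section \<open>The coproduct and its coassociativity\<close>

lemma T_monoid: "abelian_monoid (T k)"
  by (rule abelian_group.axioms(1)[OF module.axioms(2)[OF H.tensor_power_module]])

lemma pure_closed [simp]: "set xs \<subseteq> carrier H \<Longrightarrow> length xs = k \<Longrightarrow> pure_tensor R H xs \<in> carrier (T k)"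
  by (intro H.pure_tensor_closed) (simp add: tuples_def)

lemma comult_linear: "comult H \<in> linear_maps R H (T 2)"
  unfolding H_comult linear_maps_H
  by (intro lin_ext_linear H.tensor_power_module) (auto intro!: split_sum_closed T_monoid)

lemma comult_e:
  assumes "w \<in> lists L"
  shows "comult H (e w) = split_sum (T 2) w (\<lambda>u v. pure_tensor R H [e u, e v])"
  unfolding H_comult using assms
  by (intro lin_ext_free_gen H.tensor_power_module split_sum_closed T_monoid) auto

lemma lift_comult_linear:
  assumes "module R N" "multilinear R H N 2 f"
  shows "(\<lambda>h. tensor_lift R N f (comult H h)) \<in> linear_maps R H N"
  by (rule linear_maps_compose[OF comult_linear H.tensor_lift_linear[OF assms]])

text \<open>This replaces Sweedler notation. Coassociativity, the counit laws, the antipode and the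
  iterated coproduct are all computed on words from here.\<close>

lemma lift_comult_e:
  assumes "module R N" "multilinear R H N 2 f" "w \<in> lists L"
  shows "tensor_lift R N f (comult H (e w)) = split_sum N w (\<lambda>u v. f [e u, e v])"
proof -
  show ?thesis
    unfolding comult_e[OF assms(3)]
    by (rule split_sum_linear_eq[OF H.tensor_power_module assms(1) H.tensor_lift_linear[OF assms(1,2)] assms(3)])
      (auto intro!: H.tensor_lift_pure assms simp: tuples_def)
qed

lemma pure_1_linear: "(\<lambda>x. pure_tensor R H [x]) \<in> linear_maps R H (T 1)"
  using multilinear_linear[OF H.pure_tensor_multilinear, where i=0 and k=1 and xs="[e []]"]
  by (simp add: tuples_def)

lemma append_comult_left:
  "multilinear R H (T 3) 2 (\<lambda>xs. tensor_append R H 2 1 (comult H (xs ! 0)) (pure_tensor R H [xs ! 1]))"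
proof (rule multilinear_2I)
  fix x assume "x \<in> carrier H"
  then have "comult H x \<in> carrier (T 2)"
    by (rule linear_maps_closed[OF comult_linear])
  from linear_maps_compose[OF pure_1_linear H.tensor_append_linear_right[OF this]]
  show "(\<lambda>y. tensor_append R H 2 1 (comult H ([x, y] ! 0)) (pure_tensor R H [[x, y] ! 1])) \<in> linear_maps R H (T 3)"
    by (simp add: numeral_eq_Suc)
next
  fix y assume "y \<in> carrier H"
  then have "pure_tensor R H [y] \<in> carrier (T 1)"
    by simp
  from linear_maps_compose[OF comult_linear H.tensor_append_linear_left[OF this]]
  show "(\<lambda>x. tensor_append R H 2 1 (comult H ([x, y] ! 0)) (pure_tensor R H [[x, y] ! 1])) \<in> linear_maps R H (T 3)"
    by (simp add: numeral_eq_Suc)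
qed

lemma append_comult_right:
  "multilinear R H (T 3) 2 (\<lambda>xs. tensor_append R H 1 2 (pure_tensor R H [xs ! 0]) (comult H (xs ! 1)))"
proof (rule multilinear_2I)
  fix y assume "y \<in> carrier H"
  then have "comult H y \<in> carrier (T 2)"
    by (rule linear_maps_closed[OF comult_linear])
  from linear_maps_compose[OF pure_1_linear H.tensor_append_linear_left[OF this]]
  show "(\<lambda>x. tensor_append R H 1 2 (pure_tensor R H [[x, y] ! 0]) (comult H ([x, y] ! 1))) \<in> linear_maps R H (T 3)"
    by (simp add: numeral_eq_Suc)
next
  fix x assume "x \<in> carrier H"
  then have "pure_tensor R H [x] \<in> carrier (T 1)"
    by simp
  from linear_maps_compose[OF comult_linear H.tensor_append_linear_right[OF this]]
  show "(\<lambda>y. tensor_append R H 1 2 (pure_tensor R H [[x, y] ! 0]) (comult H ([x, y] ! 1))) \<in> linear_maps R H (T 3)"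
    by (simp add: numeral_eq_Suc)
qed

lemma append_comult_left_e:
  assumes "u \<in> lists L" "v \<in> lists L"
  shows "tensor_append R H 2 1 (comult H (e u)) (pure_tensor R H [e v]) =
    split_sum (T 3) u (\<lambda>a b. pure_tensor R H [e a, e b, e v])"
proof -
  have lin: "(\<lambda>X. tensor_append R H 2 1 X (pure_tensor R H [e v])) \<in> linear_maps R (T 2) (T 3)"
    using H.tensor_append_linear_left[of "pure_tensor R H [e v]" 1 2] assms by (simp add: numeral_eq_Suc)
  show ?thesis
    unfolding comult_e[OF assms(1)]
    using assms(2)
    by (intro split_sum_linear_eq[OF H.tensor_power_module H.tensor_power_module lin assms(1)])
      (simp_all add: H.tensor_append_pure tuples_def del: One_nat_def)
qed

lemma append_comult_right_e:
  assumes "u \<in> lists L" "v \<in> lists L"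
  shows "tensor_append R H 1 2 (pure_tensor R H [e u]) (comult H (e v)) =
    split_sum (T 3) v (\<lambda>b c. pure_tensor R H [e u, e b, e c])"
proof -
  have lin: "tensor_append R H 1 2 (pure_tensor R H [e u]) \<in> linear_maps R (T 2) (T 3)"
    using H.tensor_append_linear_right[of "pure_tensor R H [e u]" 1 2] assms by (simp add: numeral_eq_Suc)
  show ?thesis
    unfolding comult_e[OF assms(2)]
    using assms(1)
    by (intro split_sum_linear_eq[OF H.tensor_power_module H.tensor_power_module lin assms(2)])
      (simp_all add: H.tensor_append_pure tuples_def del: One_nat_def)
qed

lemma coassoc:
  assumes "h \<in> carrier H"
  shows "tensor_lift R (T 3)
      (\<lambda>xs. tensor_append R H 2 1 (comult H (xs ! 0)) (pure_tensor R H [xs ! 1])) (comult H h) =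
    tensor_lift R (T 3)
      (\<lambda>xs. tensor_append R H 1 2 (pure_tensor R H [xs ! 0]) (comult H (xs ! 1))) (comult H h)"
proof (rule H_ext[OF H.tensor_power_module lift_comult_linear lift_comult_linear _ assms])
  fix w assume w: "w \<in> lists L"
  note closed = split_sum_closed[OF T_monoid]
  have "tensor_lift R (T 3)
      (\<lambda>xs. tensor_append R H 2 1 (comult H (xs ! 0)) (pure_tensor R H [xs ! 1])) (comult H (e w)) =
    split_sum (T 3) w (\<lambda>u v. split_sum (T 3) u (\<lambda>a b. pure_tensor R H [e a, e b, e v]))"
    unfolding lift_comult_e[OF H.tensor_power_module append_comult_left w]
    by (intro split_sum_cong T_monoid w closed) (simp_all add: append_comult_left_e[simplified])
  also have "\<dots> = split_sum (T 3) w (\<lambda>u v. split_sum (T 3) v (\<lambda>b c. pure_tensor R H [e u, e b, e c]))"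
    by (intro split_sum_coassoc T_monoid w) simp
  also have "\<dots> = tensor_lift R (T 3)
      (\<lambda>xs. tensor_append R H 1 2 (pure_tensor R H [xs ! 0]) (comult H (xs ! 1))) (comult H (e w))"
    unfolding lift_comult_e[OF H.tensor_power_module append_comult_right w]
    by (intro split_sum_cong[symmetric] T_monoid w closed) (simp_all add: append_comult_right_e[simplified])
  finally show "tensor_lift R (T 3)
      (\<lambda>xs. tensor_append R H 2 1 (comult H (xs ! 0)) (pure_tensor R H [xs ! 1])) (comult H (e w)) =
    tensor_lift R (T 3)
      (\<lambda>xs. tensor_append R H 1 2 (pure_tensor R H [xs ! 0]) (comult H (xs ! 1))) (comult H (e w))" .
qed (auto intro!: H.tensor_power_module append_comult_left[simplified] append_comult_right[simplified])

section \<open>The counit\<close>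

lemma counit_linear: "counit H \<in> linear_maps R H (regular_module R)"
  by (intro linear_mapsI) (auto simp: H_simps free_module_on_carrier free_module_on_simps)

lemma counit_closed [simp]: "h \<in> carrier H \<Longrightarrow> counit H h \<in> carrier R"
  using linear_maps_closed[OF counit_linear] by simp

lemma counit_e: "counit H (e w) = (if w = [] then \<one> else \<zero>)"
  by (simp add: H_simps free_gen_def)

lemma smult_counit_linear: "y \<in> carrier H \<Longrightarrow> (\<lambda>x. counit H x \<odot>\<^bsub>H\<^esub> y) \<in> linear_maps R H H"
  using linear_maps_add[OF counit_linear] linear_maps_smult[OF counit_linear]
  by (intro linear_mapsI) (simp_all add: H.smult_l_distr H.smult_assoc1)

lemma smult_linear: "a \<in> carrier R \<Longrightarrow> (\<lambda>x. a \<odot>\<^bsub>H\<^esub> x) \<in> linear_maps R H H"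
  by (rule linear_maps_smult_fun[OF H_module _ linear_maps_id])

lemma counit_left:
  assumes "h \<in> carrier H"
  shows "tensor_lift R H (\<lambda>xs. counit H (xs ! 0) \<odot>\<^bsub>H\<^esub> xs ! 1) (comult H h) = h"
proof -
  have multi: "multilinear R H H 2 (\<lambda>xs. counit H (xs ! 0) \<odot>\<^bsub>H\<^esub> xs ! 1)"
    by (rule multilinear_2I) (simp_all add: smult_counit_linear smult_linear)
  show ?thesis
  proof (rule H_ext[OF H_module lift_comult_linear[OF H_module multi] linear_maps_id _ assms])
    fix w assume w: "w \<in> lists L"
    have "split_sum H w (\<lambda>u v. counit H (e u) \<odot>\<^bsub>H\<^esub> e v) =
        split_sum H w (\<lambda>u v. if u = [] then e v else \<zero>\<^bsub>H\<^esub>)"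
      by (rule split_sum_cong[OF H.abelian_monoid_axioms w]) (auto simp: counit_e)
    also have "\<dots> = e w"
      by (rule split_sum_counit_left[OF H.abelian_monoid_axioms w]) simp
    finally show "tensor_lift R H (\<lambda>xs. counit H (xs ! 0) \<odot>\<^bsub>H\<^esub> xs ! 1) (comult H (e w)) = e w"
      by (simp add: lift_comult_e[OF H_module multi w, simplified])
  qed
qed

lemma counit_right:
  assumes "h \<in> carrier H"
  shows "tensor_lift R H (\<lambda>xs. counit H (xs ! 1) \<odot>\<^bsub>H\<^esub> xs ! 0) (comult H h) = h"
proof -
  have multi: "multilinear R H H 2 (\<lambda>xs. counit H (xs ! 1) \<odot>\<^bsub>H\<^esub> xs ! 0)"
    by (rule multilinear_2I) (simp_all add: smult_counit_linear smult_linear)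
  show ?thesis
  proof (rule H_ext[OF H_module lift_comult_linear[OF H_module multi] linear_maps_id _ assms])
    fix w assume w: "w \<in> lists L"
    have "split_sum H w (\<lambda>u v. counit H (e v) \<odot>\<^bsub>H\<^esub> e u) =
        split_sum H w (\<lambda>u v. if v = [] then e u else \<zero>\<^bsub>H\<^esub>)"
      by (rule split_sum_cong[OF H.abelian_monoid_axioms w]) (auto simp: counit_e)
    also have "\<dots> = e w"
      by (rule split_sum_counit_right[OF H.abelian_monoid_axioms w]) simp
    finally show "tensor_lift R H (\<lambda>xs. counit H (xs ! 1) \<odot>\<^bsub>H\<^esub> xs ! 0) (comult H (e w)) = e w"
      by (simp add: lift_comult_e[OF H_module multi w, simplified])
  qed
qed

section \<open>Multiplicativity of the coproduct and the counit\<close>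

lemma comult_mult_e:
  assumes "u \<in> lists L" "v \<in> lists L"
  shows "comult H (e u \<otimes>\<^bsub>H\<^esub> e v) = tensor_square_mult R H (comult H (e u)) (comult H (e v))"
proof -
  have Tv: "comult H (e v) \<in> carrier (T 2)"
    using assms by (intro linear_maps_closed[OF comult_linear]) simp
  have inner: "tensor_square_mult R H (pure_tensor R H [e a, e b]) (comult H (e v)) =
      split_sum (T 2) v (\<lambda>c d. pure_tensor R H [e (a @ c), e (b @ d)])"
    if ab: "a \<in> lists L" "b \<in> lists L" for a b
  proof -
    have "pure_tensor R H [e a, e b] \<in> carrier (T 2)"
      using ab by simp
    note lin = H.tensor_square_mult_linear_right[OF this]
    show ?thesis
      unfolding comult_e[OF assms(2)]
      using ab
      by (intro split_sum_linear_eq[OF H.tensor_power_module H.tensor_power_module lin assms(2)])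
        (simp_all add: H.tensor_square_mult_pure e_mult)
  qed
  have "tensor_square_mult R H (comult H (e u)) (comult H (e v)) =
      split_sum (T 2) u (\<lambda>a b. tensor_square_mult R H (pure_tensor R H [e a, e b]) (comult H (e v)))"
    unfolding comult_e[OF assms(1)]
    by (rule split_sum_linear[OF H.tensor_power_module H.tensor_power_module
          H.tensor_square_mult_linear_left[OF Tv] assms(1)]) simp
  also have "\<dots> = split_sum (T 2) u (\<lambda>a b. split_sum (T 2) v (\<lambda>c d. pure_tensor R H [e (a @ c), e (b @ d)]))"
    by (intro split_sum_cong T_monoid assms split_sum_closed inner) simp_all
  \<comment> \<open>Cutting \<open>u\<close> and then \<open>v\<close> is how
    \<open>split_sum\<close> treats the word \<open>u @ v\<close>, so the nested sum is already the
    coproduct of the product.\<close>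
  also have "\<dots> = comult H (e u \<otimes>\<^bsub>H\<^esub> e v)"
    using assms by (simp add: e_mult comult_e split_sum_append)
  finally show ?thesis
    by simp
qed

lemma comult_mult:
  assumes "x \<in> carrier H" "y \<in> carrier H"
  shows "comult H (x \<otimes>\<^bsub>H\<^esub> y) = tensor_square_mult R H (comult H x) (comult H y)"
proof -
  note c = linear_maps_closed[OF comult_linear]
  have 1: "comult H (e u \<otimes>\<^bsub>H\<^esub> y) = tensor_square_mult R H (comult H (e u)) (comult H y)"
    if u: "u \<in> lists L" for u
    by (rule H_ext[OF H.tensor_power_module linear_maps_compose[OF mult_linear_right comult_linear]
          linear_maps_compose[OF comult_linear H.tensor_square_mult_linear_right[OF c]] _ assms(2)])
      (use u comult_mult_e in simp_all)
  show ?thesis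
    by (rule H_ext[OF H.tensor_power_module linear_maps_compose[OF mult_linear_left comult_linear]
          linear_maps_compose[OF comult_linear H.tensor_square_mult_linear_left[OF c]] _ assms(1)])
      (use 1 assms in simp_all)
qed

lemma counit_mult:
  assumes "x \<in> carrier H" "y \<in> carrier H"
  shows "counit H (x \<otimes>\<^bsub>H\<^esub> y) = counit H x \<otimes> counit H y"
proof -
  note reg = regular_module_module[OF is_cring]
  have lr: "(\<lambda>x. a \<otimes> counit H x) \<in> linear_maps R H (regular_module R)"
    and ll: "(\<lambda>x. counit H x \<otimes> a) \<in> linear_maps R H (regular_module R)" if "a \<in> carrier R" for a
    using that linear_maps_add[OF counit_linear] linear_maps_smult[OF counit_linear]
    by (intro linear_mapsI; simp add: r_distr l_distr m_ac)+
  have 1: "counit H (e u \<otimes>\<^bsub>H\<^esub> y) = counit H (e u) \<otimes> counit H y" if u: "u \<in> lists L" for u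
    by (rule H_ext[OF reg linear_maps_compose[OF mult_linear_right counit_linear] lr _ assms(2)])
      (use u in \<open>auto simp: e_mult counit_e\<close>)
  show ?thesis
    by (rule H_ext[OF reg linear_maps_compose[OF mult_linear_left counit_linear] ll _ assms(1)])
      (use 1 assms in auto)
qed

lemma H_bialgebra: "bialgebra R H"
proof (intro bialgebra.intro coalgebra.intro H_module H_unital_algebra)
  show "coalgebra_axioms R H"
    by (intro coalgebra_axioms.intro comult_linear counit_linear coassoc counit_left counit_right)
  have "comult H \<one>\<^bsub>H\<^esub> = pure_tensor R H [\<one>\<^bsub>H\<^esub>, \<one>\<^bsub>H\<^esub>]"
    using comult_e[of "[]"] by (simp add: H_simps)
  moreover have "counit H \<one>\<^bsub>H\<^esub> = \<one>"
    using counit_e[of "[]"] by (simp add: H_simps)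
  ultimately show "bialgebra_axioms R H"
    by (intro bialgebra_axioms.intro comult_mult counit_mult)
qed

end


section \<open>Grading\<close>

context interval_hopf
begin

lemma H_carrier: "h \<in> carrier H \<longleftrightarrow> (\<forall>w. h w \<in> carrier R) \<and> finite {w. h w \<noteq> \<zero>} \<and> {w. h w \<noteq> \<zero>} \<subseteq> lists L"
  by (simp add: H_simps free_module_on_carrier)

lemma H_pointwise:
  "\<zero>\<^bsub>H\<^esub> = (\<lambda>_. \<zero>)" "add H = (\<lambda>f g w. f w \<oplus> g w)" "smult H = (\<lambda>a f w. a \<otimes> f w)"
  by (simp_all add: H_simps free_module_on_simps)

lemma graded_part_iff: "h \<in> graded_part H n \<longleftrightarrow> h \<in> carrier H \<and> (\<forall>w. weight w \<noteq> n \<longrightarrow> h w = \<zero>)"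
  by (auto simp: H_simps)

lemma e_graded: "w \<in> lists L \<Longrightarrow> e w \<in> graded_part H (weight w)"
  by (simp add: graded_part_iff) (auto simp: free_gen_def)

lemma graded_part_submodule: "submodule (graded_part H n) R H"
proof (rule H.submoduleI)
  fix h assume h: "h \<in> graded_part H n"
  then have "\<ominus>\<^bsub>H\<^esub> h = (\<ominus> \<one>) \<odot>\<^bsub>H\<^esub> h"
    by (simp add: H.smult_l_minus graded_part_iff)
  then show "\<ominus>\<^bsub>H\<^esub> h \<in> graded_part H n"
    using h H.smult_closed[of "\<ominus> \<one>" h] by (auto simp: graded_part_iff H_pointwise)
next
  fix a h assume "a \<in> carrier R" "h \<in> graded_part H n"
  then show "a \<odot>\<^bsub>H\<^esub> h \<in> graded_part H n"
    using H.smult_closed[of a h] by (auto simp: graded_part_iff H_pointwise)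
next
  fix g h assume "g \<in> graded_part H n" "h \<in> graded_part H n"
  then show "g \<oplus>\<^bsub>H\<^esub> h \<in> graded_part H n"
    using H.M.a_closed[of g h] by (auto simp: graded_part_iff H_pointwise)
qed (use H.M.zero_closed in \<open>auto simp: graded_part_iff H_pointwise\<close>)

lemma finsum_apply:
  "g \<in> A \<rightarrow> carrier H \<Longrightarrow> (\<Oplus>\<^bsub>H\<^esub>i\<in>A. g i) w = (\<Oplus>i\<in>A. g i w)"
  by (rule finsum_fun_apply[OF is_cring H.M.abelian_monoid_axioms])
    (simp_all add: H_pointwise H_carrier)

text \<open>At the word \<open>w\<close> only the component of index \<open>weight w\<close> can be
  nonzero. If that index is missing from the sum, the component is the zero function and the
  equation still holds.\<close>

lemma graded_sum_apply:
  assumes "\<And>n. f n \<in> graded_part H n" "finite {n. f n \<noteq> \<zero>\<^bsub>H\<^esub>}"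
  shows "(\<Oplus>\<^bsub>H\<^esub>n\<in>{n. f n \<noteq> \<zero>\<^bsub>H\<^esub>}. f n) w = f (weight w) w"
proof -
  let ?A = "{n. f n \<noteq> \<zero>\<^bsub>H\<^esub>}"
  have f: "f n \<in> carrier H" "weight w \<noteq> n \<Longrightarrow> f n w = \<zero>" for n w
    using assms(1)[of n] by (auto simp: graded_part_iff)
  have c: "f n w \<in> carrier R" for n w
    using f(1) by (simp add: H_carrier)
  have "(\<Oplus>\<^bsub>H\<^esub>n\<in>?A. f n) w = (\<Oplus>n\<in>?A. f n w)"
    using f(1) by (intro finsum_apply) auto
  also have "\<dots> = (\<Oplus>n\<in>?A. if weight w = n then f n w else \<zero>)"
    using f(2) c by (intro finsum_cong') auto
  also have "\<dots> = f (weight w) w"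
  proof (cases "weight w \<in> ?A")
    case True
    then show ?thesis
      using assms(2) c by (intro finsum_singleton) auto
  next
    case False
    then have "f (weight w) w = \<zero>"
      by (simp add: H_pointwise)
    moreover have "(\<Oplus>n\<in>?A. if weight w = n then f n w else \<zero>) = \<zero>"
      using False by (intro add.finprod_one_eqI) auto
    ultimately show ?thesis
      by simp
  qed
  finally show ?thesis .
qed

text \<open>An equivalence gives existence and uniqueness of the decomposition at once, and it
  evaluates the \<open>THE\<close> in \<open>graded_proj\<close>.\<close>

lemma homogeneous_decomp_iff:
  assumes "h \<in> carrier H"
  shows "homogeneous_decomp H h f \<longleftrightarrow> f = (\<lambda>n w. if weight w = n then h w else \<zero>)"
proof
  assume f: "homogeneous_decomp H h f"
  then have "h w = f (weight w) w" for w
    using graded_sum_apply[of f w] by (simp add: homogeneous_decomp_def)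
  moreover have "f n w = \<zero>" if "weight w \<noteq> n" for n w
    using f that by (auto simp: homogeneous_decomp_def graded_part_iff)
  ultimately show "f = (\<lambda>n w. if weight w = n then h w else \<zero>)"
    by (intro ext) auto
next
  assume f: "f = (\<lambda>n w. if weight w = n then h w else \<zero>)"
  have graded: "f n \<in> graded_part H n" for n
    using assms by (auto simp: f graded_part_iff H_carrier elim!: finite_subset[rotated])
  have "{n. f n \<noteq> \<zero>\<^bsub>H\<^esub>} \<subseteq> weight ` {w. h w \<noteq> \<zero>}"
    by (auto simp: f H_pointwise fun_eq_iff)
  then have fin: "finite {n. f n \<noteq> \<zero>\<^bsub>H\<^esub>}"
    using assms by (auto simp: H_carrier intro: finite_subset)
  have "h w = (\<Oplus>\<^bsub>H\<^esub>n\<in>{n. f n \<noteq> \<zero>\<^bsub>H\<^esub>}. f n) w" for w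
    unfolding graded_sum_apply[OF graded fin] by (simp add: f)
  with graded fin show "homogeneous_decomp H h f"
    by (auto simp: homogeneous_decomp_def)
qed

lemma graded_proj_eq:
  "h \<in> carrier H \<Longrightarrow> graded_proj H n h = (\<lambda>w. if weight w = n then h w else \<zero>)"
  by (simp add: graded_proj_def homogeneous_decomp_iff)

lemma graded_proj_linear: "graded_proj H n \<in> linear_maps R H H"
proof (rule linear_mapsI)
  fix h assume h: "h \<in> carrier H"
  then show "graded_proj H n h \<in> carrier H"
    by (auto simp: graded_proj_eq) (auto simp: H_carrier elim!: finite_subset[rotated])
next
  fix g h assume "g \<in> carrier H" "h \<in> carrier H"
  then show "graded_proj H n (g \<oplus>\<^bsub>H\<^esub> h) = graded_proj H n g \<oplus>\<^bsub>H\<^esub> graded_proj H n h"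
    by (simp add: graded_proj_eq) (auto simp: H_pointwise)
next
  fix a h assume "a \<in> carrier R" "h \<in> carrier H"
  then show "graded_proj H n (a \<odot>\<^bsub>H\<^esub> h) = a \<odot>\<^bsub>H\<^esub> graded_proj H n h"
    by (simp add: graded_proj_eq) (auto simp: H_pointwise)
qed

lemma graded_proj_e:
  "w \<in> lists L \<Longrightarrow> graded_proj H n (e w) = (if weight w = n then e w else \<zero>\<^bsub>H\<^esub>)"
  by (simp add: graded_proj_eq H_pointwise) (auto simp: free_gen_def)

lemma mult_graded:
  assumes "x \<in> graded_part H i" "y \<in> graded_part H j"
  shows "x \<otimes>\<^bsub>H\<^esub> y \<in> graded_part H (i + j)"
proof -
  have xy: "x \<in> carrier H" "y \<in> carrier H"
    using assms by (auto simp: graded_part_iff)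
  have 1: "x \<otimes>\<^bsub>H\<^esub> e v \<in> graded_part H (i + j)" if v: "v \<in> lists L" "y v \<noteq> \<zero>" for v
  proof -
    have "x \<in> {x \<in> carrier H. x \<otimes>\<^bsub>H\<^esub> e v \<in> graded_part H (i + j)}"
    proof (rule H_induct[OF xy(1)])
      show "submodule {x \<in> carrier H. x \<otimes>\<^bsub>H\<^esub> e v \<in> graded_part H (i + j)} R H"
        using v by (intro submodule_preimage[OF H_module H_module _ graded_part_submodule] mult_linear_left) auto
      fix u assume u: "u \<in> lists L" "x u \<noteq> \<zero>"
      then have "weight (u @ v) = i + j"
        using v assms by (auto simp: graded_part_iff)
      then show "e u \<in> {x \<in> carrier H. x \<otimes>\<^bsub>H\<^esub> e v \<in> graded_part H (i + j)}"
        using u v e_graded[of "u @ v"] by (simp add: e_mult)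
    qed
    then show ?thesis
      by simp
  qed
  have "y \<in> {y \<in> carrier H. x \<otimes>\<^bsub>H\<^esub> y \<in> graded_part H (i + j)}"
    by (rule H_induct[OF xy(2) submodule_preimage[OF H_module H_module mult_linear_right[OF xy(1)] graded_part_submodule]])
      (simp add: 1)
  then show ?thesis
    by simp
qed

lemma comult_graded:
  assumes "h \<in> graded_part H n"
  shows "comult H h \<in> submodule_span R (T 2)
    {pure_tensor R H [x, y] | x y i j. i + j = n \<and> x \<in> graded_part H i \<and> y \<in> graded_part H j}"
    (is "_ \<in> submodule_span R (T 2) ?S")
proof -
  have h: "h \<in> carrier H"
    using assms by (simp add: graded_part_iff)
  have "?S \<subseteq> carrier (T 2)"
    by (auto simp: graded_part_iff)
  then have sub: "submodule (submodule_span R (T 2) ?S) R (T 2)"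
    by (rule submodule_span_submodule[OF H.tensor_power_module])
  have "h \<in> {h \<in> carrier H. comult H h \<in> submodule_span R (T 2) ?S}"
  proof (rule H_induct[OF h submodule_preimage[OF H_module H.tensor_power_module comult_linear sub]])
    fix w assume w: "w \<in> lists L" "h w \<noteq> \<zero>"
    then have "weight w = n"
      using assms by (auto simp: graded_part_iff)
    have "comult H (e w) \<in> submodule_span R (T 2) ?S"
      unfolding comult_e[OF w(1)]
    proof (rule split_sum_in_submodule[OF H.tensor_power_module sub w(1)])
      fix u v assume "u \<in> lists L" "v \<in> lists L" "weight u + weight v = weight w"
      with \<open>weight w = n\<close> have "pure_tensor R H [e u, e v] \<in> ?S"
        using e_graded by blast
      then show "pure_tensor R H [e u, e v] \<in> submodule_span R (T 2) ?S"
        using submodule_span_superset[of ?S] by blast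
    qed
    with w show "e w \<in> {h \<in> carrier H. comult H h \<in> submodule_span R (T 2) ?S}"
      by simp
  qed
  then show ?thesis
    by simp
qed

lemma H_graded_bialgebra: "graded_bialgebra R H"
proof (intro graded_bialgebra.intro graded_bialgebra_axioms.intro H_bialgebra
    graded_part_submodule mult_graded comult_graded)
  show "\<exists>!f. homogeneous_decomp H h f" if "h \<in> carrier H" for h
    using that by (simp add: homogeneous_decomp_iff)
  show "\<one>\<^bsub>H\<^esub> \<in> graded_part H 0"
    using e_graded[of "[]"] by (simp add: H_simps)
  show "counit H h = \<zero>" if "h \<in> graded_part H n" "n > 0" for h n
    using that by (auto simp: H_simps)
qed

text \<open>All letters have positive length, so the empty word is the only one of weight
  zero.\<close>

lemma H_connected: "graded_part H 0 = {a \<odot>\<^bsub>H\<^esub> \<one>\<^bsub>H\<^esub> | a. a \<in> carrier R}"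
proof (intro equalityI subsetI)
  fix h assume h: "h \<in> graded_part H 0"
  then have "h w = \<zero>" if "w \<noteq> []" for w
    using that weight_eq_0_iff[of w] h by (cases "w \<in> lists L") (auto simp: graded_part_iff H_carrier)
  moreover have c: "h [] \<in> carrier R"
    using h by (simp add: graded_part_iff H_carrier)
  ultimately have "h = h [] \<odot>\<^bsub>H\<^esub> \<one>\<^bsub>H\<^esub>"
    by (auto simp: H_pointwise H_simps(3) free_gen_def)
  with c show "h \<in> {a \<odot>\<^bsub>H\<^esub> \<one>\<^bsub>H\<^esub> | a. a \<in> carrier R}"
    by auto
next
  have "\<one>\<^bsub>H\<^esub> \<in> graded_part H 0"
    using e_graded[of "[]"] by (simp add: H_simps)
  then show "h \<in> graded_part H 0" if "h \<in> {a \<odot>\<^bsub>H\<^esub> \<one>\<^bsub>H\<^esub> | a. a \<in> carrier R}" for h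
    using that H.submoduleE(4)[OF graded_part_submodule] by auto
qed

section \<open>Bases of the graded components\<close>

lemma graded_part_basis:
  "module_basis R (component_module H n) (e ` {w \<in> lists L. weight w = n})" (is "module_basis R ?C ?B")
proof -
  interpret C: module R ?C
    by (rule submodule.submodule_is_module[OF graded_part_submodule H_module])
  have eval: "(\<Oplus>\<^bsub>?C\<^esub>b\<in>J. c b \<odot>\<^bsub>?C\<^esub> b) w = (\<Oplus>b\<in>J. c b \<otimes> b w)"
    if "J \<subseteq> ?B" "c \<in> J \<rightarrow> carrier R" for J c w
  proof -
    have "J \<subseteq> carrier ?C"
      using that(1) e_graded by auto
    then have "(\<lambda>b. c b \<odot>\<^bsub>?C\<^esub> b) \<in> J \<rightarrow> carrier ?C"
      using that(2) by (intro Pi_I C.smult_closed) auto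
    then have "(\<Oplus>\<^bsub>?C\<^esub>b\<in>J. c b \<odot>\<^bsub>?C\<^esub> b) w = (\<Oplus>b\<in>J. (c b \<odot>\<^bsub>?C\<^esub> b) w)"
      by (intro finsum_fun_apply[OF is_cring C.M.abelian_monoid_axioms])
        (simp_all add: H_pointwise graded_part_iff H_carrier)
    then show ?thesis
      by (simp add: H_pointwise)
  qed
  have indep: "lin_indep_family R ?C ?B (\<lambda>b. b)"
    unfolding lin_indep_family_def
  proof (intro allI impI ballI, elim conjE)
    fix J c b
    assume J: "finite J" "J \<subseteq> ?B" "c \<in> J \<rightarrow> carrier R" "b \<in> J"
      and sum: "(\<Oplus>\<^bsub>?C\<^esub>b\<in>J. c b \<odot>\<^bsub>?C\<^esub> b) = \<zero>\<^bsub>?C\<^esub>"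
    from J obtain w where w: "b = e w"
      by auto
    \<comment> \<open>Evaluation at \<open>w\<close> extracts the coefficient of \<open>b\<close>.
      The case distinction compares vectors rather than words, which keeps it correct over the zero
      ring, where all \<open>e w\<close> coincide.\<close>
    have "c b' \<otimes> b' w = (if b = b' then c b' else \<zero>)" if "b' \<in> J" for b'
    proof -
      from that J obtain v where "b' = e v" "c b' \<in> carrier R"
        by blast
      then show ?thesis
        by (metis w free_gen_def r_one r_null)
    qed
    then have "(\<Oplus>b'\<in>J. c b' \<otimes> b' w) = (\<Oplus>b'\<in>J. if b = b' then c b' else \<zero>)"
      using J by (intro finsum_cong') auto
    also have "\<dots> = c b"
      using J by (intro finsum_singleton) auto
    finally show "c b = \<zero>"
      using eval[OF J(2,3), of w] sum by (simp add: H_pointwise)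
  qed
  have "\<exists>J c. finite J \<and> J \<subseteq> ?B \<and> c \<in> J \<rightarrow> carrier R \<and> h = (\<Oplus>\<^bsub>?C\<^esub>b\<in>J. c b \<odot>\<^bsub>?C\<^esub> b)"
    if h: "h \<in> carrier ?C" for h
  proof -
    \<comment> \<open>A basis is a set of vectors, so the coefficients are indexed by vectors as
      well and a word has to be recovered from \<open>b\<close>.\<close>
    let ?J = "e ` {w. h w \<noteq> \<zero>}" and ?c = "\<lambda>b. h (SOME w. b = e w)"
    have h': "h w \<in> carrier R" "finite {w. h w \<noteq> \<zero>}" "{w. h w \<noteq> \<zero>} \<subseteq> {w \<in> lists L. weight w = n}" for w
      using h by (auto simp: graded_part_iff H_carrier)
    then have J: "finite ?J" "?J \<subseteq> ?B" "?c \<in> ?J \<rightarrow> carrier R"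
      by auto
    have "(\<Oplus>b\<in>?J. ?c b \<otimes> b w) = h w" for w
    proof (cases "h w = \<zero>")
      case True
      then have "(\<Oplus>b\<in>?J. ?c b \<otimes> b w) = \<zero>"
        using h'(1) by (intro add.finprod_one_eqI) (auto simp: free_gen_def)
      with True show ?thesis
        by simp
    next
      case False
      \<comment> \<open>A nonzero coefficient excludes the zero ring, so \<open>e\<close> is
        injective here and the choice in \<open>?c\<close> returns the intended word.\<close>
      then have ne: "\<one> \<noteq> \<zero>"
        using h'(1)[of w] by (metis l_one l_null)
      have inj: "e u = e v \<longleftrightarrow> u = v" for u v :: "(nat \<times> nat) list"
        using ne by (metis free_gen_def)
      have "(\<Oplus>b\<in>?J. ?c b \<otimes> b w) = (\<Oplus>b\<in>?J. if e w = b then ?c b else \<zero>)"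
      proof (rule finsum_cong')
        fix b assume "b \<in> ?J"
        then obtain v where "b = e v"
          by blast
        then show "?c b \<otimes> b w = (if e w = b then ?c b else \<zero>)"
          by (simp add: inj) (simp add: free_gen_def h')
      qed (use h'(1) in auto)
      also have "\<dots> = ?c (e w)"
        using False J h'(1) by (intro finsum_singleton) auto
      finally show ?thesis
        by (simp add: inj)
    qed
    then have "h = (\<Oplus>\<^bsub>?C\<^esub>b\<in>?J. ?c b \<odot>\<^bsub>?C\<^esub> b)"
      by (intro ext) (simp only: eval[OF J(2,3)])
    with J show ?thesis
      by blast
  qed
  then show ?thesis
    using indep e_graded by (auto simp: module_basis_def)
qed

lemma length_le_weight: "w \<in> lists L \<Longrightarrow> length w \<le> weight w"
proof (induction w rule: list.induct)
  case (Cons x w)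
  then show ?case
    using less[of "fst x" "snd x"] by simp
qed simp

text \<open>Each letter has weight at least one, so the weight bounds the length of a word. Over a
  finite alphabet this leaves finitely many words.\<close>

lemma finite_graded_words:
  assumes "finite L"
  shows "finite {w \<in> lists L. weight w = n}"
proof (rule finite_subset)
  show "{w \<in> lists L. weight w = n} \<subseteq> {w. set w \<subseteq> L \<and> length w \<le> n}"
    using length_le_weight by (auto simp: lists_eq_set)
qed (rule finite_lists_length_le[OF assms])

end


section \<open>The antipode\<close>

lemma (in ring) finsum_a_inv:
  assumes "finite A" "g \<in> A \<rightarrow> carrier R"
  shows "(\<Oplus>i\<in>A. \<ominus> g i) = \<ominus> (\<Oplus>i\<in>A. g i)"
proof -
  have "\<ominus> (\<Oplus>i\<in>A. g i) = (\<ominus> \<one>) \<otimes> (\<Oplus>i\<in>A. g i)"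
    using assms(2) by (simp add: l_minus)
  also have "\<dots> = (\<Oplus>i\<in>A. (\<ominus> \<one>) \<otimes> g i)"
    using assms by (intro finsum_rdistr) auto
  also have "\<dots> = (\<Oplus>i\<in>A. \<ominus> g i)"
    using assms(2) by (intro finsum_cong') (auto simp: l_minus Pi_iff)
  finally show ?thesis
    by simp
qed

text \<open>The ring need not be commutative. The left inverse equation is a recursion for
  \<open>s\<close> that descends in the second index; that \<open>s\<close> is also a right inverse
  needs a separate induction. The sums only involve entries between \<open>i\<close> and
  \<open>j\<close>, so nothing is asked of \<open>a\<close> below the diagonal.\<close>

lemma (in ring) unitriangular_inverse:
  fixes a :: "nat \<Rightarrow> nat \<Rightarrow> 'a"
  assumes a: "\<And>i j. a i j \<in> carrier R" "\<And>i. a i i = \<one>"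
  obtains s where "\<And>i j. s i j \<in> carrier R" "\<And>i. s i i = \<one>"
    "\<And>i j. i < j \<Longrightarrow> (\<Oplus>k\<in>{i..j}. s i k \<otimes> a k j) = \<zero>"
    "\<And>i j. i < j \<Longrightarrow> (\<Oplus>k\<in>{i..j}. a i k \<otimes> s k j) = \<zero>"
proof -
  \<comment> \<open>The recursion for \<open>s i j\<close> refers to \<open>s i k\<close> with
    \<open>k < j\<close>. It is obtained from \<open>rec_nat\<close> with a bound \<open>n\<close>
    on the depth, and the value is independent of \<open>n\<close> once
    \<open>n > j\<close>.\<close>
  define t :: "nat \<Rightarrow> nat \<Rightarrow> nat \<Rightarrow> 'a" where
    "t = rec_nat (\<lambda>i j. \<zero>) (\<lambda>n t i j. if i = j then \<one> else \<ominus> (\<Oplus>k\<in>{i..<j}. t i k \<otimes> a k j))"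
  have t_0: "t 0 i j = \<zero>"
    and t_Suc: "t (Suc n) i j = (if i = j then \<one> else \<ominus> (\<Oplus>k\<in>{i..<j}. t n i k \<otimes> a k j))" for n i j
    by (simp_all add: t_def)
  have t_closed: "t n i j \<in> carrier R" for n i j
    by (induction n arbitrary: i j) (auto simp: t_0 t_Suc a intro!: a_inv_closed finsum_closed)
  have t_stable: "t n i j = t m i j" if "j < n" "j < m" for n m i j
    using that
  proof (induction n arbitrary: j m)
    case (Suc n)
    then obtain m' where m: "m = Suc m'"
      by (cases m) auto
    have "(\<Oplus>k\<in>{i..<j}. t n i k \<otimes> a k j) = (\<Oplus>k\<in>{i..<j}. t m' i k \<otimes> a k j)"
      using Suc.prems m Suc.IH[of _ m'] by (intro finsum_cong') (auto intro!: t_closed a)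
    then show ?case
      by (simp add: m t_Suc)
  qed simp
  define s where "s i j = t (Suc j) i j" for i j
  have s_closed: "s i j \<in> carrier R" for i j
    by (simp add: s_def t_closed)
  have s_diag: "s i i = \<one>" for i
    by (simp add: s_def t_Suc)
  have s_rec: "s i j = \<ominus> (\<Oplus>k\<in>{i..<j}. s i k \<otimes> a k j)" if "i < j" for i j
  proof -
    have "s i j = \<ominus> (\<Oplus>k\<in>{i..<j}. t j i k \<otimes> a k j)"
      using that by (simp add: s_def t_Suc)
    also have "(\<Oplus>k\<in>{i..<j}. t j i k \<otimes> a k j) = (\<Oplus>k\<in>{i..<j}. s i k \<otimes> a k j)"
    proof (rule finsum_cong')
      fix k assume "k \<in> {i..<j}"
      then show "t j i k \<otimes> a k j = s i k \<otimes> a k j"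
        using t_stable[of k j "Suc k" i] by (simp add: s_def)
    qed (simp_all add: s_closed a)
    finally show ?thesis .
  qed
  have last: "(\<Oplus>k\<in>{i..j}. g k) = g j \<oplus> (\<Oplus>k\<in>{i..<j}. g k)"
    if "i < j" "\<And>k. g k \<in> carrier R" for i j :: nat and g
  proof -
    have "{i..j} = insert j {i..<j}"
      using that by auto
    then show ?thesis
      using that by (simp add: Pi_def)
  qed
  have left: "(\<Oplus>k\<in>{i..j}. s i k \<otimes> a k j) = \<zero>" if "i < j" for i j
    using that s_closed a(1)
    by (subst last) (auto simp: a(2) s_rec[OF that] l_neg intro!: finsum_closed)
  have right: "(\<Oplus>k\<in>{i..j}. a i k \<otimes> s k j) = \<zero>" if "i < j" for i j
    using that
  proof (induction j rule: less_induct)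
    case (less j)
    then obtain m where m: "j = Suc m" "i \<le> m"
      by (cases j) auto
    \<comment> \<open>The recursion replaces \<open>s k j\<close> for \<open>k < j\<close>. After
      interchanging the sums, the inner one is the entry \<open>(i, l)\<close> of the product of
      \<open>a\<close> and \<open>s\<close>, a Kronecker delta by induction since
      \<open>l \<le> m < j\<close>. What remains is minus \<open>a i j\<close>, and the term
      \<open>k = j\<close> cancels it because \<open>s j j\<close> is one.\<close>
    have "(\<Oplus>k\<in>{i..<j}. a i k \<otimes> s k j) = (\<Oplus>k\<in>{i..m}. \<ominus> (\<Oplus>l\<in>{k..m}. a i k \<otimes> s k l \<otimes> a l j))"
    proof (rule finsum_cong')
      fix k assume k: "k \<in> {i..m}"
      have "a i k \<otimes> s k j = \<ominus> (a i k \<otimes> (\<Oplus>l\<in>{k..m}. s k l \<otimes> a l j))"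
        using k s_closed a(1)
        by (subst s_rec) (auto simp: m atLeastLessThanSuc_atLeastAtMost r_minus intro!: finsum_closed)
      also have "\<dots> = \<ominus> (\<Oplus>l\<in>{k..m}. a i k \<otimes> s k l \<otimes> a l j)"
        using s_closed a(1) by (subst finsum_rdistr) (auto simp: m_assoc)
      finally show "a i k \<otimes> s k j = \<ominus> (\<Oplus>l\<in>{k..m}. a i k \<otimes> s k l \<otimes> a l j)" .
    qed (use s_closed a(1) in \<open>auto simp: m intro!: finsum_closed a_inv_closed\<close>)
    also have "\<dots> = \<ominus> (\<Oplus>k\<in>{i..m}. \<Oplus>l\<in>{k..m}. a i k \<otimes> s k l \<otimes> a l j)"
      using s_closed a(1) by (intro finsum_a_inv) (auto intro!: finsum_closed)
    also have "(\<Oplus>k\<in>{i..m}. \<Oplus>l\<in>{k..m}. a i k \<otimes> s k l \<otimes> a l j) =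
        (\<Oplus>l\<in>{i..m}. \<Oplus>k\<in>{i..l}. a i k \<otimes> s k l \<otimes> a l j)"
      using s_closed a(1) by (intro finsum_triangle[symmetric]) auto
    also have "\<dots> = (\<Oplus>l\<in>{i..m}. if i = l then a l j else \<zero>)"
    proof (rule finsum_cong')
      fix l assume l: "l \<in> {i..m}"
      have "(\<Oplus>k\<in>{i..l}. a i k \<otimes> s k l \<otimes> a l j) = (\<Oplus>k\<in>{i..l}. a i k \<otimes> s k l) \<otimes> a l j"
        using s_closed a(1) by (subst finsum_ldistr) auto
      also have "\<dots> = (if i = l then a l j else \<zero>)"
        using l less.IH[of l] m a by (auto simp: s_diag)
      finally show "(\<Oplus>k\<in>{i..l}. a i k \<otimes> s k l \<otimes> a l j) = (if i = l then a l j else \<zero>)" .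
    qed (use a(1) in auto)
    also have "\<dots> = a i j"
      using m a(1) by (intro finsum_singleton) auto
    finally show ?case
      using less.prems s_closed a(1) by (subst last) (auto simp: s_diag r_neg)
  qed
  show ?thesis
    by (rule that[OF s_closed s_diag left right])
qed

context interval_hopf
begin

lemma antipode_exists: "\<exists>S. is_antipode R H S"
proof -
  have e_Nil: "e [] = \<one>\<^bsub>H\<^esub>"
    by (simp add: H_simps)
  \<comment> \<open>The inversion lemma takes a total matrix, and zero is a filler. If
    \<open>(i, j) \<in> L\<close>, then all intervals inside it are in \<open>L\<close>, so the sums
    over \<open>{i..j}\<close> do not meet the filler.\<close>
  define a where "a i j = (if edge i j \<in> lists L then e (edge i j) else \<zero>\<^bsub>H\<^esub>)" for i j
  have a_closed: "a i j \<in> carrier H" for i j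
    by (simp add: a_def)
  have a_diag: "a i i = \<one>\<^bsub>H\<^esub>" for i
    by (simp add: a_def e_Nil)
  have a_edge: "e (edge i j @ w) = a i j \<otimes>\<^bsub>H\<^esub> e w" if "edge i j \<in> lists L" "w \<in> lists L" for i j w
    using that by (simp add: a_def e_mult)
  obtain s where s: "\<And>i j. s i j \<in> carrier H" "\<And>i. s i i = \<one>\<^bsub>H\<^esub>"
      "\<And>i j. i < j \<Longrightarrow> (\<Oplus>\<^bsub>H\<^esub>k\<in>{i..j}. s i k \<otimes>\<^bsub>H\<^esub> a k j) = \<zero>\<^bsub>H\<^esub>"
      "\<And>i j. i < j \<Longrightarrow> (\<Oplus>\<^bsub>H\<^esub>k\<in>{i..j}. a i k \<otimes>\<^bsub>H\<^esub> s k j) = \<zero>\<^bsub>H\<^esub>"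
    by (rule ring.unitriangular_inverse[OF H.algebra_ring a_closed a_diag]) (rule that)
  \<comment> \<open>An antipode reverses products, so the letter split off at the front contributes
    the last factor.\<close>
  define Sw where "Sw = rec_list \<one>\<^bsub>H\<^esub> (\<lambda>x _ y. y \<otimes>\<^bsub>H\<^esub> s (fst x) (snd x))"
  have Sw_Nil: "Sw [] = \<one>\<^bsub>H\<^esub>" and Sw_Cons: "Sw (x # w) = Sw w \<otimes>\<^bsub>H\<^esub> s (fst x) (snd x)" for x w
    by (simp_all add: Sw_def)
  have Sw_closed: "Sw w \<in> carrier H" for w
    by (induction w) (auto simp: Sw_Nil Sw_Cons s(1) mult_closed)
  have Sw_edge: "Sw (edge i j @ w) = Sw w \<otimes>\<^bsub>H\<^esub> s i j" for i j w
    by (simp add: edge_def Sw_Cons s(2) Sw_closed)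
  define S where "S = lin_ext R H Sw"
  have S_linear: "S \<in> linear_maps R H H"
    unfolding S_def linear_maps_H(1) by (intro lin_ext_linear H_module) (simp add: Sw_closed)
  have S_e: "S (e w) = Sw w" for w
    unfolding S_def by (intro lin_ext_free_gen H_module Sw_closed)
  have multi_left: "multilinear R H H 2 (\<lambda>xs. S (xs ! 0) \<otimes>\<^bsub>H\<^esub> xs ! 1)"
    by (rule multilinear_2I)
      (simp_all add: mult_linear_right linear_maps_closed[OF S_linear] linear_maps_compose[OF S_linear mult_linear_left])
  have multi_right: "multilinear R H H 2 (\<lambda>xs. xs ! 0 \<otimes>\<^bsub>H\<^esub> S (xs ! 1))"
    by (rule multilinear_2I)
      (simp_all add: mult_linear_left linear_maps_closed[OF S_linear] linear_maps_compose[OF S_linear mult_linear_right])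
  have left: "split_sum H w (\<lambda>u v. Sw u \<otimes>\<^bsub>H\<^esub> e v) = (if w = [] then \<one>\<^bsub>H\<^esub> else \<zero>\<^bsub>H\<^esub>)"
    if w: "w \<in> lists L" for w
  proof (cases w)
    case Nil
    then show ?thesis
      by (simp add: Sw_Nil e_Nil)
  next
    case (Cons x w')
    obtain i j where x: "x = (i, j)"
      by (cases x)
    with Cons w have ij: "(i, j) \<in> L" "i < j" and w': "w' \<in> lists L"
      using less by auto
    note edge = edge_closed[OF ij(1)]
    \<comment> \<open>As \<open>Sw\<close> reverses the order, the two halves of the first letter
      meet in the middle as \<open>s i k\<close> and \<open>a k j\<close>. Summing over
      \<open>k\<close> gives zero by the left inverse property, whatever the rest of the word
      is.\<close>
    let ?f = "\<lambda>u v k. Sw u \<otimes>\<^bsub>H\<^esub> (s i k \<otimes>\<^bsub>H\<^esub> a k j) \<otimes>\<^bsub>H\<^esub> e v"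
    have "split_sum H w (\<lambda>u v. Sw u \<otimes>\<^bsub>H\<^esub> e v) = (\<Oplus>\<^bsub>H\<^esub>k\<in>{i..j}. split_sum H w' (\<lambda>u v. ?f u v k))"
      unfolding Cons x split_sum.simps fst_conv snd_conv
      by (intro H.M.finsum_cong' refl split_sum_cong[OF H.M.abelian_monoid_axioms w'])
        (auto intro!: split_sum_closed H.M.abelian_monoid_axioms w'
          simp: Sw_edge a_edge edge Sw_closed s(1) a_closed mult_closed mult_assoc)
    also have "\<dots> = split_sum H w' (\<lambda>u v. \<Oplus>\<^bsub>H\<^esub>k\<in>{i..j}. ?f u v k)"
      by (intro split_sum_finsum[symmetric] H.M.abelian_monoid_axioms w')
        (simp_all add: Sw_closed s(1) a_closed mult_closed)
    also have "\<dots> = split_sum H w' (\<lambda>u v. \<zero>\<^bsub>H\<^esub>)"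
    proof (rule split_sum_cong[OF H.M.abelian_monoid_axioms w'])
      fix u v assume v: "v \<in> lists L"
      have lin: "(\<lambda>z. Sw u \<otimes>\<^bsub>H\<^esub> z \<otimes>\<^bsub>H\<^esub> e v) \<in> linear_maps R H H"
        by (rule linear_maps_compose[OF mult_linear_right mult_linear_left]) (simp_all add: Sw_closed v)
      have "(\<Oplus>\<^bsub>H\<^esub>k\<in>{i..j}. ?f u v k) =
          Sw u \<otimes>\<^bsub>H\<^esub> (\<Oplus>\<^bsub>H\<^esub>k\<in>{i..j}. s i k \<otimes>\<^bsub>H\<^esub> a k j) \<otimes>\<^bsub>H\<^esub> e v"
        by (rule linear_maps_finsum[OF H_module H_module lin, symmetric]) (simp add: s(1) a_closed mult_closed)
      then show "(\<Oplus>\<^bsub>H\<^esub>k\<in>{i..j}. ?f u v k) = \<zero>\<^bsub>H\<^esub>"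
        using linear_maps_zero[OF H_module H_module lin] by (simp add: s(3) ij(2))
    qed simp
    finally show ?thesis
      by (simp add: split_sum_zero[OF H.M.abelian_monoid_axioms] Cons)
  qed
  have right: "split_sum H w (\<lambda>u v. e u \<otimes>\<^bsub>H\<^esub> Sw v) = (if w = [] then \<one>\<^bsub>H\<^esub> else \<zero>\<^bsub>H\<^esub>)"
    if "w \<in> lists L" for w
    using that
  proof (induction w rule: list.induct)
    case Nil
    then show ?case
      by (simp add: Sw_Nil e_Nil)
  next
    case (Cons x w)
    obtain i j where x: "x = (i, j)"
      by (cases x)
    with Cons have ij: "(i, j) \<in> L" "i < j" and w: "w \<in> lists L"
      using less by auto
    note edge = edge_closed[OF ij(1)]
    \<comment> \<open>On this side the halves \<open>a i k\<close> and \<open>s k j\<close> of the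
      first letter enclose the sum for the rest of the word, hence the induction. The hypothesis
      makes the middle zero or one; in the latter case the right inverse property applies.\<close>
    let ?q = "split_sum H w (\<lambda>u v. e u \<otimes>\<^bsub>H\<^esub> Sw v)"
    have q: "?q = \<one>\<^bsub>H\<^esub> \<or> ?q = \<zero>\<^bsub>H\<^esub>"
      using Cons.IH[OF w] by simp
    have "split_sum H (x # w) (\<lambda>u v. e u \<otimes>\<^bsub>H\<^esub> Sw v) = (\<Oplus>\<^bsub>H\<^esub>k\<in>{i..j}. a i k \<otimes>\<^bsub>H\<^esub> ?q \<otimes>\<^bsub>H\<^esub> s k j)"
      unfolding x split_sum.simps fst_conv snd_conv
    proof (rule H.M.finsum_cong')
      fix k assume k: "k \<in> {i..j}"
      have lin: "(\<lambda>z. a i k \<otimes>\<^bsub>H\<^esub> z \<otimes>\<^bsub>H\<^esub> s k j) \<in> linear_maps R H H"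
        by (rule linear_maps_compose[OF mult_linear_right mult_linear_left]) (simp_all add: a_closed s(1))
      show "split_sum H w (\<lambda>u v. e (edge i k @ u) \<otimes>\<^bsub>H\<^esub> Sw (edge k j @ v)) =
          a i k \<otimes>\<^bsub>H\<^esub> ?q \<otimes>\<^bsub>H\<^esub> s k j"
        using k
        by (intro split_sum_linear_eq[OF H_module H_module lin w, symmetric])
          (auto simp: Sw_edge a_edge edge Sw_closed s(1) a_closed mult_closed mult_assoc)
    qed (use q in \<open>auto simp: a_closed s(1) mult_closed\<close>)
    also have "\<dots> = \<zero>\<^bsub>H\<^esub>"
      using q by (auto simp: a_closed s(1,4) ij(2))
    finally show ?case
      by simp
  qed
  have unit: "(\<lambda>h. counit H h \<odot>\<^bsub>H\<^esub> \<one>\<^bsub>H\<^esub>) \<in> linear_maps R H H"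
    by (rule smult_counit_linear) simp
  have "is_antipode R H S"
    unfolding is_antipode_def
  proof (intro conjI ballI S_linear)
    fix h assume h: "h \<in> carrier H"
    show "tensor_lift R H (\<lambda>xs. S (xs ! 0) \<otimes>\<^bsub>H\<^esub> xs ! 1) (comult H h) = counit H h \<odot>\<^bsub>H\<^esub> \<one>\<^bsub>H\<^esub>"
      by (rule H_ext[OF H_module lift_comult_linear[OF H_module multi_left] unit _ h])
        (simp add: lift_comult_e[OF H_module multi_left, simplified] S_e left counit_e)
    show "tensor_lift R H (\<lambda>xs. xs ! 0 \<otimes>\<^bsub>H\<^esub> S (xs ! 1)) (comult H h) = counit H h \<odot>\<^bsub>H\<^esub> \<one>\<^bsub>H\<^esub>"
      by (rule H_ext[OF H_module lift_comult_linear[OF H_module multi_right] unit _ h])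
        (simp add: lift_comult_e[OF H_module multi_right, simplified] S_e right counit_e)
  qed
  then show ?thesis
    by (rule exI[where x=S])
qed

lemma H_hopf: "connected_graded_hopf_algebra R H"
  by (intro connected_graded_hopf_algebra.intro connected_graded_hopf_algebra_axioms.intro
      H_graded_bialgebra antipode_exists H_connected)

end


section \<open>The operators on a generator\<close>

text \<open>A zero gap contributes the empty word, which stands for a tensor factor one.\<close>

primrec intervals :: "nat \<Rightarrow> nat list \<Rightarrow> (nat \<times> nat) list list"
  where
    "intervals i [] = []"
  | "intervals i (b # bs) = edge i (i + b) # intervals (i + b) bs"

lemma length_intervals [simp]: "length (intervals i bs) = length bs"
  by (induction bs arbitrary: i) auto

lemma intervals_nth:
  "q < length bs \<Longrightarrow>
    intervals i bs ! q = edge (i + sum_list (take q bs)) (i + sum_list (take q bs) + bs ! q)"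
proof (induction bs arbitrary: i q)
  case (Cons b bs)
  then show ?case
    by (cases q) (simp_all add: add.assoc)
qed simp

definition gap_lists :: "nat \<Rightarrow> nat \<Rightarrow> nat list set"
  where "gap_lists k n = {bs. length bs = k \<and> sum_list bs = n}"

lemma finite_gap_lists: "finite (gap_lists k n)"
proof (rule finite_subset)
  show "gap_lists k n \<subseteq> {bs. set bs \<subseteq> {..n} \<and> length bs = k}"
    by (auto simp: gap_lists_def member_le_sum_list)
qed (rule finite_lists_length_eq[OF finite_atMost])

lemma gap_lists_0: "gap_lists 0 n = (if n = 0 then {[]} else {})"
  by (auto simp: gap_lists_def)

lemma gap_lists_Cons: "b # bs \<in> gap_lists (Suc k) n \<longleftrightarrow> b \<le> n \<and> bs \<in> gap_lists k (n - b)"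
  by (auto simp: gap_lists_def)

lemma gap_lists_Suc: "gap_lists (Suc k) n = (\<Union>b\<in>{..n}. (#) b ` gap_lists k (n - b))"
proof (intro equalityI subsetI)
  fix bs assume bs: "bs \<in> gap_lists (Suc k) n"
  then obtain b bs' where "bs = b # bs'"
    by (auto simp: gap_lists_def length_Suc_conv)
  with bs show "bs \<in> (\<Union>b\<in>{..n}. (#) b ` gap_lists k (n - b))"
    by (auto simp: gap_lists_Cons)
qed (auto simp: gap_lists_Cons)

text \<open>Splitting off the first part mirrors the recursion of \<open>iter_comult\<close>, which
  splits off the first tensor factor.\<close>

lemma (in abelian_monoid) finsum_gap_lists_Suc:
  assumes "\<And>bs. bs \<in> gap_lists (Suc k) n \<Longrightarrow> f bs \<in> carrier G"
  shows "(\<Oplus>bs\<in>gap_lists (Suc k) n. f bs) = (\<Oplus>b\<in>{..n}. \<Oplus>bs\<in>gap_lists k (n - b). f (b # bs))"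
proof -
  have "(\<Oplus>bs\<in>gap_lists (Suc k) n. f bs) = (\<Oplus>b\<in>{..n}. \<Oplus>bs\<in>(#) b ` gap_lists k (n - b). f bs)"
    unfolding gap_lists_Suc
    by (intro add.finprod_UN_disjoint)
      (auto simp: finite_gap_lists pairwise_def disjnt_def gap_lists_Cons intro!: assms)
  also have "\<dots> = (\<Oplus>b\<in>{..n}. \<Oplus>bs\<in>gap_lists k (n - b). f (b # bs))"
    by (intro finsum_cong' refl finsum_reindex)
      (auto simp: gap_lists_Cons intro!: assms finsum_closed)
  finally show ?thesis .
qed

lemma (in module) perm_action_multilinear:
  assumes "\<tau> permutes {1..k}"
  shows "multilinear R M (tensor_power R M k) k (\<lambda>xs. pure_tensor R M (map (\<lambda>i. xs ! (\<tau> i - 1)) [1..<Suc k]))"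
proof (rule multilinearI)
  have range: "\<tau> i - 1 < k" "1 \<le> \<tau> i" if "1 \<le> i" "i \<le> k" for i
    using permutes_in_image[OF assms, of i] that by auto
  have tup: "map (\<lambda>i. xs ! (\<tau> i - 1)) [1..<Suc k] \<in> tuples M k" if "xs \<in> tuples M k" for xs
    using that range by (auto simp: tuples_def subset_iff)
  then show "pure_tensor R M (map (\<lambda>i. xs ! (\<tau> i - 1)) [1..<Suc k]) \<in> carrier (tensor_power R M k)"
    if "xs \<in> tuples M k" for xs
    using that by (intro pure_tensor_closed)
  fix xs j assume xs: "xs \<in> tuples M k" and j: "j < k"
  \<comment> \<open>Entry \<open>j\<close> of the input, counted from \<open>0\<close>, is read at
    exactly one place of the output, namely \<open>?p\<close> counted from \<open>1\<close>.
    Updating the input there is an update of one entry of the output.\<close>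
  let ?p = "Hilbert_Choice.inv \<tau> (Suc j)"
  have p: "1 \<le> ?p" "?p \<le> k"
    using permutes_in_image[OF permutes_inv[OF assms], of "Suc j"] j by auto
  have "map (\<lambda>i. xs[j := x] ! (\<tau> i - 1)) [1..<Suc k] =
      (map (\<lambda>i. xs ! (\<tau> i - 1)) [1..<Suc k])[?p - 1 := x]" for x
  proof (rule nth_equalityI)
    fix i assume "i < length (map (\<lambda>i. xs[j := x] ! (\<tau> i - 1)) [1..<Suc k])"
    then have i: "i < k"
      by (simp del: upt_Suc)
    have "j = \<tau> (Suc i) - 1 \<longleftrightarrow> ?p - 1 = i"
      using range[of "Suc i"] i p permutes_inv_eq[OF assms, of "Suc j" "Suc i"] by auto
    then show "map (\<lambda>i. xs[j := x] ! (\<tau> i - 1)) [1..<Suc k] ! i =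
        (map (\<lambda>i. xs ! (\<tau> i - 1)) [1..<Suc k])[?p - 1 := x] ! i"
      using xs i j range[of "Suc i"] by (simp add: tuples_def nth_list_update del: upt_Suc)
  qed (simp del: upt_Suc)
  then show "(\<lambda>x. pure_tensor R M (map (\<lambda>i. xs[j := x] ! (\<tau> i - 1)) [1..<Suc k])) \<in>
      linear_maps R M (tensor_power R M k)"
    using multilinear_linear[OF pure_tensor_multilinear tup[OF xs], of "?p - 1"] p by auto
qed

lemma (in module) tensor_map_multilinear:
  assumes "\<And>f. f \<in> set fs \<Longrightarrow> f \<in> linear_maps R M M"
  shows "multilinear R M (tensor_power R M (length fs)) (length fs)
    (\<lambda>xs. pure_tensor R M (map (\<lambda>i. (fs ! i) (xs ! i)) [0..<length fs]))"
proof (rule multilinearI)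
  have tup: "map (\<lambda>i. (fs ! i) (xs ! i)) [0..<length fs] \<in> tuples M (length fs)"
    if "xs \<in> tuples M (length fs)" for xs
    using tuples_nth[OF that] linear_maps_closed[OF assms] by (auto simp: tuples_def)
  then show "pure_tensor R M (map (\<lambda>i. (fs ! i) (xs ! i)) [0..<length fs]) \<in> carrier (tensor_power R M (length fs))"
    if "xs \<in> tuples M (length fs)" for xs
    using that by (intro pure_tensor_closed)
  fix xs i assume xs: "xs \<in> tuples M (length fs)" and i: "i < length fs"
  have "map (\<lambda>j. (fs ! j) (xs[i := x] ! j)) [0..<length fs] =
      (map (\<lambda>j. (fs ! j) (xs ! j)) [0..<length fs])[i := (fs ! i) x]" for x
    using xs i by (intro nth_equalityI) (auto simp: tuples_def nth_list_update)
  then show "(\<lambda>x. pure_tensor R M (map (\<lambda>j. (fs ! j) (xs[i := x] ! j)) [0..<length fs])) \<in>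
      linear_maps R M (tensor_power R M (length fs))"
    using pure_tensor_linear_comp[OF tup[OF xs] i assms[OF nth_mem[OF i]]] by simp
qed

section \<open>The iterated coproduct of a generator\<close>

context interval_hopf
begin

lemma intervals_closed:
  assumes "edge i (i + sum_list bs) \<in> lists L"
  shows "set (intervals i bs) \<subseteq> lists L"
  using assms
proof (induction bs arbitrary: i)
  case (Cons b bs)
  then show ?case
    using edge_sub_closed[OF Cons.prems, of i "i + b"]
      edge_sub_closed[OF Cons.prems, of "i + b" "i + b + sum_list bs"] by (simp add: add.assoc)
qed simp

lemma intervals_tuple:
  "\<lbrakk>edge i (i + sum_list bs) \<in> lists L; length bs = k\<rbrakk> \<Longrightarrow> map e (intervals i bs) \<in> tuples H k"
  using intervals_closed[of i bs] by (auto simp: tuples_def)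

lemma append_iter_multilinear:
  assumes "iter_comult R H k \<in> linear_maps R H (T k)"
  shows "multilinear R H (T (Suc k)) 2
    (\<lambda>xs. tensor_append R H 1 k (pure_tensor R H [xs ! 0]) (iter_comult R H k (xs ! 1)))"
proof (rule multilinear_2I)
  fix x assume "x \<in> carrier H"
  then have "pure_tensor R H [x] \<in> carrier (T 1)"
    by simp
  from linear_maps_compose[OF assms H.tensor_append_linear_right[OF this]]
  show "(\<lambda>y. tensor_append R H 1 k (pure_tensor R H [[x, y] ! 0]) (iter_comult R H k ([x, y] ! 1)))
      \<in> linear_maps R H (T (Suc k))"
    by simp
next
  fix y assume "y \<in> carrier H"
  then have "iter_comult R H k y \<in> carrier (T k)"
    by (rule linear_maps_closed[OF assms])
  from linear_maps_compose[OF pure_1_linear H.tensor_append_linear_left[OF this]]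
  show "(\<lambda>x. tensor_append R H 1 k (pure_tensor R H [[x, y] ! 0]) (iter_comult R H k ([x, y] ! 1)))
      \<in> linear_maps R H (T (Suc k))"
    by simp
qed

lemma iter_comult_linear: "iter_comult R H k \<in> linear_maps R H (T k)"
proof (induction k)
  case 0
  interpret T0: module R "T 0" by (rule H.tensor_power_module)
  have "pure_tensor R H [] \<in> carrier (T 0)"
    by simp
  then show ?case
    using linear_maps_add[OF counit_linear] linear_maps_smult[OF counit_linear]
    by (intro linear_mapsI) (simp_all add: T0.smult_l_distr T0.smult_assoc1)
next
  case (Suc k)
  have "iter_comult R H (Suc k) = (\<lambda>h. tensor_lift R (T (Suc k))
      (\<lambda>xs. tensor_append R H 1 k (pure_tensor R H [xs ! 0]) (iter_comult R H k (xs ! 1))) (comult H h))"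
    by (rule ext) simp
  then show ?case
    using lift_comult_linear[OF H.tensor_power_module append_iter_multilinear[OF Suc]] by simp
qed

text \<open>The left endpoint varies and \<open>n = 0\<close> is allowed, because the induction
  applies the formula to the right piece of a cut, which may be degenerate. For \<open>k = 0\<close>
  the counit leaves the empty tensor if \<open>n = 0\<close> and zero otherwise, in accordance with
  the weak compositions without parts.\<close>

lemma iter_comult_edge:
  assumes "edge i (i + n) \<in> lists L"
  shows "iter_comult R H k (e (edge i (i + n))) =
    (\<Oplus>\<^bsub>T k\<^esub>bs\<in>gap_lists k n. pure_tensor R H (map e (intervals i bs)))"
  using assms
proof (induction k arbitrary: i n)
  case 0
  interpret T0: module R "T 0" by (rule H.tensor_power_module)
  have "pure_tensor R H [] \<in> carrier (T 0)"
    by simp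
  then show ?case
    by (simp add: gap_lists_0 counit_e edge_def)
next
  case (Suc k)
  interpret T1: abelian_monoid "T (Suc k)" by (rule T_monoid)
  let ?g = "\<lambda>u v. tensor_append R H 1 k (pure_tensor R H [e u]) (iter_comult R H k (e v))"
  note edge = edge_sub_closed[OF Suc.prems]
  have g_closed: "?g u v \<in> carrier (T (Suc k))" if "u \<in> lists L" "v \<in> lists L" for u v
    using multilinear_closed[OF append_iter_multilinear[OF iter_comult_linear], of "[e u, e v]"] that
    by (simp add: tuples_def)
  have intervals: "map e (intervals i bs) \<in> tuples H (Suc k)" if "bs \<in> gap_lists (Suc k) n" for bs
    using that Suc.prems by (intro intervals_tuple) (auto simp: gap_lists_def)
  have g_edge: "?g (edge i (i + b)) (edge (i + b) (i + n)) =
      (\<Oplus>\<^bsub>T (Suc k)\<^esub>bs\<in>gap_lists k (n - b). pure_tensor R H (map e (intervals i (b # bs))))"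
    if b: "b \<le> n" for b
  proof -
    have e1: "edge i (i + b) \<in> lists L" and e2: "edge (i + b) (i + b + (n - b)) \<in> lists L"
      using edge[of i "i + b"] edge[of "i + b" "i + n"] b by auto
    then have x: "[e (edge i (i + b))] \<in> tuples H 1"
      by (simp add: tuples_def)
    have lin: "tensor_append R H 1 k (pure_tensor R H [e (edge i (i + b))]) \<in> linear_maps R (T k) (T (Suc k))"
      using H.tensor_append_linear_right[OF H.pure_tensor_closed[OF x], of k] by simp
    have tup: "map e (intervals (i + b) bs) \<in> tuples H k" if "bs \<in> gap_lists k (n - b)" for bs
      using that e2 by (intro intervals_tuple) (auto simp: gap_lists_def)
    have "?g (edge i (i + b)) (edge (i + b) (i + n)) =
        tensor_append R H 1 k (pure_tensor R H [e (edge i (i + b))])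
          (\<Oplus>\<^bsub>T k\<^esub>bs\<in>gap_lists k (n - b). pure_tensor R H (map e (intervals (i + b) bs)))"
      using Suc.IH[OF e2] b by simp
    also have "\<dots> = (\<Oplus>\<^bsub>T (Suc k)\<^esub>bs\<in>gap_lists k (n - b).
        tensor_append R H 1 k (pure_tensor R H [e (edge i (i + b))]) (pure_tensor R H (map e (intervals (i + b) bs))))"
      by (rule linear_maps_finsum[OF H.tensor_power_module H.tensor_power_module lin])
        (intro Pi_I H.pure_tensor_closed tup)
    also have "\<dots> = (\<Oplus>\<^bsub>T (Suc k)\<^esub>bs\<in>gap_lists k (n - b). pure_tensor R H (map e (intervals i (b # bs))))"
      using b by (intro T1.finsum_cong' refl Pi_I H.pure_tensor_closed intervals)
        (simp_all add: gap_lists_Cons H.tensor_append_pure[OF x tup] del: One_nat_def intervals.simps,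
          simp)
    finally show ?thesis .
  qed
  \<comment> \<open>Appending the empty word gives the shape of
    \<open>split_sum_edge_append\<close>, which includes the degenerate edge.\<close>
  have "iter_comult R H (Suc k) (e (edge i (i + n))) = split_sum (T (Suc k)) (edge i (i + n) @ []) ?g"
    using lift_comult_e[OF H.tensor_power_module append_iter_multilinear[OF iter_comult_linear] Suc.prems, of k]
    by simp
  also have "\<dots> = (\<Oplus>\<^bsub>T (Suc k)\<^esub>l\<in>(+) i ` {..n}. ?g (edge i l) (edge l (i + n)))"
    using split_sum_edge_append[OF T_monoid _ Suc.prems, of "[]" ?g] g_closed
    by (simp add: image_add_atLeastAtMost atMost_atLeast0 add.commute[of n i])
  also have "\<dots> = (\<Oplus>\<^bsub>T (Suc k)\<^esub>b\<in>{..n}. ?g (edge i (i + b)) (edge (i + b) (i + n)))"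
    by (intro T1.finsum_reindex) (auto intro!: g_closed edge simp del: One_nat_def)
  also have "\<dots> = (\<Oplus>\<^bsub>T (Suc k)\<^esub>b\<in>{..n}. \<Oplus>\<^bsub>T (Suc k)\<^esub>bs\<in>gap_lists k (n - b). pure_tensor R H (map e (intervals i (b # bs))))"
    by (intro T1.finsum_cong' refl Pi_I T1.finsum_closed H.pure_tensor_closed intervals g_edge)
      (simp_all add: gap_lists_def)
  also have "\<dots> = (\<Oplus>\<^bsub>T (Suc k)\<^esub>bs\<in>gap_lists (Suc k) n. pure_tensor R H (map e (intervals i bs)))"
    by (intro T1.finsum_gap_lists_Suc[symmetric] H.pure_tensor_closed intervals)
  finally show ?case .
qed

lemma foldr_mult_e:
  "set ws \<subseteq> lists L \<Longrightarrow> foldr (\<otimes>\<^bsub>H\<^esub>) (map e ws) \<one>\<^bsub>H\<^esub> = e (concat ws)"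
proof (induction ws)
  case (Cons w ws)
  then have "concat ws \<in> lists L"
    by (auto simp: lists_eq_set)
  with Cons show ?case
    by (simp add: e_mult)
qed (simp add: H_simps)

lemma foldr_mult_zero:
  assumes "set xs \<subseteq> carrier H" "\<zero>\<^bsub>H\<^esub> \<in> set xs"
  shows "foldr (\<otimes>\<^bsub>H\<^esub>) xs \<one>\<^bsub>H\<^esub> = \<zero>\<^bsub>H\<^esub>"
  using assms
proof (induction xs)
  case (Cons x xs)
  have "foldr (\<otimes>\<^bsub>H\<^esub>) xs \<one>\<^bsub>H\<^esub> \<in> carrier H"
    using Cons.prems(1) multilinear_closed[OF H.iter_mult_multilinear, of xs "length xs"]
    by (simp add: tuples_def)
  then show ?case
    using Cons linear_maps_zero[OF H_module H_module mult_linear_right, of x]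
      linear_maps_zero[OF H_module H_module mult_linear_left] by auto
qed simp

end

section \<open>The word of a composition and a permutation\<close>

definition blocks :: "nat list \<Rightarrow> (nat \<Rightarrow> nat) \<Rightarrow> nat list"
  where "blocks \<alpha> \<sigma> = map (\<lambda>q. \<alpha> ! (Hilbert_Choice.inv \<sigma> (Suc q) - 1)) [0..<length \<alpha>]"

text \<open>Under the action of the inverse of \<open>\<sigma>\<close>, factor \<open>i\<close> of
  the product is tensor factor \<open>\<sigma> i\<close> of the coproduct. The word lists the
  intervals in this order and not from left to right.\<close>

definition p_word :: "nat list \<Rightarrow> (nat \<Rightarrow> nat) \<Rightarrow> (nat \<times> nat) list"
  where "p_word \<alpha> \<sigma> = concat (map (\<lambda>i. intervals 0 (blocks \<alpha> \<sigma>) ! (\<sigma> (Suc i) - 1)) [0..<length \<alpha>])"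

lemma length_blocks [simp]: "length (blocks \<alpha> \<sigma>) = length \<alpha>"
  by (simp add: blocks_def)

text \<open>Values of \<open>\<sigma>\<close> on \<open>{1..k}\<close> are positive, so the
  truncated subtraction that converts to list positions loses nothing.\<close>

lemma permutes_shift:
  assumes "\<sigma> permutes {1..k}" "q < k"
  shows "\<sigma> (Suc q) - 1 < k" "Suc (\<sigma> (Suc q) - 1) = \<sigma> (Suc q)"
  using permutes_in_image[OF assms(1), of "Suc q"] assms(2) by auto

text \<open>The left side says that no projection kills the tensor of the intervals with gaps
  \<open>bs\<close>, as the factor moved to place \<open>i\<close> has weight
  \<open>bs ! (\<sigma> (Suc i) - 1)\<close>. Substituting the inverse of \<open>\<sigma>\<close>
  solves these equations for \<open>bs\<close>, so a single term of the iterated coproduct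
  survives.\<close>

lemma blocks_unique:
  assumes "\<sigma> permutes {1..length \<alpha>}" "length bs = length \<alpha>"
  shows "(\<forall>i<length \<alpha>. \<alpha> ! i = bs ! (\<sigma> (Suc i) - 1)) \<longleftrightarrow> bs = blocks \<alpha> \<sigma>"
proof
  assume l: "\<forall>i<length \<alpha>. \<alpha> ! i = bs ! (\<sigma> (Suc i) - 1)"
  show "bs = blocks \<alpha> \<sigma>"
  proof (rule nth_equalityI)
    fix q assume "q < length bs"
    then have q: "q < length \<alpha>"
      using assms(2) by simp
    note s = permutes_shift[OF permutes_inv[OF assms(1)] q]
    show "bs ! q = blocks \<alpha> \<sigma> ! q"
      using l s q permutes_inverses(1)[OF assms(1)] by (simp add: blocks_def)
  qed (simp add: assms)
next
  assume bs: "bs = blocks \<alpha> \<sigma>"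
  show "\<forall>i<length \<alpha>. \<alpha> ! i = bs ! (\<sigma> (Suc i) - 1)"
    using permutes_shift[OF assms(1)] permutes_inverses(2)[OF assms(1)] by (simp add: bs blocks_def)
qed

lemma sum_list_blocks:
  assumes "\<sigma> permutes {1..length \<alpha>}"
  shows "sum_list (blocks \<alpha> \<sigma>) = sum_list \<alpha>"
proof -
  note s = permutes_shift[OF assms] and t = permutes_shift[OF permutes_inv[OF assms]]
  have "(\<Sum>q = 0..<length \<alpha>. \<alpha> ! (Hilbert_Choice.inv \<sigma> (Suc q) - 1)) = (\<Sum>i = 0..<length \<alpha>. \<alpha> ! i)"
    by (rule sum.reindex_bij_witness[where i="\<lambda>i. \<sigma> (Suc i) - 1" and j="\<lambda>q. Hilbert_Choice.inv \<sigma> (Suc q) - 1"])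
      (use s t permutes_inverses[OF assms] in auto)
  then show ?thesis
    by (simp add: sum_list_sum_nth blocks_def)
qed

text \<open>Parts of a composition are positive, so every surviving edge is a single letter and the
  concatenation has one letter for each part.\<close>

lemma p_word_eq:
  assumes "is_composition \<alpha>" "\<sigma> permutes {1..length \<alpha>}"
  defines "off \<equiv> \<lambda>q. sum_list (take q (blocks \<alpha> \<sigma>))"
  shows "p_word \<alpha> \<sigma> = map (\<lambda>i. (off (\<sigma> (Suc i) - 1), off (\<sigma> (Suc i) - 1) + \<alpha> ! i)) [0..<length \<alpha>]"
proof -
  have "\<forall>i<length \<alpha>. \<alpha> ! i = blocks \<alpha> \<sigma> ! (\<sigma> (Suc i) - 1)"
    using blocks_unique[OF assms(2)] by simp
  then have "intervals 0 (blocks \<alpha> \<sigma>) ! (\<sigma> (Suc i) - 1) = [(off (\<sigma> (Suc i) - 1), off (\<sigma> (Suc i) - 1) + \<alpha> ! i)]"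
    if "i < length \<alpha>" for i
    using that permutes_shift[OF assms(2) that] assms(1) nth_mem[OF that]
    by (auto simp: intervals_nth edge_def off_def is_composition_def)
  then have "map (\<lambda>i. intervals 0 (blocks \<alpha> \<sigma>) ! (\<sigma> (Suc i) - 1)) [0..<length \<alpha>] =
      map (\<lambda>i. [(off (\<sigma> (Suc i) - 1), off (\<sigma> (Suc i) - 1) + \<alpha> ! i)]) [0..<length \<alpha>]"
    by simp
  then show ?thesis
    by (simp only: p_word_def concat_map_singleton)
qed

text \<open>The word determines \<open>\<alpha>\<close> as the list of its interval lengths, and \<open>\<sigma>\<close> as the ranking of the
  left endpoints of its intervals.\<close>

lemma p_word_inj:
  assumes "is_composition \<alpha>" "\<sigma> permutes {1..length \<alpha>}" "is_composition \<beta>" "\<tau> permutes {1..length \<beta>}"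
    and "p_word \<alpha> \<sigma> = p_word \<beta> \<tau>"
  shows "\<alpha> = \<beta> \<and> \<sigma> = \<tau>"
proof -
  define off where "off \<alpha> \<sigma> q = sum_list (take q (blocks \<alpha> \<sigma>))" for \<alpha> \<sigma> q
  note word = p_word_eq[OF assms(1,2), folded off_def] p_word_eq[OF assms(3,4), folded off_def]
  have len: "length \<alpha> = length \<beta>"
    using arg_cong[OF assms(5), of length] by (simp add: word)
  have nth: "p_word \<alpha> \<sigma> ! i = p_word \<beta> \<tau> ! i" for i
    using assms(5) by simp
  have letter: "off \<alpha> \<sigma> (\<sigma> (Suc i) - 1) = off \<beta> \<tau> (\<tau> (Suc i) - 1)" "\<alpha> ! i = \<beta> ! i" if "i < length \<alpha>" for i
    using nth[of i] that len by (simp_all add: word)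
  have "\<alpha> = \<beta>"
    using len letter(2) by (intro nth_equalityI)
  have rank: "\<sigma> (Suc i) - 1 = card {j. j < length \<alpha> \<and> off \<alpha> \<sigma> (\<sigma> (Suc j) - 1) < off \<alpha> \<sigma> (\<sigma> (Suc i) - 1)}"
    if c: "is_composition \<alpha>" and \<sigma>: "\<sigma> permutes {1..length \<alpha>}" and i: "i < length \<alpha>" for \<alpha> \<sigma> i
  proof -
    note s = permutes_shift[OF \<sigma>] and t = permutes_shift[OF permutes_inv[OF \<sigma>]]
    have pos: "0 < b" if "b \<in> set (blocks \<alpha> \<sigma>)" for b
      using that c t by (auto simp: blocks_def is_composition_def)
    \<comment> \<open>Positive parts make the left endpoints strictly increasing from one interval
      to the next, so counting the smaller endpoints recovers the position of an interval.\<close>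
    have mono: "off \<alpha> \<sigma> q < off \<alpha> \<sigma> r" if "q < r" "r < length \<alpha>" for q r
    proof -
      have "off \<alpha> \<sigma> q < off \<alpha> \<sigma> (Suc q)"
        using that pos[OF nth_mem, of q] by (simp add: off_def take_Suc_conv_app_nth)
      also have "take r (blocks \<alpha> \<sigma>) = take (Suc q) (blocks \<alpha> \<sigma>) @ take (r - Suc q) (drop (Suc q) (blocks \<alpha> \<sigma>))"
        using that by (metis Suc_leI le_add_diff_inverse take_add)
      then have "off \<alpha> \<sigma> (Suc q) \<le> off \<alpha> \<sigma> r"
        by (simp add: off_def)
      finally show ?thesis .
    qed
    have less_iff: "off \<alpha> \<sigma> q < off \<alpha> \<sigma> r \<longleftrightarrow> q < r" if "q < length \<alpha>" "r < length \<alpha>" for q r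
      using mono[of q r] mono[of r q] that by (cases q r rule: linorder_cases) auto
    let ?m = "\<sigma> (Suc i) - 1"
    have "q < length \<alpha>" if "q < ?m" for q
      using that s(1)[OF i] by simp
    then have "bij_betw (\<lambda>j. \<sigma> (Suc j) - 1) {j. j < length \<alpha> \<and> \<sigma> (Suc j) - 1 < ?m} {..<?m}"
      by (intro bij_betw_byWitness[where f'="\<lambda>q. Hilbert_Choice.inv \<sigma> (Suc q) - 1"])
        (auto simp del: One_nat_def simp: s(2) t permutes_inverses[OF \<sigma>])
    moreover have "{j. j < length \<alpha> \<and> off \<alpha> \<sigma> (\<sigma> (Suc j) - 1) < off \<alpha> \<sigma> ?m} =
        {j. j < length \<alpha> \<and> \<sigma> (Suc j) - 1 < ?m}"
      using less_iff[OF s(1) s(1)[OF i]] by blast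
    ultimately show ?thesis
      using bij_betw_same_card by fastforce
  qed
  have "\<sigma> x = \<tau> x" for x
  proof (cases "x \<in> {1..length \<alpha>}")
    case True
    then obtain i where i: "x = Suc i" "i < length \<alpha>"
      by (cases x) auto
    have "\<sigma> (Suc i) - 1 = \<tau> (Suc i) - 1"
      using rank[OF assms(1,2) i(2)] rank[OF assms(3,4), of i] i(2) letter(1) len by (simp cong: conj_cong)
    then show ?thesis
      using permutes_shift(2)[OF assms(2) i(2)] permutes_shift(2)[OF assms(4), of i] i len by metis
  next
    case False
    then show ?thesis
      using assms(2,4) len by (simp add: permutes_not_in)
  qed
  with \<open>\<alpha> = \<beta>\<close> show ?thesis
    by auto
qed

section \<open>Values on generators and linear independence\<close>

context interval_hopf
begin

text \<open>Everything that follows the iterated coproduct is bundled into one linear map, which can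
  then be applied term by term to a sum of pure tensors.\<close>

lemma p_endo_linear_factor:
  assumes "\<sigma> permutes {1..length \<alpha>}"
  defines "Q \<equiv> \<lambda>X. iter_mult R H (tensor_map R H (map (graded_proj H) \<alpha>)
    (perm_action R H (length \<alpha>) (Hilbert_Choice.inv \<sigma>) X))"
  shows "Q \<in> linear_maps R (T (length \<alpha>)) H"
    and "xs \<in> tuples H (length \<alpha>) \<Longrightarrow> Q (pure_tensor R H xs) =
      foldr (\<otimes>\<^bsub>H\<^esub>) (map (\<lambda>i. graded_proj H (\<alpha> ! i) (xs ! (\<sigma> (Suc i) - 1))) [0..<length \<alpha>]) \<one>\<^bsub>H\<^esub>"
proof -
  let ?fs = "map (graded_proj H) \<alpha>"
  have fs: "multilinear R H (T (length \<alpha>)) (length \<alpha>)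
      (\<lambda>xs. pure_tensor R H (map (\<lambda>i. (?fs ! i) (xs ! i)) [0..<length \<alpha>]))"
    using H.tensor_map_multilinear[of ?fs] graded_proj_linear by auto
  note perm = H.perm_action_multilinear[OF assms(1)]
  \<comment> \<open>\<open>p_endo\<close> acts by the inverse of \<open>\<sigma>\<close>, and
    \<open>perm_action\<close> inverts its permutation again, so \<open>\<sigma>\<close> itself
    indexes the factors.\<close>
  have inv: "Hilbert_Choice.inv (Hilbert_Choice.inv \<sigma>) = \<sigma>"
    by (rule inv_inv_eq[OF permutes_bij[OF assms(1)]])
  have Q: "Q X = tensor_lift R H (\<lambda>xs. foldr (\<otimes>\<^bsub>H\<^esub>) xs \<one>\<^bsub>H\<^esub>)
      (tensor_lift R (T (length \<alpha>)) (\<lambda>xs. pure_tensor R H (map (\<lambda>i. (?fs ! i) (xs ! i)) [0..<length \<alpha>]))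
        (tensor_lift R (T (length \<alpha>)) (\<lambda>xs. pure_tensor R H (map (\<lambda>i. xs ! (\<sigma> i - 1)) [1..<Suc (length \<alpha>)])) X))" for X
    by (simp only: Q_def iter_mult_def tensor_map_def perm_action_def inv length_map)
  show "Q \<in> linear_maps R (T (length \<alpha>)) H"
    unfolding Q[abs_def]
    by (intro linear_maps_compose[OF H.tensor_lift_linear[OF H.tensor_power_module perm]]
        linear_maps_compose[OF H.tensor_lift_linear[OF H.tensor_power_module fs]]
        H.tensor_lift_linear[OF H_module H.iter_mult_multilinear])
  assume xs: "xs \<in> tuples H (length \<alpha>)"
  let ?ys = "map (\<lambda>i. xs ! (\<sigma> i - 1)) [1..<Suc (length \<alpha>)]"
  let ?zs = "map (\<lambda>i. graded_proj H (\<alpha> ! i) (xs ! (\<sigma> (Suc i) - 1))) [0..<length \<alpha>]"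
  have x: "xs ! (\<sigma> (Suc i) - 1) \<in> carrier H" if "i < length \<alpha>" for i
    using tuples_nth[OF xs permutes_shift(1)[OF assms(1) that]] .
  have ys_eq: "?ys = map (\<lambda>i. xs ! (\<sigma> (Suc i) - 1)) [0..<length \<alpha>]"
    by (intro nth_equalityI) (simp_all del: upt_Suc)
  have ys: "?ys \<in> tuples H (length \<alpha>)"
    unfolding ys_eq using x by (auto simp: tuples_def)
  have zs: "?zs \<in> tuples H (length \<alpha>)"
    using x linear_maps_closed[OF graded_proj_linear] by (auto simp: tuples_def)
  have "map (\<lambda>i. (?fs ! i) (?ys ! i)) [0..<length \<alpha>] = ?zs"
    unfolding ys_eq by simp
  then show "Q (pure_tensor R H xs) = foldr (\<otimes>\<^bsub>H\<^esub>) ?zs \<one>\<^bsub>H\<^esub>"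
    by (simp only: Q H.tensor_lift_pure[OF H.tensor_power_module perm xs]
        H.tensor_lift_pure[OF H.tensor_power_module fs ys] H.tensor_lift_pure[OF H_module H.iter_mult_multilinear zs])
qed

lemma p_word_closed:
  assumes "\<sigma> permutes {1..length \<alpha>}" "edge 0 (sum_list \<alpha>) \<in> lists L"
  shows "p_word \<alpha> \<sigma> \<in> lists L"
proof -
  have "set (intervals 0 (blocks \<alpha> \<sigma>)) \<subseteq> lists L"
    using assms by (intro intervals_closed) (simp add: sum_list_blocks)
  then have "intervals 0 (blocks \<alpha> \<sigma>) ! (\<sigma> (Suc i) - 1) \<in> lists L" if "i < length \<alpha>" for i
    using permutes_shift(1)[OF assms(1) that] nth_mem by (metis length_blocks length_intervals subsetD)
  then show ?thesis
    by (fastforce simp: p_word_def lists_eq_set)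
qed

text \<open>The projections kill all terms of the iterated coproduct except the one with gaps
  \<open>blocks \<alpha> \<sigma>\<close>. These gaps have the same sum as \<open>\<alpha>\<close>,
  so the term is present exactly when \<open>\<alpha>\<close> has size \<open>n\<close>.\<close>

lemma p_endo_edge:
  assumes "\<sigma> permutes {1..length \<alpha>}" "edge 0 n \<in> lists L"
  shows "p_endo R H \<alpha> \<sigma> (e (edge 0 n)) = (if sum_list \<alpha> = n then e (p_word \<alpha> \<sigma>) else \<zero>\<^bsub>H\<^esub>)"
proof -
  let ?k = "length \<alpha>"
  define Q where "Q = (\<lambda>X. iter_mult R H (tensor_map R H (map (graded_proj H) \<alpha>)
    (perm_action R H (length \<alpha>) (Hilbert_Choice.inv \<sigma>) X)))"
  note Q_linear = p_endo_linear_factor(1)[OF assms(1), folded Q_def]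
  have Q_pure: "Q (pure_tensor R H xs) =
      foldr (\<otimes>\<^bsub>H\<^esub>) (map (\<lambda>i. graded_proj H (\<alpha> ! i) (xs ! (\<sigma> (Suc i) - 1))) [0..<?k]) \<one>\<^bsub>H\<^esub>"
    if "xs \<in> tuples H ?k" for xs
    unfolding Q_def by (rule p_endo_linear_factor(2)[OF assms(1) that])
  have tup: "map e (intervals 0 bs) \<in> tuples H ?k" if "bs \<in> gap_lists ?k n" for bs
    using that assms(2) by (intro intervals_tuple) (auto simp: gap_lists_def)
  have Q_bs: "Q (pure_tensor R H (map e (intervals 0 bs))) =
      (if blocks \<alpha> \<sigma> = bs then e (p_word \<alpha> \<sigma>) else \<zero>\<^bsub>H\<^esub>)"
    if bs: "bs \<in> gap_lists ?k n" for bs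
  proof -
    have len: "length bs = ?k" and sum: "sum_list bs = n"
      using bs by (auto simp: gap_lists_def)
    let ?w = "\<lambda>i. intervals 0 bs ! (\<sigma> (Suc i) - 1)"
    have w: "?w i \<in> lists L" "weight (?w i) = bs ! (\<sigma> (Suc i) - 1)" if "i < ?k" for i
    proof -
      have q: "\<sigma> (Suc i) - 1 < length bs"
        using permutes_shift(1)[OF assms(1) that] len by simp
      have "set (intervals 0 bs) \<subseteq> lists L"
        using assms(2) sum by (intro intervals_closed) simp
      then show "?w i \<in> lists L"
        using q nth_mem[of "\<sigma> (Suc i) - 1" "intervals 0 bs"] by auto
      show "weight (?w i) = bs ! (\<sigma> (Suc i) - 1)"
        using q by (simp add: intervals_nth)
    qed
    have eq: "map (\<lambda>i. graded_proj H (\<alpha> ! i) (map e (intervals 0 bs) ! (\<sigma> (Suc i) - 1))) [0..<?k] =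
        map (\<lambda>i. if \<alpha> ! i = bs ! (\<sigma> (Suc i) - 1) then e (?w i) else \<zero>\<^bsub>H\<^esub>) [0..<?k]"
      using permutes_shift(1)[OF assms(1)] len w by (auto simp: graded_proj_e)
    have Q_eq: "Q (pure_tensor R H (map e (intervals 0 bs))) = foldr (\<otimes>\<^bsub>H\<^esub>)
        (map (\<lambda>i. if \<alpha> ! i = bs ! (\<sigma> (Suc i) - 1) then e (?w i) else \<zero>\<^bsub>H\<^esub>) [0..<?k]) \<one>\<^bsub>H\<^esub>"
      by (simp only: Q_pure[OF tup[OF bs]] eq)
    show ?thesis
    proof (cases "blocks \<alpha> \<sigma> = bs")
      case True
      then have map_eq: "map (\<lambda>i. if \<alpha> ! i = bs ! (\<sigma> (Suc i) - 1) then e (?w i) else \<zero>\<^bsub>H\<^esub>) [0..<?k] =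
          map e (map ?w [0..<?k])"
        using blocks_unique[OF assms(1) len] by auto
      have "Q (pure_tensor R H (map e (intervals 0 bs))) = e (p_word \<alpha> \<sigma>)"
        unfolding Q_eq map_eq p_word_def True using w by (intro foldr_mult_e) auto
      with True show ?thesis
        by simp
    next
      case False
      then obtain i where "i < ?k" "\<alpha> ! i \<noteq> bs ! (\<sigma> (Suc i) - 1)"
        using blocks_unique[OF assms(1) len] by auto
      then have "foldr (\<otimes>\<^bsub>H\<^esub>) (map (\<lambda>i. if \<alpha> ! i = bs ! (\<sigma> (Suc i) - 1) then e (?w i) else \<zero>\<^bsub>H\<^esub>) [0..<?k]) \<one>\<^bsub>H\<^esub> = \<zero>\<^bsub>H\<^esub>"
        using w by (intro foldr_mult_zero) auto
      with False show ?thesis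
        by (simp only: Q_eq if_False)
    qed
  qed
  \<comment> \<open>The form \<open>0 + n\<close> of the right endpoint matches
    \<open>iter_comult_edge\<close> with left endpoint \<open>0\<close>.\<close>
  have "p_endo R H \<alpha> \<sigma> (e (edge 0 n)) = Q (iter_comult R H ?k (e (edge 0 (0 + n))))"
    by (simp add: p_endo_def Q_def)
  also have "\<dots> = Q (\<Oplus>\<^bsub>T ?k\<^esub>bs\<in>gap_lists ?k n. pure_tensor R H (map e (intervals 0 bs)))"
    by (subst iter_comult_edge) (simp_all add: assms(2))
  also have "\<dots> = (\<Oplus>\<^bsub>H\<^esub>bs\<in>gap_lists ?k n. Q (pure_tensor R H (map e (intervals 0 bs))))"
    by (rule linear_maps_finsum[OF H.tensor_power_module H_module Q_linear])
      (intro Pi_I H.pure_tensor_closed tup)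
  also have "\<dots> = (if sum_list \<alpha> = n then e (p_word \<alpha> \<sigma>) else \<zero>\<^bsub>H\<^esub>)"
  proof (cases "sum_list \<alpha> = n")
    case True
    then have closed: "e (p_word \<alpha> \<sigma>) \<in> carrier H"
      using p_word_closed[OF assms(1)] assms(2) by simp
    then have "(\<Oplus>\<^bsub>H\<^esub>bs\<in>gap_lists ?k n. Q (pure_tensor R H (map e (intervals 0 bs)))) =
        (\<Oplus>\<^bsub>H\<^esub>bs\<in>gap_lists ?k n. if blocks \<alpha> \<sigma> = bs then e (p_word \<alpha> \<sigma>) else \<zero>\<^bsub>H\<^esub>)"
      by (intro H.M.finsum_cong' refl Q_bs) auto
    also have "\<dots> = e (p_word \<alpha> \<sigma>)"
      using True closed sum_list_blocks[OF assms(1)]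
      by (intro H.M.finsum_singleton finite_gap_lists) (auto simp: gap_lists_def)
    finally show ?thesis
      using True by simp
  next
    case False
    then have "blocks \<alpha> \<sigma> \<noteq> bs" if "bs \<in> gap_lists ?k n" for bs
      using that sum_list_blocks[OF assms(1)] by (auto simp: gap_lists_def)
    then have "(\<Oplus>\<^bsub>H\<^esub>bs\<in>gap_lists ?k n. Q (pure_tensor R H (map e (intervals 0 bs)))) = \<zero>\<^bsub>H\<^esub>"
      by (intro H.M.add.finprod_one_eqI) (simp add: Q_bs)
    with False show ?thesis
      by simp
  qed
  finally show ?thesis .
qed

text \<open>To isolate the coefficient at \<open>(\<beta>, \<tau>)\<close>, a relation is applied to
  the generator whose degree is the size of \<open>\<beta>\<close> and then evaluated at the word of
  \<open>(\<beta>, \<tau>)\<close>. The index set is left open so that both parts of the theorem are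
  instances.\<close>

lemma p_endo_lin_indep:
  assumes "I \<subseteq> {(\<alpha>, \<sigma>). is_composition \<alpha> \<and> \<sigma> permutes {1..length \<alpha>}}"
    and "\<And>\<alpha> \<sigma>. (\<alpha>, \<sigma>) \<in> I \<Longrightarrow> edge 0 (sum_list \<alpha>) \<in> lists L"
  shows "lin_indep_endos R H I (\<lambda>(\<alpha>, \<sigma>). p_endo R H \<alpha> \<sigma>)"
  unfolding lin_indep_endos_def
proof (intro allI impI ballI, elim conjE)
  fix J c z
  assume J: "finite J" "J \<subseteq> I" "c \<in> J \<rightarrow> carrier R" and z: "z \<in> J"
    and sum: "\<forall>x\<in>carrier H. (\<Oplus>\<^bsub>H\<^esub>i\<in>J. c i \<odot>\<^bsub>H\<^esub> (case i of (\<alpha>, \<sigma>) \<Rightarrow> p_endo R H \<alpha> \<sigma>) x) = \<zero>\<^bsub>H\<^esub>"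
  obtain \<beta> \<tau> where [simp]: "z = (\<beta>, \<tau>)"
    by (cases z)
  let ?n = "sum_list \<beta>"
  let ?x = "e (edge 0 ?n)" and ?w = "p_word \<beta> \<tau>"
  let ?p = "\<lambda>i. (case i of (\<alpha>, \<sigma>) \<Rightarrow> p_endo R H \<alpha> \<sigma>) ?x"
  have n: "edge 0 ?n \<in> lists L"
    using J z assms(2) by auto
  have p: "?p (\<alpha>, \<sigma>) = (if sum_list \<alpha> = ?n then e (p_word \<alpha> \<sigma>) else \<zero>\<^bsub>H\<^esub>)" if "(\<alpha>, \<sigma>) \<in> J" for \<alpha> \<sigma>
  proof -
    have "\<sigma> permutes {1..length \<alpha>}"
      using that J assms(1) by blast
    then show ?thesis
      using p_endo_edge[OF _ n] by simp
  qed
  have p_closed: "?p i \<in> carrier H" if "i \<in> J" for i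
  proof -
    obtain \<alpha> \<sigma> where i: "i = (\<alpha>, \<sigma>)"
      by (cases i)
    then have "p_word \<alpha> \<sigma> \<in> lists L"
      using that J assms by (intro p_word_closed) auto
    then show ?thesis
      using p[of \<alpha> \<sigma>] that i by simp
  qed
  \<comment> \<open>Pairs of another size give the zero function. Pairs of the same size give the
    indicator function of their word, which by injectivity vanishes at \<open>?w\<close> unless the
    pair is \<open>z\<close>.\<close>
  have p_apply: "c i \<otimes> ?p i ?w = (if z = i then c i else \<zero>)" if "i \<in> J" for i
  proof -
    obtain \<alpha> \<sigma> where i: "i = (\<alpha>, \<sigma>)"
      by (cases i)
    have inj: "p_word \<beta> \<tau> = p_word \<alpha> \<sigma> \<longleftrightarrow> \<beta> = \<alpha> \<and> \<tau> = \<sigma>"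
      using p_word_inj[of \<beta> \<tau> \<alpha> \<sigma>] that i z J assms(1) by auto
    have c: "c i \<in> carrier R"
      using that J by auto
    then show ?thesis
      using p[of \<alpha> \<sigma>] that by (auto simp: i inj free_gen_def H_pointwise)
  qed
  have "\<zero> = (\<Oplus>\<^bsub>H\<^esub>i\<in>J. c i \<odot>\<^bsub>H\<^esub> ?p i) ?w"
    using sum n by (simp add: H_pointwise)
  also have "\<dots> = (\<Oplus>i\<in>J. (c i \<odot>\<^bsub>H\<^esub> ?p i) ?w)"
    using J p_closed by (intro finsum_apply) auto
  also have "\<dots> = (\<Oplus>i\<in>J. if z = i then c i else \<zero>)"
    using J p_apply by (intro finsum_cong') (auto simp: H_pointwise)
  also have "\<dots> = c z"
    using J z by (intro finsum_singleton) auto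
  finally show "c z = \<zero>"
    by simp
qed

end


theorem theorem1p36:
  fixes R :: "('a, 'r) ring_scheme"
  assumes "cring R"
  shows "(\<exists>H :: ('a, (nat \<times> nat) list \<Rightarrow> 'a) graded_bialg.
            connected_graded_hopf_algebra R H \<and>
            lin_indep_endos R H
              {(\<alpha>, \<sigma>). is_composition \<alpha> \<and> \<sigma> permutes {1..length \<alpha>}}
              (\<lambda>(\<alpha>, \<sigma>). p_endo R H \<alpha> \<sigma>) \<and>
            (\<forall>m. \<exists>B. module_basis R (component_module H m) B)) \<and>
         (\<forall>n :: nat. \<exists>H :: ('a, (nat \<times> nat) list \<Rightarrow> 'a) graded_bialg.
            connected_graded_hopf_algebra R H \<and>
            lin_indep_endos R H
              {(\<alpha>, \<sigma>). is_composition \<alpha> \<and> sum_list \<alpha> < n \<and> \<sigma> permutes {1..length \<alpha>}}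
              (\<lambda>(\<alpha>, \<sigma>). p_endo R H \<alpha> \<sigma>) \<and>
            (\<forall>m. \<exists>B. finite B \<and> module_basis R (component_module H m) B))"
proof (intro conjI allI)
  interpret cring R by fact
  let ?L = "{(i, j). i < j} :: (nat \<times> nat) set"
  interpret interval_hopf R ?L
    by unfold_locales auto
  show "\<exists>H :: ('a, (nat \<times> nat) list \<Rightarrow> 'a) graded_bialg.
      connected_graded_hopf_algebra R H \<and>
      lin_indep_endos R H {(\<alpha>, \<sigma>). is_composition \<alpha> \<and> \<sigma> permutes {1..length \<alpha>}}
        (\<lambda>(\<alpha>, \<sigma>). p_endo R H \<alpha> \<sigma>) \<and>
      (\<forall>m. \<exists>B. module_basis R (component_module H m) B)"
  proof (intro exI[of _ "interval_bialg R ?L"] conjI allI H_hopf)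
    show "lin_indep_endos R H {(\<alpha>, \<sigma>). is_composition \<alpha> \<and> \<sigma> permutes {1..length \<alpha>}}
        (\<lambda>(\<alpha>, \<sigma>). p_endo R H \<alpha> \<sigma>)"
    proof (rule p_endo_lin_indep)
      \<comment> \<open>For \<open>m = 0\<close> the edge is the empty word: the empty composition
        is tested on the unit of the algebra.\<close>
      have "edge 0 m \<in> lists ?L" for m
        by (cases m) (auto simp: edge_def)
      then show "edge 0 (sum_list \<alpha>) \<in> lists ?L" for \<alpha> .
    qed auto
    show "\<exists>B. module_basis R (component_module H m) B" for m
      using graded_part_basis by blast
  qed
next
  interpret cring R by fact
  fix n :: nat
  \<comment> \<open>Bounding the right endpoint makes the alphabet finite and respects subintervals.
    All positive sizes to be tested are below \<open>n\<close>, so their generators are still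
    available.\<close>
  let ?L = "{(i, j). i < j \<and> j \<le> n} :: (nat \<times> nat) set"
  interpret interval_hopf R ?L
    by unfold_locales auto
  have "finite ?L"
    by (rule finite_subset[of _ "{..n} \<times> {..n}"]) auto
  note fin = finite_graded_words[OF this]
  show "\<exists>H :: ('a, (nat \<times> nat) list \<Rightarrow> 'a) graded_bialg.
      connected_graded_hopf_algebra R H \<and>
      lin_indep_endos R H {(\<alpha>, \<sigma>). is_composition \<alpha> \<and> sum_list \<alpha> < n \<and> \<sigma> permutes {1..length \<alpha>}}
        (\<lambda>(\<alpha>, \<sigma>). p_endo R H \<alpha> \<sigma>) \<and>
      (\<forall>m. \<exists>B. finite B \<and> module_basis R (component_module H m) B)"
  proof (intro exI[of _ "interval_bialg R ?L"] conjI allI H_hopf)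
    show "lin_indep_endos R H {(\<alpha>, \<sigma>). is_composition \<alpha> \<and> sum_list \<alpha> < n \<and> \<sigma> permutes {1..length \<alpha>}}
        (\<lambda>(\<alpha>, \<sigma>). p_endo R H \<alpha> \<sigma>)"
    proof (rule p_endo_lin_indep)
      have "edge 0 m \<in> lists ?L" if "m < n" for m
        using that by (cases m) (auto simp: edge_def)
      then show "edge 0 (sum_list \<alpha>) \<in> lists ?L"
        if "(\<alpha>, \<sigma>) \<in> {(\<alpha>, \<sigma>). is_composition \<alpha> \<and> sum_list \<alpha> < n \<and> \<sigma> permutes {1..length \<alpha>}}" for \<alpha> \<sigma>
        using that by blast
    qed auto
    show "\<exists>B. finite B \<and> module_basis R (component_module H m) B" for m
      using graded_part_basis finite_imageI[OF fin] by blast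
  qed
qed

end
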